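(* Let $\mathcal C: f=0$ be a reduced plane curve of degree $d$ in $\mathbb P^2$, with $f\in S=\mathbb C[x,y,z]$ homogeneous. If $r_0\le mdr(f)$ for some integer $r_0\ge 1$, then $$\tau(\mathcal C)\le (d-1)^2-r_0(d-r_0-1),$$ and equality holds if and only if $\mathcal C$ is free with exponents $(r_0,d-r_0-1)$. In particular, for fixed $d$ and $\tau$, the set $F(d,\tau)$ of free curves in the variety $C(d,\tau)\subset \mathbb P(S_d)$ of reduced plane curves of degree $d$ with global Tjurina number $\tau$ is a Zariski open subset of $C(d,\tau)$.
   Context: $S=\mathbb C[x,y,z]$ is graded, $S_r$ its degree $r$ part. For a reduced curve $f=0$, $mdr(f)$ (minimal degree of a Jacobian syzygy) is the smallest integer $r\ge 0$ such that there exist $a,b,c\in S_r$, not all zero, with $af_x+bf_y+cf_z=0$. The module of Jacobian syzygies $AR(f)=\{(a,b,c)\in S^3: af_x+bf_y+cf_z=0\}$ is a graded $S$-module; the curve is free if $AR(f)$ is a free $S$-module, necessarily of rank 2, generated by homogeneous syzygies of degrees $d_1\le d_2$ (the exponents). $\tau(\mathcal C)$ denotes the global (total) Tjurina number, i.e. the sum of the Tjurina numbers of all singular points of $\mathcal C$. *)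

theory Defs
  imports Complex_Main "HOL-Library.Poly_Mapping"
begin

text \<open>Multivariate polynomials over the complex numbers with variables indexed by type 'v:
  a polynomial is a finitely supported map from monomials (exponent vectors 'v =>0 nat)
  to coefficients. The ring S = C[x,y,z] is the set of polynomials in variables 0,1,2
  (x = variable 0, y = variable 1, z = variable 2).\<close>

type_synonym 'v cpoly = "('v \<Rightarrow>\<^sub>0 nat) \<Rightarrow>\<^sub>0 complex"
type_synonym mpoly = "nat cpoly"

definition mvars :: "'v cpoly \<Rightarrow> 'v set" where
  "mvars p = \<Union> (Poly_Mapping.keys ` Poly_Mapping.keys p)"

definition in_S :: "mpoly \<Rightarrow> bool" where
  "in_S p \<longleftrightarrow> mvars p \<subseteq> {0,1,2}"

definition tdeg :: "('v \<Rightarrow>\<^sub>0 nat) \<Rightarrow> nat" where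
  "tdeg m = (\<Sum>v\<in>Poly_Mapping.keys m. Poly_Mapping.lookup m v)"

text \<open>homogeneous of degree r (the zero polynomial is homogeneous of every degree)\<close>
definition homog :: "nat \<Rightarrow> 'v cpoly \<Rightarrow> bool" where
  "homog r p \<longleftrightarrow> (\<forall>m\<in>Poly_Mapping.keys p. tdeg m = r)"

definition const :: "complex \<Rightarrow> 'v cpoly" where
  "const c = Poly_Mapping.single 0 c"

definition Var :: "'v \<Rightarrow> 'v cpoly" where
  "Var i = Poly_Mapping.single (Poly_Mapping.single i 1) 1"

definition pderiv :: "'v \<Rightarrow> 'v cpoly \<Rightarrow> 'v cpoly" where
  "pderiv i p = (\<Sum>m\<in>Poly_Mapping.keys p.
      Poly_Mapping.single (m - Poly_Mapping.single i 1) (of_nat (Poly_Mapping.lookup m i) * Poly_Mapping.lookup p m))"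

definition meval :: "('v \<Rightarrow> complex) \<Rightarrow> 'v cpoly \<Rightarrow> complex" where
  "meval a p = (\<Sum>m\<in>Poly_Mapping.keys p. Poly_Mapping.lookup p m * (\<Prod>v\<in>Poly_Mapping.keys m. a v ^ Poly_Mapping.lookup m v))"

definition reduced :: "mpoly \<Rightarrow> bool" where
  "reduced f \<longleftrightarrow> f \<noteq> 0 \<and> (\<forall>g. g * g dvd f \<longrightarrow> Poly_Mapping.keys g \<subseteq> {0})"

definition fx :: "mpoly \<Rightarrow> mpoly" where "fx f = pderiv 0 f"
definition fy :: "mpoly \<Rightarrow> mpoly" where "fy f = pderiv 1 f"
definition fz :: "mpoly \<Rightarrow> mpoly" where "fz f = pderiv 2 f"

definition AR :: "mpoly \<Rightarrow> (mpoly \<times> mpoly \<times> mpoly) set" where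
  "AR f = {(a,b,c). in_S a \<and> in_S b \<and> in_S c \<and> a * fx f + b * fy f + c * fz f = 0}"

definition homog3 :: "nat \<Rightarrow> mpoly \<times> mpoly \<times> mpoly \<Rightarrow> bool" where
  "homog3 r \<rho> = (case \<rho> of (a,b,c) \<Rightarrow> homog r a \<and> homog r b \<and> homog r c)"

definition mdr :: "mpoly \<Rightarrow> nat" where
  "mdr f = (LEAST r. \<exists>\<rho>\<in>AR f. homog3 r \<rho> \<and> \<rho> \<noteq> (0,0,0))"

definition lincomb3 :: "mpoly \<Rightarrow> mpoly \<times> mpoly \<times> mpoly \<Rightarrow> mpoly \<Rightarrow> mpoly \<times> mpoly \<times> mpoly
    \<Rightarrow> mpoly \<times> mpoly \<times> mpoly" where
  "lincomb3 p \<rho>1 q \<rho>2 = (case \<rho>1 of (a1,b1,c1) \<Rightarrow> case \<rho>2 of (a2,b2,c2) \<Rightarrow>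
      (p*a1 + q*a2, p*b1 + q*b2, p*c1 + q*c2))"

definition free_exps :: "mpoly \<Rightarrow> nat \<Rightarrow> nat \<Rightarrow> bool" where
  "free_exps f d1 d2 \<longleftrightarrow> d1 \<le> d2 \<and>
     (\<exists>\<rho>1\<in>AR f. \<exists>\<rho>2\<in>AR f. homog3 d1 \<rho>1 \<and> \<rho>1 \<noteq> (0,0,0) \<and> homog3 d2 \<rho>2 \<and> \<rho>2 \<noteq> (0,0,0) \<and>
        (\<forall>\<rho>\<in>AR f. \<exists>!(p,q). in_S p \<and> in_S q \<and> \<rho> = lincomb3 p \<rho>1 q \<rho>2))"

definition is_free :: "mpoly \<Rightarrow> bool" where
  "is_free f \<longleftrightarrow> (\<exists>d1 d2. free_exps f d1 d2)"

definition gen_ideal :: "mpoly set \<Rightarrow> mpoly set" where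
  "gen_ideal G = {h. \<exists>F c. finite F \<and> F \<subseteq> G \<and> (\<forall>g\<in>F. in_S (c g)) \<and> h = (\<Sum>g\<in>F. c g * g)}"

definition codim :: "mpoly set \<Rightarrow> nat" where
  "codim I = (LEAST n. \<exists>B. finite B \<and> card B = n \<and> (\<forall>b\<in>B. in_S b) \<and>
       (\<forall>p. in_S p \<longrightarrow> (\<exists>c. p - (\<Sum>b\<in>B. const (c b) * b) \<in> I)))"

text \<open>points of P^2 as normalized representatives: first nonzero coordinate equal to 1\<close>
definition proj_pts :: "(nat \<Rightarrow> complex) set" where
  "proj_pts = {a. (\<forall>i>2. a i = 0) \<and> (\<exists>k\<le>2. a k = 1 \<and> (\<forall>j<k. a j = 0))}"

definition chart :: "(nat \<Rightarrow> complex) \<Rightarrow> nat" where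
  "chart a = (LEAST k. a k \<noteq> 0)"

definition Mpow :: "(nat \<Rightarrow> complex) \<Rightarrow> nat \<Rightarrow> mpoly set" where
  "Mpow a N = {(Var 0 - const (a 0))^i * (Var 1 - const (a 1))^j * (Var 2 - const (a 2))^k
                 | i j k. i + j + k = N}"

text \<open>local Tjurina number at a point a of P^2: in the affine chart x_k = 1 (a_k = 1) it is
  dim_C O_a/(g, g_u, g_v) (g the local equation), computed as the stable value of
  dim_C S/(f_x, f_y, f_z, x_k - 1, M_a^N) for N large\<close>
definition loc_tjurina :: "mpoly \<Rightarrow> (nat \<Rightarrow> complex) \<Rightarrow> nat" where
  "loc_tjurina f a = (THE t. \<exists>N0. \<forall>N\<ge>N0.
      codim (gen_ideal ({fx f, fy f, fz f, Var (chart a) - 1} \<union> Mpow a N)) = t)"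

definition sing_pts :: "mpoly \<Rightarrow> (nat \<Rightarrow> complex) set" where
  "sing_pts f = {a\<in>proj_pts. meval a (fx f) = 0 \<and> meval a (fy f) = 0 \<and> meval a (fz f) = 0}"

definition tjurina :: "mpoly \<Rightarrow> nat" where
  "tjurina f = (\<Sum>a\<in>sing_pts f. loc_tjurina f a)"

text \<open>C(d,tau): reduced plane curves of degree d with global Tjurina number tau
  (as nonzero polynomials; P(S_d) is obtained by scaling, all notions are scale invariant)\<close>
definition Cdt :: "nat \<Rightarrow> nat \<Rightarrow> mpoly set" where
  "Cdt d t = {f. in_S f \<and> homog d f \<and> f \<noteq> 0 \<and> reduced f \<and> tjurina f = t}"

definition Fdt :: "nat \<Rightarrow> nat \<Rightarrow> mpoly set" where
  "Fdt d t = {f\<in>Cdt d t. is_free f}"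

text \<open>monomials of degree d in x,y,z: the homogeneous coordinates of P(S_d)\<close>
definition Mon :: "nat \<Rightarrow> (nat \<Rightarrow>\<^sub>0 nat) set" where
  "Mon d = {m. Poly_Mapping.keys m \<subseteq> {0,1,2} \<and> tdeg m = d}"

text \<open>A \<subseteq> X \<subseteq> P(S_d) is Zariski open in X: A = X minus the common zero locus of a set G
  of homogeneous polynomials in the coefficients of S_d\<close>
definition zariski_open_in :: "nat \<Rightarrow> mpoly set \<Rightarrow> mpoly set \<Rightarrow> bool" where
  "zariski_open_in d A X \<longleftrightarrow> A \<subseteq> X \<and>
     (\<exists>G :: (nat \<Rightarrow>\<^sub>0 nat) cpoly set. (\<forall>P\<in>G. mvars P \<subseteq> Mon d \<and> (\<exists>k. homog k P)) \<and>
        (\<forall>f\<in>X. f \<in> A \<longleftrightarrow> (\<exists>P\<in>G. meval (Poly_Mapping.lookup f) P \<noteq> 0)))"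

end

theory Submission
  imports Defs "HOL-Library.Product_Plus" "HOL-Computational_Algebra.Computational_Algebra"
    "HOL-Computational_Algebra.Field_as_Ring" "Jordan_Normal_Form.Determinant"
begin

text \<open>
  Let \<open>w\<close> be the gradient of \<open>f\<close>, a triple of forms of degree \<open>e = d - 1\<close>, let \<open>J\<close> be the Jacobian
  ideal and \<open>\<rho>\<close> a syzygy of \<open>w\<close> of minimal degree \<open>r\<close>. As \<open>f\<close> is reduced, its partial derivatives are
  coprime, so that for each syzygy \<open>\<sigma>\<close> the cross product \<open>\<rho> \<times> \<sigma>\<close> is a multiple \<open>h w\<close> of \<open>w\<close>, and \<open>h = 0\<close>
  only for the multiples \<open>\<sigma>\<close> of \<open>\<rho>\<close>. Let \<open>I\<close> be the ideal of all these \<open>h\<close>. Counting dimensions,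
  \<open>dim (S/J)\<^sub>n + dim (S/I)\<^sub>m = e\<^sup>2 - r (e - r)\<close> for large \<open>n\<close>, where \<open>m = n + r - 2 e\<close>.

  The first term is eventually the total Tjurina number: dehomogenizing by a linear form that vanishes
  at no singular point turns \<open>S/J\<close> into a finite-dimensional algebra, the product of its local algebras.
  A general linear form is a nonzerodivisor modulo \<open>I\<close>, so the second term increases with \<open>m\<close>. This
  gives the bound for \<open>2 r \<le> e\<close>; equality forces \<open>1 \<in> I\<close>, and a \<open>\<sigma>\<close> with \<open>\<rho> \<times> \<sigma> = w\<close> completes \<open>\<rho>\<close> to a
  basis. If \<open>2 r > e\<close>, then \<open>I\<close> vanishes in degrees below \<open>2 r - e\<close>, which makes the bound strict.

  For given \<open>d\<close> and \<open>\<tau>\<close>, equality can hold for only one \<open>r0 \<le> e / 2\<close>, and the free curves are those without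
  syzygies of degree less than \<open>r0\<close>, which is an open condition.
\<close>

\<comment> \<open>The dimension count serves two triples: the gradient and the minimal syzygy \<rho>
  itself. Minimality makes the entries of \<rho> coprime, so the same bound on Hilbert functions
  shows that \<rho> has finitely many zeros. On a line that misses them \<rho> stays coprime, and
  this makes the equation of the line a nonzerodivisor modulo I.

  The obstacle beyond 2 r = e is that r (e - r) decreases there, so that the bound for r no longer
  implies the one for r0 \<le> r. The loss is recovered in degree n = 2 r - e - 1, the last one in
  which I is forced to vanish: subtracting dim S_n pushes the Tjurina number below 3/4 e^2, and e^2
  - r0 (e - r0) is at least 3/4 e^2 for every r0.

  Local Tjurina numbers live in coordinate charts that vary with the point, the global count in one
  generic chart. They are compared through the large graded pieces of S modulo J plus a power of the
  homogeneous ideal of the point, where no chart is left.\<close>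
alias keys = Poly_Mapping.keys
alias lookup = poly_mapping.lookup
alias single = Poly_Mapping.single

section \<open>Dimensions of quotients of vector spaces\<close>

locale quot_space = vector_space scale
  for scale :: "'a::field \<Rightarrow> 'b::ab_group_add \<Rightarrow> 'b" (infixr \<open>*s\<close> 75)
begin

definition spans_mod :: "'b set \<Rightarrow> 'b set \<Rightarrow> 'b set \<Rightarrow> bool" where
  "spans_mod V U C \<longleftrightarrow> finite C \<and> C \<subseteq> V \<and> V \<subseteq> span (C \<union> U)"

definition fin_quot :: "'b set \<Rightarrow> 'b set \<Rightarrow> bool" where
  "fin_quot V U \<longleftrightarrow> (\<exists>C. spans_mod V U C)"

text \<open>A least cardinality of spanning sets, the shape of \<open>codim\<close>, so that the two
  can be matched without a finiteness assumption. The value has a meaning only under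
  \<open>fin_quot\<close>.\<close>

definition qdim :: "'b set \<Rightarrow> 'b set \<Rightarrow> nat" where
  "qdim V U = (LEAST n. \<exists>C. spans_mod V U C \<and> card C = n)"

lemma span_subspace_eq: "subspace U \<Longrightarrow> span U = U"
  by simp

lemma qdim_le: "spans_mod V U C \<Longrightarrow> qdim V U \<le> card C"
  unfolding qdim_def by (rule Least_le) auto

lemma qdim_attained: "fin_quot V U \<Longrightarrow> \<exists>C. spans_mod V U C \<and> card C = qdim V U"
  unfolding qdim_def fin_quot_def by (rule LeastI_ex) auto

lemma fin_quotI: "spans_mod V U C \<Longrightarrow> fin_quot V U"
  unfolding fin_quot_def by auto

lemma spans_mod_iff:
  assumes "subspace U" "finite C"
  shows "V \<subseteq> span (C \<union> U) \<longleftrightarrow> (\<forall>v\<in>V. \<exists>a. v - (\<Sum>c\<in>C. a c *s c) \<in> U)"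
proof -
  have "v \<in> span (C \<union> U) \<longleftrightarrow> (\<exists>a. v - (\<Sum>c\<in>C. a c *s c) \<in> U)" for v
  proof
    assume "v \<in> span (C \<union> U)"
    then obtain x y where "x \<in> span C" "y \<in> U" "v = x + y"
      unfolding span_Un span_subspace_eq[OF assms(1)] by blast
    moreover from this obtain a where "x = (\<Sum>c\<in>C. a c *s c)"
      using span_finite[OF assms(2)] by auto
    ultimately show "\<exists>a. v - (\<Sum>c\<in>C. a c *s c) \<in> U" by (metis add_diff_cancel_left')
  next
    assume "\<exists>a. v - (\<Sum>c\<in>C. a c *s c) \<in> U"
    then obtain a where a: "v - (\<Sum>c\<in>C. a c *s c) \<in> U" by auto
    have "(\<Sum>c\<in>C. a c *s c) \<in> span (C \<union> U)"
      by (intro span_sum span_scale span_base) auto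
    moreover have "v - (\<Sum>c\<in>C. a c *s c) \<in> span (C \<union> U)" using a by (intro span_base) auto
    ultimately have "(\<Sum>c\<in>C. a c *s c) + (v - (\<Sum>c\<in>C. a c *s c)) \<in> span (C \<union> U)"
      by (rule span_add)
    then show "v \<in> span (C \<union> U)" by simp
  qed
  then show ?thesis by blast
qed

text \<open>Stands in for the quotient by \<open>U\<close>: extend a basis of \<open>U\<close> to
  the whole space and kill the vectors from \<open>U\<close>. Dimensions modulo \<open>U\<close>
  become dimensions of images.\<close>

lemma exists_linear_with_kernel:
  assumes U: "subspace U"
  shows "\<exists>P. Vector_Spaces.linear scale scale P \<and> (\<forall>v. P v = 0 \<longleftrightarrow> v \<in> U)"
proof -
  interpret pr: vector_space_pair scale scale ..
  obtain B where B: "B \<subseteq> U" "independent B" "U \<subseteq> span B"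
    by (rule maximal_independent_subset)
  have sB: "span B = U" using B U by (simp add: span_minimal subset_antisym)
  define E where "E = extend_basis B"
  have E: "B \<subseteq> E" "independent E" "span E = UNIV"
    using B by (auto simp: E_def extend_basis_superset independent_extend_basis)
  define P where "P = pr.construct E (\<lambda>b. if b \<in> B then 0 else b)"
  have lin: "Vector_Spaces.linear scale scale P" unfolding P_def by (rule pr.linear_construct[OF E(2)])
  have PB: "P b = 0" if "b \<in> B" for b
    using pr.construct_basis[OF E(2)] that E(1) by (auto simp: P_def)
  have PE: "P b = b" if "b \<in> E - B" for b
    using pr.construct_basis[OF E(2)] that E(1) by (auto simp: P_def)
  have idl: "Vector_Spaces.linear scale scale (\<lambda>x. x)" by (simp add: Vector_Spaces.linear_iff vector_space_axioms)
  have PU: "P u = 0" if "u \<in> U" for u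
    using pr.linear_eq_0_on_span[OF lin, of B u] PB that sB by auto
  have PW: "P w = w" if "w \<in> span (E - B)" for w
    by (rule pr.linear_eq_on[OF lin idl that PE])
  have "v \<in> U" if "P v = 0" for v
  proof -
    have "v \<in> span (B \<union> (E - B))" using E by (simp add: Un_absorb1)
    then obtain u w where uw: "u \<in> span B" "w \<in> span (E - B)" "v = u + w"
      unfolding span_Un by blast
    then have "P v = w" using PU PW sB by (simp add: pr.linear_add[OF lin])
    then show ?thesis using uw sB that by simp
  qed
  then show ?thesis using lin PU by blast
qed

lemma fin_quot_mono: "fin_quot V U \<Longrightarrow> U \<subseteq> U' \<Longrightarrow> fin_quot V U'"
  unfolding fin_quot_def spans_mod_def using span_mono[of "_ \<union> U" "_ \<union> U'"] by (meson Un_mono order_refl order_trans)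

lemma qdim_antimono:
  assumes "fin_quot V U" "U \<subseteq> U'"
  shows "qdim V U' \<le> qdim V U"
proof -
  obtain C where C: "spans_mod V U C" "card C = qdim V U" using qdim_attained assms by blast
  have "spans_mod V U' C" using C(1) span_mono[of "C \<union> U" "C \<union> U'"] assms(2)
    unfolding spans_mod_def by blast
  from qdim_le[OF this] C show ?thesis by simp
qed

lemma qdim_basis:
  assumes "independent B" "B \<subseteq> V" "V \<subseteq> span B" "finite B"
  shows "fin_quot V {0}" "qdim V {0} = card B"
proof -
  have B: "spans_mod V {0} B" using assms unfolding spans_mod_def by auto
  then show f: "fin_quot V {0}" by (rule fin_quotI)
  obtain C where C: "spans_mod V {0} C" "card C = qdim V {0}" using qdim_attained f by blast
  then have "B \<subseteq> span C" "finite C" using assms unfolding spans_mod_def by auto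
  then have "card B \<le> card C" using independent_span_bound[of C B] assms by auto
  then show "qdim V {0} = card B" using C qdim_le[OF B] by auto
qed

lemma qdim_eq_0_iff:
  assumes "fin_quot V U" "subspace U"
  shows "qdim V U = 0 \<longleftrightarrow> V \<subseteq> U"
proof
  assume "qdim V U = 0"
  then obtain C where "spans_mod V U C" "card C = 0" using qdim_attained assms by metis
  then have "C = {}" unfolding spans_mod_def by auto
  then show "V \<subseteq> U" using \<open>spans_mod V U C\<close> span_subspace_eq[OF assms(2)] unfolding spans_mod_def by (simp del: span_eq_iff)
next
  assume "V \<subseteq> U"
  then have "spans_mod V U {}" using span_superset[of U] unfolding spans_mod_def by auto
  from qdim_le[OF this] show "qdim V U = 0" by simp
qed

text \<open>Extend a basis \<open>B\<close> of \<open>U\<close> to a basis \<open>E\<close> of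
  \<open>V\<close>. The added vectors span \<open>V\<close> modulo \<open>U\<close>; conversely a
  spanning set modulo \<open>U\<close> together with \<open>B\<close> spans \<open>V\<close>, hence
  has at least \<open>card E\<close> elements.\<close>

lemma qdim_add_0:
  assumes U: "subspace U" and V: "subspace V" and UV: "U \<subseteq> V" and fin: "fin_quot V {0}"
  shows "fin_quot V U" "fin_quot U {0}" "qdim V {0} = qdim V U + qdim U {0}"
proof -
  obtain D where D: "spans_mod V {0} D" using fin unfolding fin_quot_def by blast
  obtain B where B: "B \<subseteq> U" "independent B" "U \<subseteq> span B"
    by (rule maximal_independent_subset)
  obtain E where E: "B \<subseteq> E" "E \<subseteq> V" "independent E" "V \<subseteq> span E"
    using maximal_independent_subset_extend[of B V] B(1,2) UV by blast
  have finE: "finite E" using independent_span_bound[of D E] D E unfolding spans_mod_def by auto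
  then have finB: "finite B" using E finite_subset by blast
  note bE = qdim_basis[OF E(3,2,4) finE] and bB = qdim_basis[OF B(2,1,3) finB]
  show f: "fin_quot V U" using fin_quot_mono[OF fin, of U] U by (simp add: subspace_0)
  show "fin_quot U {0}" by (rule bB)
  have sub: "V \<subseteq> span ((E - B) \<union> U)"
  proof -
    have "E \<subseteq> span ((E - B) \<union> U)" using B(1) by (intro subsetI span_base) auto
    then show ?thesis using E(4) span_minimal[OF _ subspace_span] by blast
  qed
  have EB: "spans_mod V U (E - B)" unfolding spans_mod_def using sub finE E by auto
  obtain C where C: "spans_mod V U C" "card C = qdim V U" using qdim_attained f by blast
  have "E \<subseteq> span (C \<union> B)"
  proof -
    have "U \<subseteq> span (C \<union> B)" using B(3) span_mono[of B "C \<union> B"] by auto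
    moreover have "C \<subseteq> span (C \<union> B)" by (intro subsetI span_base) auto
    ultimately have "span (C \<union> U) \<subseteq> span (C \<union> B)" by (intro span_minimal) auto
    then show ?thesis using C(1) E(2) unfolding spans_mod_def by auto
  qed
  then have "card E \<le> card (C \<union> B)" using independent_span_bound[of "C \<union> B" E] E finB C(1)
    unfolding spans_mod_def by auto
  then have "card E \<le> qdim V U + card B" using card_Un_le[of C B] C by linarith
  moreover have "qdim V U \<le> card E - card B"
    using qdim_le[OF EB] E(1) finE finB by (simp add: card_Diff_subset)
  moreover have "card B \<le> card E" using E(1) finE by (simp add: card_mono)
  ultimately show "qdim V {0} = qdim V U + qdim U {0}" using bE bB by linarith
qed

end

locale quot_space_pair = vs1: quot_space s1 + vs2: quot_space s2
  for s1 :: "'a::field \<Rightarrow> 'b::ab_group_add \<Rightarrow> 'b"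
  and s2 :: "'a \<Rightarrow> 'c::ab_group_add \<Rightarrow> 'c"
begin

sublocale vector_space_pair s1 s2 ..

lemma qdim_image:
  assumes lin: "Vector_Spaces.linear s1 s2 T" and TV: "T ` V \<subseteq> V'" and TU: "T ` U \<subseteq> U'"
    and sur: "\<And>v'. v' \<in> V' \<Longrightarrow> \<exists>v\<in>V. v' - T v \<in> U'" and fin: "vs1.fin_quot V U"
  shows "vs2.fin_quot V' U'" "vs2.qdim V' U' \<le> vs1.qdim V U"
proof -
  obtain C where C: "vs1.spans_mod V U C" "card C = vs1.qdim V U" using vs1.qdim_attained fin by blast
  have s: "vs2.spans_mod V' U' (T ` C)"
    unfolding vs2.spans_mod_def
  proof (intro conjI subsetI)
    show "finite (T ` C)" using C unfolding vs1.spans_mod_def by auto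
    show "x \<in> V'" if "x \<in> T ` C" for x using that TV C unfolding vs1.spans_mod_def by auto
    fix v' assume "v' \<in> V'"
    then obtain v where v: "v \<in> V" "v' - T v \<in> U'" using sur by blast
    have "T v \<in> T ` vs1.span (C \<union> U)" using v C unfolding vs1.spans_mod_def by auto
    also have "\<dots> = vs2.span (T ` (C \<union> U))" using linear_span_image[OF lin] by auto
    also have "\<dots> \<subseteq> vs2.span (T ` C \<union> U')" by (rule vs2.span_mono) (use TU in auto)
    finally have "T v \<in> vs2.span (T ` C \<union> U')" .
    moreover have "v' - T v \<in> vs2.span (T ` C \<union> U')" using v by (auto intro: vs2.span_base)
    ultimately have "T v + (v' - T v) \<in> vs2.span (T ` C \<union> U')" by (rule vs2.span_add)
    then show "v' \<in> vs2.span (T ` C \<union> U')" by simp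
  qed
  then show "vs2.fin_quot V' U'" by (rule vs2.fin_quotI)
  have "vs2.qdim V' U' \<le> card (T ` C)" by (rule vs2.qdim_le[OF s])
  also have "\<dots> \<le> card C" using C card_image_le unfolding vs1.spans_mod_def by blast
  finally show "vs2.qdim V' U' \<le> vs1.qdim V U" using C by simp
qed

lemma qdim_preimage:
  assumes lin: "Vector_Spaces.linear s1 s2 T" and V: "vs1.subspace V" and U: "vs1.subspace U" and U': "vs2.subspace U'"
    and inj: "\<And>v. v \<in> V \<Longrightarrow> T v \<in> U' \<Longrightarrow> v \<in> U" and TV: "T ` V \<subseteq> V'"
    and sur: "\<And>v'. v' \<in> V' \<Longrightarrow> \<exists>v\<in>V. v' - T v \<in> U'" and fin: "vs2.fin_quot V' U'"
  shows "vs1.fin_quot V U" "vs1.qdim V U \<le> vs2.qdim V' U'"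
proof -
  obtain C where C: "vs2.spans_mod V' U' C" "card C = vs2.qdim V' U'" using vs2.qdim_attained fin by blast
  then have finC: "finite C" and CV: "C \<subseteq> V'" unfolding vs2.spans_mod_def by auto
  have "\<forall>c\<in>C. \<exists>v\<in>V. c - T v \<in> U'" using sur CV by auto
  then obtain g where g: "\<And>c. c \<in> C \<Longrightarrow> g c \<in> V" "\<And>c. c \<in> C \<Longrightarrow> c - T (g c) \<in> U'" by metis
  have s: "vs1.spans_mod V U (g ` C)"
    unfolding vs1.spans_mod_def
  proof (intro conjI subsetI)
    show "finite (g ` C)" using finC by auto
    show "x \<in> V" if "x \<in> g ` C" for x using that g by auto
    fix v assume v: "v \<in> V"
    then have "T v \<in> V'" using TV by auto
    then obtain a where a: "T v - (\<Sum>c\<in>C. s2 (a c) c) \<in> U'"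
      using C vs2.spans_mod_iff[OF U' finC, of V'] unfolding vs2.spans_mod_def by blast
    define w where "w = (\<Sum>c\<in>C. s1 (a c) (g c))"
    have wV: "w \<in> V" unfolding w_def using V g by (intro vs1.subspace_sum vs1.subspace_scale) auto
    have "T w = (\<Sum>c\<in>C. s2 (a c) (T (g c)))" unfolding w_def
      by (simp add: linear_sum[OF lin] linear_scale[OF lin])
    then have "(\<Sum>c\<in>C. s2 (a c) c) - T w = (\<Sum>c\<in>C. s2 (a c) (c - T (g c)))"
      by (simp add: vs2.scale_right_diff_distrib sum_subtractf)
    also have "\<dots> \<in> U'" using U' g by (intro vs2.subspace_sum vs2.subspace_scale) auto
    finally have "(T v - (\<Sum>c\<in>C. s2 (a c) c)) + ((\<Sum>c\<in>C. s2 (a c) c) - T w) \<in> U'"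
      using a vs2.subspace_add[OF U'] by blast
    then have "T (v - w) \<in> U'" by (simp add: linear_diff[OF lin])
    then have "v - w \<in> U" using inj v wV vs1.subspace_diff[OF V] by blast
    then have "v - w \<in> vs1.span (g ` C \<union> U)" by (auto intro: vs1.span_base)
    moreover have "w \<in> vs1.span (g ` C \<union> U)"
      unfolding w_def by (intro vs1.span_sum vs1.span_scale vs1.span_base) auto
    ultimately have "(v - w) + w \<in> vs1.span (g ` C \<union> U)" by (rule vs1.span_add)
    then show "v \<in> vs1.span (g ` C \<union> U)" by simp
  qed
  then show "vs1.fin_quot V U" by (rule vs1.fin_quotI)
  have "vs1.qdim V U \<le> card (g ` C)" by (rule vs1.qdim_le[OF s])
  also have "\<dots> \<le> card C" using finC card_image_le by blast
  finally show "vs1.qdim V U \<le> vs2.qdim V' U'" using C by simp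
qed

text \<open>\<open>T\<close> induces an isomorphism of \<open>V / U\<close> with
  \<open>V' / U'\<close>, expressed without forming quotients; surjectivity is asked only modulo
  \<open>U'\<close>, which lets \<open>T\<close> be an inclusion.\<close>

lemma qdim_iso:
  assumes lin: "Vector_Spaces.linear s1 s2 T" and V: "vs1.subspace V" and U: "vs1.subspace U" and U': "vs2.subspace U'"
    and UV: "U \<subseteq> V" and TV: "T ` V \<subseteq> V'" and inj: "\<And>v. v \<in> V \<Longrightarrow> T v \<in> U' \<longleftrightarrow> v \<in> U"
    and sur: "\<And>v'. v' \<in> V' \<Longrightarrow> \<exists>v\<in>V. v' - T v \<in> U'"
  shows "vs1.fin_quot V U \<longleftrightarrow> vs2.fin_quot V' U'" "vs1.fin_quot V U \<Longrightarrow> vs1.qdim V U = vs2.qdim V' U'"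
proof -
  have TU: "T ` U \<subseteq> U'" using UV inj by auto
  show *: "vs1.fin_quot V U \<longleftrightarrow> vs2.fin_quot V' U'"
    using qdim_image(1)[OF lin TV TU sur] qdim_preimage(1)[OF lin V U U' _ TV sur] inj by blast
  show "vs1.qdim V U = vs2.qdim V' U'" if f: "vs1.fin_quot V U"
  proof (rule antisym)
    show "vs1.qdim V U \<le> vs2.qdim V' U'"
      using qdim_preimage(2)[OF lin V U U' _ TV sur] inj f * by blast
    show "vs2.qdim V' U' \<le> vs1.qdim V U"
      using qdim_image(2)[OF lin TV TU sur f] by blast
  qed
qed

end

context quot_space
begin

lemma linear_id': "Vector_Spaces.linear scale scale (\<lambda>x. x)"
  by (simp add: Vector_Spaces.linear_iff vector_space_axioms)

text \<open>A projection along \<open>W\<close> reduces all three quotients to the case of the zero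
  subspace.\<close>

lemma qdim_add:
  assumes W: "subspace W" and U: "subspace U" and V: "subspace V" and WU: "W \<subseteq> U" and UV: "U \<subseteq> V"
    and fin: "fin_quot V W"
  shows "fin_quot V U" "fin_quot U W" "qdim V W = qdim V U + qdim U W"
proof -
  interpret pr: quot_space_pair scale scale ..
  obtain P where P: "Vector_Spaces.linear scale scale P" "\<And>v. P v = 0 \<longleftrightarrow> v \<in> W"
    using exists_linear_with_kernel[OF W] by blast
  note sP = pr.linear_subspace_image[OF P(1)]
  have sm: "\<exists>v\<in>V. v' - P v \<in> U'" if "v' \<in> P ` V" "subspace U'" for v' V U'
    using that by (auto simp: subspace_0 intro!: bexI)
  have PU: "P v \<in> P ` U \<longleftrightarrow> v \<in> U" for v
  proof
    assume "P v \<in> P ` U"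
    then obtain u where u: "u \<in> U" "P v = P u" by blast
    then have "P (v - u) = 0" by (simp add: pr.linear_diff[OF P(1)])
    then have "v - u \<in> U" using P WU by blast
    then have "(v - u) + u \<in> U" using u U subspace_add by blast
    then show "v \<in> U" by simp
  qed auto
  note i1 = pr.qdim_iso[OF P(1) V W, of "{0}" "P ` V"]
  have VW: "fin_quot V W \<longleftrightarrow> fin_quot (P ` V) {0}" "fin_quot V W \<Longrightarrow> qdim V W = qdim (P ` V) {0}"
    using i1 P WU UV sm[OF _ subspace_single_0] by (auto simp: subspace_single_0)
  note i2 = pr.qdim_iso[OF P(1) U W, of "{0}" "P ` U"]
  have UW: "fin_quot U W \<longleftrightarrow> fin_quot (P ` U) {0}" "fin_quot U W \<Longrightarrow> qdim U W = qdim (P ` U) {0}"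
    using i2 P WU sm[OF _ subspace_single_0] by (auto simp: subspace_single_0)
  note i3 = pr.qdim_iso[OF P(1) V U sP[OF U] UV order_refl[of "P ` V"] PU sm[OF _ sP[OF U]]]
  note a = qdim_add_0[OF sP[OF U] sP[OF V] image_mono[OF UV]]
  show "fin_quot V U" using fin fin_quot_mono WU by blast
  show "fin_quot U W" using a(2) fin VW UW by blast
  then show "qdim V W = qdim V U + qdim U W"
    using a fin VW UW i3 by (metis (no_types))
qed

lemma fin_quot_trans:
  assumes "fin_quot V U" "fin_quot U W" "U \<subseteq> V"
  shows "fin_quot V W"
proof -
  obtain C where C: "spans_mod V U C" using assms unfolding fin_quot_def by blast
  obtain D where D: "spans_mod U W D" using assms unfolding fin_quot_def by blast
  have "U \<subseteq> span ((C \<union> D) \<union> W)"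
    using D span_mono[of "D \<union> W" "(C \<union> D) \<union> W"] unfolding spans_mod_def by auto
  moreover have "C \<subseteq> span ((C \<union> D) \<union> W)" by (intro subsetI span_base) auto
  ultimately have "span (C \<union> U) \<subseteq> span ((C \<union> D) \<union> W)" by (intro span_minimal) auto
  then have "V \<subseteq> span ((C \<union> D) \<union> W)" using C unfolding spans_mod_def by auto
  then have "spans_mod V W (C \<union> D)" using C D assms(3) unfolding spans_mod_def by auto
  then show ?thesis by (rule fin_quotI)
qed

text \<open>Chinese remaindering in dimensions: \<open>I / (I \<inter> K)\<close> is isomorphic to
  the whole space modulo \<open>K\<close>, as \<open>I\<close> and \<open>K\<close> together span
  everything.\<close>

lemma qdim_comax:
  assumes I: "subspace I" and K: "subspace K" and IK: "\<And>v. \<exists>x\<in>I. \<exists>y\<in>K. v = x + y"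
    and fI: "fin_quot UNIV I" and fK: "fin_quot UNIV K"
  shows "fin_quot UNIV (I \<inter> K)" "qdim UNIV (I \<inter> K) = qdim UNIV I + qdim UNIV K"
proof -
  interpret pr: quot_space_pair scale scale ..
  have IKs: "subspace (I \<inter> K)" using I K by (simp add: subspace_inter)
  have sur: "\<exists>v\<in>I. v' - v \<in> K" for v' using IK[of v'] by force
  note iso = pr.qdim_iso[OF linear_id' I IKs K, of UNIV]
  have f: "fin_quot I (I \<inter> K)" and e: "qdim I (I \<inter> K) = qdim UNIV K"
    using iso sur fK by auto
  have "fin_quot UNIV (I \<inter> K)" by (rule fin_quot_trans[OF fI f subset_UNIV])
  then show F: "fin_quot UNIV (I \<inter> K)" .
  show "qdim UNIV (I \<inter> K) = qdim UNIV I + qdim UNIV K"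
    using qdim_add(3)[OF IKs I subspace_UNIV _ _ F] e by simp
qed

lemma card_le_qdim:
  assumes U: "subspace U" and fin: "fin_quot V U" and F: "finite F" and gV: "\<And>a. a \<in> F \<Longrightarrow> g a \<in> V"
    and ind: "\<And>u a. (\<Sum>a\<in>F. u a *s g a) \<in> U \<Longrightarrow> a \<in> F \<Longrightarrow> u a = 0"
  shows "card F \<le> qdim V U"
proof -
  interpret pr: quot_space_pair scale scale ..
  obtain P where P: "Vector_Spaces.linear scale scale P" "\<And>v. P v = 0 \<longleftrightarrow> v \<in> U"
    using exists_linear_with_kernel[OF U] by blast
  obtain C where C: "spans_mod V U C" "card C = qdim V U" using qdim_attained fin by blast
  have finC: "finite C" using C unfolding spans_mod_def by blast
  have Psum: "P (\<Sum>a\<in>F. u a *s g a) = (\<Sum>a\<in>F. u a *s P (g a))" for u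
    by (simp add: pr.linear_sum[OF P(1)] pr.linear_scale[OF P(1)])
  have ind': "u a = 0" if "(\<Sum>a\<in>F. u a *s P (g a)) = 0" "a \<in> F" for u a
    using ind[of u a] that P(2) Psum[of u] by simp
  have inj: "inj_on (\<lambda>a. P (g a)) F"
  proof (rule inj_onI, rule ccontr)
    fix a b assume ab: "a \<in> F" "b \<in> F" "P (g a) = P (g b)" "a \<noteq> b"
    have "(\<Sum>k\<in>F. (if k = a then 1 else if k = b then -1 else 0) *s P (g k))
      = (\<Sum>k\<in>F. (if k = a then P (g a) else 0) - (if k = b then P (g b) else 0))"
      using ab by (intro sum.cong) auto
    also have "\<dots> = 0" using ab F by (simp add: sum_subtractf)
    finally show False using ind'[OF _ ab(1)] by fastforce
  qed
  let ?S = "(\<lambda>a. P (g a)) ` F"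
  have "independent ?S"
  proof (rule independent_if_scalars_zero)
    fix u x assume s: "(\<Sum>x\<in>?S. u x *s x) = 0" and x: "x \<in> ?S"
    have "(\<Sum>a\<in>F. u (P (g a)) *s P (g a)) = 0"
      using s sum.reindex[OF inj, of "\<lambda>x. u x *s x"] by (simp add: o_def)
    from ind'[OF this] show "u x = 0" using x by auto
  qed (use F in auto)
  moreover have "?S \<subseteq> span (P ` C)"
  proof clarify
    fix a assume "a \<in> F"
    then have "g a \<in> span (C \<union> U)" using gV C unfolding spans_mod_def by auto
    then obtain y u where "y \<in> span C" "u \<in> U" "g a = y + u" unfolding span_Un span_subspace_eq[OF U] by blast
    then show "P (g a) \<in> span (P ` C)"
      using P(2)[of u] pr.linear_span_image[OF P(1), of C] by (auto simp: pr.linear_add[OF P(1)])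
  qed
  ultimately have "card ?S \<le> card (P ` C)" using independent_span_bound finC by blast
  also have "\<dots> \<le> card C" using finC card_image_le by blast
  finally show ?thesis using C card_image[OF inj] by simp
qed

text \<open>One more vector than the dimension suffices. The vectors may repeat, so the dependence
  is stated for indices.\<close>

lemma exists_dependent_combination:
  fixes v :: "nat \<Rightarrow> 'b"
  assumes U: "subspace U" and fin: "fin_quot UNIV U"
  shows "\<exists>n a. (\<exists>i\<le>n. a i \<noteq> 0) \<and> (\<Sum>i\<le>n. a i *s v i) \<in> U"
proof (rule ccontr)
  assume no: "\<not> ?thesis"
  have "card {..qdim UNIV U} \<le> qdim UNIV U"
    by (rule card_le_qdim[OF U fin, of _ v]) (use no in \<open>auto\<close>)
  then show False by simp
qed

end

context quot_space_pair
begin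

text \<open>The injection identifies \<open>V / U\<close> with \<open>W / U'\<close>, where
  \<open>W\<close> is the sum of the image of \<open>V\<close> and \<open>U'\<close>.\<close>

lemma qdim_inj_mono:
  assumes lin: "Vector_Spaces.linear s1 s2 T" and V: "vs1.subspace V" and U: "vs1.subspace U"
    and V': "vs2.subspace V'" and U': "vs2.subspace U'" and UV: "U \<subseteq> V" and UV': "U' \<subseteq> V'"
    and TV: "T ` V \<subseteq> V'" and inj: "\<And>v. v \<in> V \<Longrightarrow> T v \<in> U' \<longleftrightarrow> v \<in> U" and fin: "vs2.fin_quot V' U'"
  shows "vs1.qdim V U \<le> vs2.qdim V' U'"
proof -
  define W where "W = {x + y | x y. x \<in> T ` V \<and> y \<in> U'}"
  have W: "vs2.subspace W" unfolding W_def
    by (rule vs2.subspace_sums[OF linear_subspace_image[OF lin V] U'])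
  have WV: "W \<subseteq> V'" using TV UV' vs2.subspace_add[OF V'] unfolding W_def by blast
  have UW: "U' \<subseteq> W" unfolding W_def using linear_0[OF lin] vs1.subspace_0[OF V] by force
  have TW: "T ` V \<subseteq> W" unfolding W_def using vs2.subspace_0[OF U'] by force
  have sur: "\<exists>v\<in>V. v' - T v \<in> U'" if "v' \<in> W" for v' using that unfolding W_def by force
  note a = vs2.qdim_add[OF U' W V' UW WV fin]
  have "vs1.qdim V U = vs2.qdim W U'"
    using qdim_iso[OF lin V U U' UV TW inj sur] a by blast
  then show ?thesis using a by linarith
qed

end

section \<open>The graded ring of polynomials in three variables\<close>

definition mono_val :: "('v \<Rightarrow> 'r::comm_monoid_mult) \<Rightarrow> ('v \<Rightarrow>\<^sub>0 nat) \<Rightarrow> 'r" where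
  "mono_val v m = (\<Prod>i\<in>keys m. v i ^ lookup m i)"

definition ev :: "(complex \<Rightarrow> 'r::comm_ring_1) \<Rightarrow> ('v \<Rightarrow> 'r) \<Rightarrow> 'v cpoly \<Rightarrow> 'r" where
  "ev \<kappa> v p = (\<Sum>m\<in>keys p. \<kappa> (lookup p m) * mono_val v m)"

lemma mono_val_superset:
  assumes "finite A" "keys m \<subseteq> A"
  shows "mono_val v m = (\<Prod>i\<in>A. v i ^ lookup m i)"
  unfolding mono_val_def
  by (rule prod.mono_neutral_left) (use assms in \<open>auto simp: in_keys_iff\<close>)

lemma mono_val_add: "mono_val v (m + n) = mono_val v m * mono_val v n"
proof -
  let ?A = "keys m \<union> keys n"
  have "mono_val v (m + n) = (\<Prod>i\<in>?A. v i ^ lookup (m + n) i)"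
    by (rule mono_val_superset) (auto dest: subsetD[OF Poly_Mapping.keys_add])
  also have "\<dots> = (\<Prod>i\<in>?A. v i ^ lookup m i) * (\<Prod>i\<in>?A. v i ^ lookup n i)"
    by (simp add: lookup_add power_add prod.distrib)
  also have "\<dots> = mono_val v m * mono_val v n"
    using mono_val_superset[of ?A m v] mono_val_superset[of ?A n v] by simp
  finally show ?thesis .
qed

lemma mono_val_0 [simp]: "mono_val v 0 = 1"
  by (simp add: mono_val_def)

lemma mono_val_single: "mono_val v (single i n) = v i ^ n"
  by (simp add: mono_val_def)

lemma sum_single_lookup:
  "(\<Sum>m\<in>keys p. single m (lookup p m)) = (p :: 'v cpoly)"
  by (rule poly_mapping_eqI) (auto simp: lookup_sum lookup_single when_def in_keys_iff)

text \<open>Two embeddings of the coefficients matter: the identity, which gives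
  \<open>meval\<close>, and \<open>K\<close>, which gives the passage to the iterated polynomial
  ring.\<close>

locale scalar_hom =
  fixes \<kappa> :: "complex \<Rightarrow> 'r::comm_ring_1"
  assumes emb_0: "\<kappa> 0 = 0" and emb_1: "\<kappa> 1 = 1"
    and emb_add: "\<kappa> (a + b) = \<kappa> a + \<kappa> b" and emb_mult: "\<kappa> (a * b) = \<kappa> a * \<kappa> b"
begin

lemma ev_superset:
  assumes "finite A" "keys p \<subseteq> A"
  shows "ev \<kappa> v p = (\<Sum>m\<in>A. \<kappa> (lookup p m) * mono_val v m)"
  unfolding ev_def
  by (rule sum.mono_neutral_left) (use assms in \<open>auto simp: in_keys_iff emb_0\<close>)

lemma ev_add: "ev \<kappa> v (p + q) = ev \<kappa> v p + ev \<kappa> v q"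
proof -
  let ?A = "keys p \<union> keys q"
  have "ev \<kappa> v (p + q) = (\<Sum>m\<in>?A. \<kappa> (lookup (p + q) m) * mono_val v m)"
    by (rule ev_superset) (auto dest: subsetD[OF Poly_Mapping.keys_add])
  also have "\<dots> = (\<Sum>m\<in>?A. \<kappa> (lookup p m) * mono_val v m)
      + (\<Sum>m\<in>?A. \<kappa> (lookup q m) * mono_val v m)"
    by (simp add: lookup_add emb_add distrib_right sum.distrib)
  also have "\<dots> = ev \<kappa> v p + ev \<kappa> v q"
    using ev_superset[of ?A p v] ev_superset[of ?A q v] by simp
  finally show ?thesis .
qed

lemma ev_0 [simp]: "ev \<kappa> v 0 = 0"
  by (simp add: ev_def)

lemma ev_sum: "ev \<kappa> v (sum g A) = (\<Sum>a\<in>A. ev \<kappa> v (g a))"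
  by (induction A rule: infinite_finite_induct) (auto simp: ev_add)

lemma ev_single: "ev \<kappa> v (single m c) = \<kappa> c * mono_val v m"
  by (cases "c = 0") (auto simp: ev_def emb_0)

lemma ev_mult: "ev \<kappa> v (p * q) = ev \<kappa> v p * ev \<kappa> v q"
proof -
  let ?s = "\<lambda>p m. single m (lookup p m)"
  have "ev \<kappa> v (p * q)
    = ev \<kappa> v ((\<Sum>m\<in>keys p. ?s p m) * (\<Sum>n\<in>keys q. ?s q n))"
    by (simp only: sum_single_lookup)
  also have "\<dots> = (\<Sum>m\<in>keys p. \<Sum>n\<in>keys q.
      (\<kappa> (lookup p m) * mono_val v m) * (\<kappa> (lookup q n) * mono_val v n))"
    by (simp add: sum_product ev_sum mult_single ev_single mono_val_add emb_mult mult_ac)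
  also have "\<dots> = ev \<kappa> v p * ev \<kappa> v q"
    by (simp add: ev_def sum_product)
  finally show ?thesis .
qed

lemma ev_1 [simp]: "ev \<kappa> v 1 = 1"
  by (simp add: ev_def emb_1)

lemma ev_const: "ev \<kappa> v (const c) = \<kappa> c"
  by (simp add: const_def ev_single)

lemma ev_Var: "ev \<kappa> v (Var i) = v i"
  by (simp add: Var_def ev_single mono_val_single emb_1)

lemma ev_uminus: "ev \<kappa> v (- p) = - ev \<kappa> v p"
  using ev_add[of v p "- p"] by (simp add: eq_neg_iff_add_eq_0 add.commute)

lemma ev_diff: "ev \<kappa> v (p - q) = ev \<kappa> v p - ev \<kappa> v q"
  using ev_add[of v p "- q"] by (simp add: ev_uminus)

lemma ev_power: "ev \<kappa> v (p ^ n) = ev \<kappa> v p ^ n"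
  by (induction n) (auto simp: ev_mult)

end

interpretation cid: scalar_hom "\<lambda>c. c"
  by standard auto

lemma meval_eq_ev: "meval a p = ev (\<lambda>c. c) a p"
  by (simp add: meval_def ev_def mono_val_def)

type_synonym R = "complex poly poly poly"

text \<open>\<open>R\<close> is \<open>C[x,y,z]\<close> as an iterated univariate polynomial ring, \<open>x\<close> being the outermost variable:
  this gives unique factorization and evaluation from the library.\<close>

definition K :: "complex \<Rightarrow> R" where "K c = [:[:[:c:]:]:]"
definition X :: R where "X = [:0, 1:]"
definition Y :: R where "Y = [:[:0, 1:]:]"
definition Z :: R where "Z = [:[:[:0, 1:]:]:]"

interpretation KR: scalar_hom K
  by standard (auto simp: K_def one_pCons)

lemmas K_0 = KR.emb_0 and K_1 = KR.emb_1 and K_add = KR.emb_add and K_mult = KR.emb_mult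

lemma K_diff: "K (a - b) = K a - K b" and K_uminus: "K (- a) = - K a"
  by (auto simp: K_def)

lemma K_eq_0_iff [simp]: "K a = 0 \<longleftrightarrow> a = 0"
  by (simp add: K_def)

definition cf :: "R \<Rightarrow> nat \<Rightarrow> nat \<Rightarrow> nat \<Rightarrow> complex" where
  "cf p i j k = coeff (coeff (coeff p i) j) k"

lemma R_eqI: "(\<And>i j k. cf p i j k = cf q i j k) \<Longrightarrow> p = q"
  by (intro poly_eqI) (auto simp: cf_def)

lemma cf_add [simp]: "cf (p + q) i j k = cf p i j k + cf q i j k"
  and cf_diff [simp]: "cf (p - q) i j k = cf p i j k - cf q i j k"
  and cf_uminus [simp]: "cf (- p) i j k = - cf p i j k"
  and cf_0 [simp]: "cf 0 i j k = 0"
  and cf_K_mult [simp]: "cf (K c * p) i j k = c * cf p i j k"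
  by (auto simp: cf_def K_def)

lemma cf_sum: "cf (sum g A) i j k = (\<Sum>a\<in>A. cf (g a) i j k)"
  by (induction A rule: infinite_finite_induct) auto

definition M :: "nat \<Rightarrow> nat \<Rightarrow> nat \<Rightarrow> R" where
  "M i j k = X ^ i * Y ^ j * Z ^ k"

lemma M_eq_monom: "M i j k = monom (monom (monom 1 k) j) i"
proof -
  have "X ^ i = monom 1 i" by (simp add: X_def monom_altdef)
  moreover have "Y ^ j = [:monom 1 j:]" by (simp add: Y_def monom_altdef poly_const_pow)
  moreover have "Z ^ k = [:[:monom 1 k:]:]" by (simp add: Z_def monom_altdef poly_const_pow)
  ultimately show ?thesis by (simp add: M_def mult.commute smult_monom)
qed

lemma cf_M: "cf (M i j k) i' j' k' = (if i = i' \<and> j = j' \<and> k = k' then 1 else 0)"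
  by (simp add: M_eq_monom cf_def)

text \<open>Variables of index above 2 are sent to 0, so \<open>\<Phi>\<close> is injective on
  \<open>in_S\<close> only.\<close>

definition vars3 :: "nat \<Rightarrow> R" where
  "vars3 i = (if i = 0 then X else if i = 1 then Y else if i = 2 then Z else 0)"

definition \<Phi> :: "mpoly \<Rightarrow> R" where "\<Phi> = ev K vars3"

definition expo :: "nat \<Rightarrow> nat \<Rightarrow> nat \<Rightarrow> nat \<Rightarrow>\<^sub>0 nat" where
  "expo i j k = single 0 i + single 1 j + single 2 k"

lemma lookup_expo: "lookup (expo i j k) v =
    (if v = 0 then i else if v = 1 then j else if v = 2 then k else 0)"
  by (auto simp: expo_def lookup_add lookup_single when_def)

lemma expo_inject [simp]: "expo i j k = expo i' j' k' \<longleftrightarrow> i = i' \<and> j = j' \<and> k = k'"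
  by (metis lookup_expo one_neq_zero zero_neq_numeral one_eq_numeral_iff semiring_norm(83))

lemma expo_lookup:
  assumes "keys m \<subseteq> {0,1,2}"
  shows "m = expo (lookup m 0) (lookup m 1) (lookup m 2)"
  by (rule poly_mapping_eqI) (use assms in \<open>auto simp: lookup_expo in_keys_iff\<close>)

lemma mono_val_expo: "mono_val v (expo i j k) = v 0 ^ i * v 1 ^ j * v 2 ^ k"
  by (simp add: expo_def mono_val_add mono_val_single)

lemma mono_val_vars3: "mono_val vars3 (expo i j k) = M i j k"
  by (simp add: mono_val_expo vars3_def M_def)

lemma tdeg_superset:
  assumes "finite A" "keys m \<subseteq> A"
  shows "tdeg m = (\<Sum>i\<in>A. lookup m i)"
  unfolding tdeg_def
  by (rule sum.mono_neutral_left) (use assms in \<open>auto simp: in_keys_iff\<close>)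

lemma tdeg_add: "tdeg (m + n) = tdeg m + tdeg n"
proof -
  let ?A = "keys m \<union> keys n"
  have "tdeg (m + n) = (\<Sum>i\<in>?A. lookup (m + n) i)"
    by (rule tdeg_superset) (auto dest: subsetD[OF Poly_Mapping.keys_add])
  then show ?thesis
    using tdeg_superset[of ?A m] tdeg_superset[of ?A n] by (simp add: lookup_add sum.distrib)
qed

lemma tdeg_single [simp]: "tdeg (single i n) = n"
  by (simp add: tdeg_def)

lemma tdeg_expo: "tdeg (expo i j k) = i + j + k"
  by (simp add: expo_def tdeg_add)

lemma in_S_iff: "in_S p \<longleftrightarrow> (\<forall>m\<in>keys p. keys m \<subseteq> {0,1,2})"
  by (auto simp: in_S_def mvars_def)

lemma in_S_0: "in_S 0" by (simp add: in_S_iff)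
lemma in_S_add: "in_S p \<Longrightarrow> in_S q \<Longrightarrow> in_S (p + q)"
  using Poly_Mapping.keys_add[of p q] by (auto simp: in_S_iff)
lemma in_S_uminus: "in_S p \<Longrightarrow> in_S (- p)"
  by (auto simp: in_S_iff)
lemma in_S_diff: "in_S p \<Longrightarrow> in_S q \<Longrightarrow> in_S (p - q)"
  using in_S_add[of p "- q"] by (simp add: in_S_uminus)
lemma in_S_mult: "in_S p \<Longrightarrow> in_S q \<Longrightarrow> in_S (p * q)"
proof -
  assume pq: "in_S p" "in_S q"
  show "in_S (p * q)" unfolding in_S_iff
  proof
    fix m assume "m \<in> keys (p * q)"
    then obtain a b where ab: "a \<in> keys p" "b \<in> keys q" "m = a + b"
      using keys_mult[of p q] by blast
    then have "keys a \<union> keys b \<subseteq> {0,1,2}" using pq by (auto simp: in_S_iff)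
    then show "keys m \<subseteq> {0,1,2}" using Poly_Mapping.keys_add[of a b] ab(3) by blast
  qed
qed
lemma in_S_sum: "(\<And>a. a \<in> A \<Longrightarrow> in_S (g a)) \<Longrightarrow> in_S (sum g A)"
  by (induction A rule: infinite_finite_induct) (auto simp: in_S_0 in_S_add)
lemma in_S_const: "in_S (const c)" by (simp add: in_S_iff const_def)
lemma in_S_1: "in_S 1" using in_S_const[of 1] by (simp add: const_def)
lemma in_S_power: "in_S p \<Longrightarrow> in_S (p ^ n)" by (induction n) (auto simp: in_S_1 in_S_mult)
lemma in_S_Var: "i \<le> 2 \<Longrightarrow> in_S (Var i)" by (auto simp: in_S_iff Var_def)
lemma in_S_single: "keys m \<subseteq> {0,1,2} \<Longrightarrow> in_S (single m c)"
  by (auto simp: in_S_iff)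

lemma in_S_lookup: "in_S p \<Longrightarrow> lookup p m \<noteq> 0 \<Longrightarrow> \<exists>i j k. m = expo i j k"
  using expo_lookup by (metis in_S_iff in_keys_iff)

lemma cf_\<Phi>:
  assumes "in_S p"
  shows "cf (\<Phi> p) i j k = lookup p (expo i j k)"
proof -
  have *: "cf (K (lookup p m) * mono_val vars3 m) i j k =
      (if m = expo i j k then lookup p m else 0)" if m: "m \<in> keys p" for m
  proof -
    obtain a b c where "m = expo a b c" using assms m in_S_lookup in_keys_iff by metis
    then show ?thesis by (auto simp: mono_val_vars3 cf_M)
  qed
  have "cf (\<Phi> p) i j k = (\<Sum>m\<in>keys p. if m = expo i j k then lookup p m else 0)"
    unfolding \<Phi>_def ev_def cf_sum by (rule sum.cong[OF refl *])
  then show ?thesis by (simp add: in_keys_iff)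
qed

lemma inj_on_\<Phi>: "inj_on \<Phi> {p. in_S p}"
proof (rule inj_onI)
  fix p q assume "p \<in> {p. in_S p}" "q \<in> {p. in_S p}" and eq: "\<Phi> p = \<Phi> q"
  then have S: "in_S p" "in_S q" by auto
  show "p = q"
  proof (rule poly_mapping_eqI, rule ccontr)
    fix m assume ne: "lookup p m \<noteq> lookup q m"
    then have "lookup p m \<noteq> 0 \<or> lookup q m \<noteq> 0" by auto
    then obtain i j k where "m = expo i j k" using in_S_lookup S by metis
    then show False using ne cf_\<Phi>[OF S(1)] cf_\<Phi>[OF S(2)] eq by metis
  qed
qed

lemmas \<Phi>_add = KR.ev_add[of vars3, folded \<Phi>_def] and \<Phi>_mult = KR.ev_mult[of vars3, folded \<Phi>_def]
  and \<Phi>_0 = KR.ev_0[of vars3, folded \<Phi>_def] and \<Phi>_1 = KR.ev_1[of vars3, folded \<Phi>_def]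
  and \<Phi>_diff = KR.ev_diff[of vars3, folded \<Phi>_def] and \<Phi>_uminus = KR.ev_uminus[of vars3, folded \<Phi>_def]
  and \<Phi>_sum = KR.ev_sum[of vars3, folded \<Phi>_def] and \<Phi>_const = KR.ev_const[of vars3, folded \<Phi>_def]
  and \<Phi>_power = KR.ev_power[of vars3, folded \<Phi>_def] and \<Phi>_single = KR.ev_single[of vars3, folded \<Phi>_def]

lemma \<Phi>_Var: "\<Phi> (Var i) = vars3 i"
  by (simp add: \<Phi>_def KR.ev_Var)

text \<open>The three nested layers of coefficients are peeled off from the inside out, each step
  being a constant of the layer plus a multiple of its variable.\<close>

lemma R_induct:
  assumes K: "\<And>c. P (K c)" and X: "P X" and Y: "P Y" and Z: "P Z"
    and add: "\<And>p q. P p \<Longrightarrow> P q \<Longrightarrow> P (p + q)" and mult: "\<And>p q. P p \<Longrightarrow> P q \<Longrightarrow> P (p * q)"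
  shows "P p"
proof -
  have 1: "P [:[:s:]:]" for s
  proof (induction s)
    case 0 then show ?case using K[of 0] by (simp add: K_def)
  next
    case (pCons a s)
    have "[:[:pCons a s:]:] = K a + Z * [:[:s:]:]" by (simp add: K_def Z_def)
    then show ?case using add[OF K mult[OF Z pCons(2)]] by simp
  qed
  have 2: "P [:s:]" for s
  proof (induction s)
    case 0 then show ?case using K[of 0] by (simp add: K_def)
  next
    case (pCons a s)
    have "[:pCons a s:] = [:[:a:]:] + Y * [:s:]" by (simp add: Y_def)
    then show ?case using add[OF 1 mult[OF Y pCons(2)]] by simp
  qed
  show ?thesis
  proof (induction p)
    case 0 then show ?case using K[of 0] by (simp add: K_def)
  next
    case (pCons a s)
    have "pCons a s = [:a:] + X * s" by (simp add: X_def)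
    then show ?case using add[OF 2 mult[OF X pCons(2)]] by simp
  qed
qed

lemma \<Phi>_surj: "\<exists>p. in_S p \<and> \<Phi> p = q"
proof (induction q rule: R_induct)
  case (1 c) show ?case using in_S_const \<Phi>_const by blast
next
  case 2 show ?case using in_S_Var[of 0] \<Phi>_Var[of 0] by (auto simp: vars3_def)
next
  case 3 show ?case using in_S_Var[of 1] \<Phi>_Var[of 1] by (auto simp: vars3_def)
next
  case 4 show ?case using in_S_Var[of 2] \<Phi>_Var[of 2] by (auto simp: vars3_def)
next
  case (5 p q) then show ?case using in_S_add \<Phi>_add by metis
next
  case (6 p q) then show ?case using in_S_mult \<Phi>_mult by metis
qed

definition \<Psi> :: "R \<Rightarrow> mpoly" where "\<Psi> = the_inv_into {p. in_S p} \<Phi>"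

lemma in_S_\<Psi>: "in_S (\<Psi> q)" and \<Phi>_\<Psi>: "\<Phi> (\<Psi> q) = q"
proof -
  have q: "q \<in> \<Phi> ` {p. in_S p}" using \<Phi>_surj[of q] by auto
  show "in_S (\<Psi> q)" using the_inv_into_into[OF inj_on_\<Phi> q order_refl] by (simp add: \<Psi>_def)
  show "\<Phi> (\<Psi> q) = q" using f_the_inv_into_f[OF inj_on_\<Phi> q] by (simp add: \<Psi>_def)
qed

lemma \<Phi>_inject: "in_S p \<Longrightarrow> in_S q \<Longrightarrow> \<Phi> p = \<Phi> q \<longleftrightarrow> p = q"
  using inj_on_\<Phi> by (auto simp: inj_on_def)

lemma \<Phi>_eq_0_iff: "in_S p \<Longrightarrow> \<Phi> p = 0 \<longleftrightarrow> p = 0"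
  using \<Phi>_inject[OF _ in_S_0] by (simp add: \<Phi>_0)

lemma \<Psi>_\<Phi>: "in_S p \<Longrightarrow> \<Psi> (\<Phi> p) = p"
  using \<Phi>_inject[OF in_S_\<Psi>] \<Phi>_\<Psi> by blast

lemma lookup_\<Psi>: "lookup (\<Psi> q) (expo i j k) = cf q i j k"
  using cf_\<Phi>[OF in_S_\<Psi>] by (simp add: \<Phi>_\<Psi>)

section \<open>Homogeneous elements and components\<close>

definition hom :: "nat \<Rightarrow> R \<Rightarrow> bool" where
  "hom n p \<longleftrightarrow> (\<forall>i j k. cf p i j k \<noteq> 0 \<longrightarrow> i + j + k = n)"

lemma hom_\<Phi>: "in_S p \<Longrightarrow> hom n (\<Phi> p) \<longleftrightarrow> homog n p"
  unfolding hom_def homog_def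
  by (metis cf_\<Phi> in_S_lookup in_keys_iff tdeg_expo)

lemma homog_\<Psi>: "homog n (\<Psi> q) \<longleftrightarrow> hom n q"
  using hom_\<Phi>[OF in_S_\<Psi>] by (simp add: \<Phi>_\<Psi>)

lemma homog_mult: "homog m p \<Longrightarrow> homog n q \<Longrightarrow> homog (m + n) (p * q)"
  using keys_mult[of p q] by (fastforce simp: homog_def tdeg_add)

lemma hom_0 [simp]: "hom n 0" and hom_add: "hom n p \<Longrightarrow> hom n q \<Longrightarrow> hom n (p + q)"
  and hom_diff: "hom n p \<Longrightarrow> hom n q \<Longrightarrow> hom n (p - q)" and hom_uminus: "hom n p \<Longrightarrow> hom n (- p)"
  and hom_K_mult: "hom n p \<Longrightarrow> hom n (K c * p)"
  by (auto simp: hom_def) (metis add.right_neutral diff_0_right diff_self add_0)+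

lemma hom_mult: "hom m p \<Longrightarrow> hom n q \<Longrightarrow> hom (m + n) (p * q)"
  using homog_mult[of m "\<Psi> p" n "\<Psi> q"] hom_\<Phi>[of "\<Psi> p * \<Psi> q" "m + n"]
  by (simp add: homog_\<Psi> in_S_mult in_S_\<Psi> \<Phi>_mult \<Phi>_\<Psi>)

lemma hom_M: "hom (i + j + k) (M i j k)"
  by (auto simp: hom_def cf_M)

lemma M_0 [simp]: "M 0 0 0 = 1" by (simp add: M_def)

lemma hom_1: "hom 0 1" using hom_M[of 0 0 0] by simp
lemma hom_K: "hom 0 (K c)" using hom_K_mult[OF hom_1, of c] by simp
lemma hom_X: "hom 1 X" and hom_Y: "hom 1 Y" and hom_Z: "hom 1 Z"
  using hom_M[of 1 0 0] hom_M[of 0 1 0] hom_M[of 0 0 1] by (simp_all add: M_def)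

lemma hom_power: "hom m p \<Longrightarrow> hom (n * m) (p ^ n)"
  by (induction n) (auto simp: hom_1 intro: hom_mult)

definition hcomp :: "nat \<Rightarrow> R \<Rightarrow> R" where
  "hcomp n p = \<Phi> (\<Sum>m\<in>{m \<in> keys (\<Psi> p). tdeg m = n}.
      single m (lookup (\<Psi> p) m))"

lemma cf_hcomp: "cf (hcomp n p) i j k = (if i + j + k = n then cf p i j k else 0)"
proof -
  let ?s = "\<Sum>m\<in>{m \<in> keys (\<Psi> p). tdeg m = n}. single m (lookup (\<Psi> p) m)"
  have "in_S ?s" using in_S_\<Psi>[of p] by (intro in_S_sum in_S_single) (auto simp: in_S_iff)
  then have "cf (hcomp n p) i j k = lookup ?s (expo i j k)"
    by (simp add: hcomp_def cf_\<Phi>)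
  also have "\<dots> = (\<Sum>m\<in>{m \<in> keys (\<Psi> p). tdeg m = n}.
      if m = expo i j k then lookup (\<Psi> p) m else 0)"
    by (simp add: lookup_sum lookup_single when_def)
  also have "\<dots> = (if i + j + k = n then cf p i j k else 0)"
    by (auto simp: tdeg_expo lookup_\<Psi> in_keys_iff)
  finally show ?thesis .
qed

lemma hcomp_add: "hcomp n (p + q) = hcomp n p + hcomp n q"
  and hcomp_diff: "hcomp n (p - q) = hcomp n p - hcomp n q"
  and hcomp_0 [simp]: "hcomp n 0 = 0"
  by (auto intro!: R_eqI simp: cf_hcomp)

lemma hcomp_sum: "hcomp n (sum g A) = (\<Sum>a\<in>A. hcomp n (g a))"
  by (induction A rule: infinite_finite_induct) (auto simp: hcomp_add)

lemma hom_hcomp: "hom n (hcomp n p)"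
  by (auto simp: hom_def cf_hcomp)

lemma hcomp_hom: "hom m p \<Longrightarrow> hcomp n p = (if n = m then p else 0)"
  by (rule R_eqI) (auto simp: cf_hcomp hom_def)

lemma hcomp_bound: "\<exists>D. \<forall>n>D. hcomp n p = 0"
proof -
  let ?D = "\<Sum>m\<in>keys (\<Psi> p). tdeg m"
  have "hcomp n p = 0" if n: "n > ?D" for n
  proof (rule R_eqI)
    fix i j k
    show "cf (hcomp n p) i j k = cf 0 i j k"
    proof (cases "i + j + k = n \<and> cf p i j k \<noteq> 0")
      case True
      then have "expo i j k \<in> keys (\<Psi> p)" by (simp add: in_keys_iff lookup_\<Psi>)
      then have "tdeg (expo i j k) \<le> ?D" by (intro member_le_sum) auto
      then show ?thesis using n True by (simp add: tdeg_expo)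
    qed (auto simp: cf_hcomp)
  qed
  then show ?thesis by blast
qed

lemma sum_hcomp:
  assumes "\<forall>n>D. hcomp n p = 0"
  shows "(\<Sum>n\<le>D. hcomp n p) = p"
proof (rule R_eqI)
  fix i j k
  have "cf (\<Sum>n\<le>D. hcomp n p) i j k = (\<Sum>n\<le>D. if n = i + j + k then cf p i j k else 0)"
    by (auto simp: cf_sum cf_hcomp intro!: sum.cong)
  also have "\<dots> = (if i + j + k \<le> D then cf p i j k else 0)" by simp
  also have "\<dots> = cf p i j k"
    using assms cf_hcomp[of "i + j + k" p i j k] by (auto simp: not_le)
  finally show "cf (\<Sum>n\<le>D. hcomp n p) i j k = cf p i j k" .
qed

lemma hcomp_mult_hom:
  assumes q: "hom m q"
  shows "hcomp (m + n) (q * p) = q * hcomp n p" "i < m \<Longrightarrow> hcomp i (q * p) = 0"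
proof -
  obtain D where D: "\<forall>n>D. hcomp n p = 0" using hcomp_bound by blast
  have e: "q * p = (\<Sum>l\<le>D. q * hcomp l p)" using sum_hcomp[OF D] by (simp add: sum_distrib_left[symmetric])
  have c: "hcomp i (q * hcomp l p) = (if i = m + l then q * hcomp l p else 0)" for i l
    by (rule hcomp_hom[OF hom_mult[OF q hom_hcomp]])
  have "hcomp (m + n) (q * p) = (\<Sum>l\<le>D. if l = n then q * hcomp l p else 0)"
    unfolding e hcomp_sum c by (auto intro!: sum.cong)
  then show "hcomp (m + n) (q * p) = q * hcomp n p" using D by (auto simp: not_le)
  show "hcomp i (q * p) = 0" if "i < m"
    unfolding e hcomp_sum c using that by (auto intro!: sum.neutral)
qed

text \<open>Leading forms multiply. As the ring is a domain, this gives additivity of the degree,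
  which is what the divisibility arguments below need.\<close>

lemma hcomp_mult_top:
  assumes p: "\<forall>i>a. hcomp i p = 0" and q: "\<forall>i>b. hcomp i q = 0"
  shows "hcomp (a + b) (p * q) = hcomp a p * hcomp b q" "i > a + b \<Longrightarrow> hcomp i (p * q) = 0"
proof -
  have e: "p * q = (\<Sum>k\<le>a. \<Sum>l\<le>b. hcomp k p * hcomp l q)"
    using sum_hcomp[OF p] sum_hcomp[OF q] by (metis sum_product)
  have c: "hcomp i (hcomp k p * hcomp l q) = (if i = k + l then hcomp k p * hcomp l q else 0)" for i k l
    by (rule hcomp_hom[OF hom_mult[OF hom_hcomp hom_hcomp]])
  have "hcomp (a + b) (p * q) = (\<Sum>k\<le>a. \<Sum>l\<le>b. if k = a then if l = b then hcomp k p * hcomp l q else 0 else 0)"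
    unfolding e hcomp_sum c by (auto intro!: sum.cong)
  also have "\<dots> = (\<Sum>k\<le>a. if k = a then hcomp k p * hcomp b q else 0)"
    by (intro sum.cong refl) simp
  finally show "hcomp (a + b) (p * q) = hcomp a p * hcomp b q" by simp
  show "hcomp i (p * q) = 0" if "i > a + b"
    unfolding e hcomp_sum c using that by (auto intro!: sum.neutral)
qed

section \<open>Values at points\<close>

definition ev3 :: "R \<Rightarrow> complex \<Rightarrow> complex \<Rightarrow> complex \<Rightarrow> complex" where
  "ev3 p a b c = poly (poly (poly p [:[:a:]:]) [:b:]) c"

lemma ev3_simps [simp]:
  "ev3 (p + q) a b c = ev3 p a b c + ev3 q a b c" "ev3 (p - q) a b c = ev3 p a b c - ev3 q a b c"
  "ev3 (p * q) a b c = ev3 p a b c * ev3 q a b c" "ev3 (- p) a b c = - ev3 p a b c"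
  "ev3 (p ^ n) a b c = ev3 p a b c ^ n" "ev3 0 a b c = 0" "ev3 1 a b c = 1" "ev3 (K d) a b c = d"
  "ev3 X a b c = a" "ev3 Y a b c = b" "ev3 Z a b c = c"
  by (simp_all add: ev3_def K_def X_def Y_def Z_def)

lemma ev3_sum: "ev3 (sum g A) a b c = (\<Sum>x\<in>A. ev3 (g x) a b c)"
  by (induction A rule: infinite_finite_induct) auto

lemma \<Phi>_expand:
  assumes p: "in_S p"
  shows "\<Phi> p = (\<Sum>m\<in>keys p. K (lookup p m) *
    M (lookup m 0) (lookup m 1) (lookup m 2))"
proof -
  have "mono_val vars3 m = M (lookup m 0) (lookup m 1) (lookup m 2)"
    if "m \<in> keys p" for m
  proof -
    have "m = expo (lookup m 0) (lookup m 1) (lookup m 2)"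
      by (rule expo_lookup) (use p that in \<open>auto simp: in_S_iff\<close>)
    then show ?thesis using mono_val_vars3 by metis
  qed
  then show ?thesis unfolding \<Phi>_def ev_def by (intro sum.cong refl) simp
qed

lemma ev3_M [simp]: "ev3 (M i j k) a b c = a ^ i * b ^ j * c ^ k"
  by (simp add: M_def)

lemma ev3_\<Phi>:
  assumes p: "in_S p"
  shows "ev3 (\<Phi> p) (a 0) (a 1) (a 2) = meval a p"
proof -
  have m: "mono_val a m = a 0 ^ lookup m 0 * a 1 ^ lookup m 1 * a 2 ^ lookup m 2"
    if "m \<in> keys p" for m
  proof -
    have "m = expo (lookup m 0) (lookup m 1) (lookup m 2)"
      by (rule expo_lookup) (use p that in \<open>auto simp: in_S_iff\<close>)
    then show ?thesis using mono_val_expo[of a] by metis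
  qed
  show ?thesis
    unfolding meval_eq_ev \<Phi>_expand[OF p] ev3_sum ev_def by (intro sum.cong refl) (simp add: m)
qed

lemma M_expand: "\<exists>F. p = (\<Sum>(i,j,k)\<in>F. K (cf p i j k) * M i j k) \<and> finite F \<and> (\<forall>i j k. cf p i j k \<noteq> 0 \<longrightarrow> (i,j,k) \<in> F)"
proof -
  let ?t = "\<lambda>m. (lookup m 0, lookup m 1, lookup m (2::nat)) :: nat \<times> nat \<times> nat"
  let ?F = "?t ` keys (\<Psi> p)"
  have F: "(i,j,k) \<in> ?F" if "cf p i j k \<noteq> 0" for i j k
  proof -
    have "expo i j k \<in> keys (\<Psi> p)" using that by (simp add: in_keys_iff lookup_\<Psi>)
    moreover have "?t (expo i j k) = (i,j,k)" by (simp add: lookup_expo)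
    ultimately show ?thesis by (intro image_eqI[of _ ?t]) (simp_all only:)
  qed
  have "p = (\<Sum>(i,j,k)\<in>?F. K (cf p i j k) * M i j k)"
  proof (rule R_eqI)
    fix a b c
    have "cf (\<Sum>(i,j,k)\<in>?F. K (cf p i j k) * M i j k) a b c
      = (\<Sum>x\<in>?F. if x = (a,b,c) then cf p a b c else 0)"
      unfolding cf_sum by (intro sum.cong refl) (auto simp: cf_M split: if_splits)
    also have "\<dots> = cf p a b c" using F[of a b c] by auto
    finally show "cf p a b c = cf (\<Sum>(i,j,k)\<in>?F. K (cf p i j k) * M i j k) a b c" by simp
  qed
  then show ?thesis using F by (intro exI[of _ ?F]) auto
qed

lemma ev3_scale:
  assumes "hom n p"
  shows "ev3 p (t * a) (t * b) (t * c) = t ^ n * ev3 p a b c"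
proof -
  obtain F where F: "p = (\<Sum>(i,j,k)\<in>F. K (cf p i j k) * M i j k)" using M_expand by blast
  have *: "ev3 (K (cf p i j k) * M i j k) (t * a) (t * b) (t * c) = t ^ n * ev3 (K (cf p i j k) * M i j k) a b c" for i j k
  proof (cases "cf p i j k = 0")
    case False
    then have "n = i + j + k" using assms by (auto simp: hom_def)
    then show ?thesis by (simp add: power_mult_distrib power_add mult_ac)
  qed simp
  show ?thesis
    by (subst (1 2) F, unfold ev3_sum sum_distrib_left, intro sum.cong refl) (use * in auto)
qed

section \<open>Dimensions of the graded pieces\<close>

abbreviation scR :: "complex \<Rightarrow> R \<Rightarrow> R" where "scR \<equiv> \<lambda>c p. K c * p"

interpretation VR: quot_space scR
  by standard (auto simp: algebra_simps K_add K_mult K_1)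

definition Sn :: "nat \<Rightarrow> R set" where "Sn n = {p. hom n p}"

lemma subspace_Sn: "VR.subspace (Sn n)"
  by (auto simp: VR.subspace_def Sn_def hom_add hom_K_mult)

definition triples :: "nat \<Rightarrow> (nat \<times> nat \<times> nat) set" where
  "triples n = {(i,j,k). i + j + k = n}"

lemma finite_triples: "finite (triples n)"
  by (rule finite_subset[of _ "{..n} \<times> {..n} \<times> {..n}"]) (auto simp: triples_def)

lemma card_triples: "2 * card (triples n) = (n + 1) * (n + 2)"
proof -
  have e: "triples n = (\<Union>i\<in>{..n}. (\<lambda>j. (i, j, n - i - j)) ` {..n - i})"
    by (force simp: triples_def)
  have "card (triples n) = (\<Sum>i\<le>n. card ((\<lambda>j. (i, j, n - i - j)) ` {..n - i}))"
    unfolding e by (rule card_UN_disjoint) auto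
  also have "\<dots> = (\<Sum>i\<le>n. Suc (n - i))"
    by (intro sum.cong refl, subst card_image) (auto simp: inj_on_def)
  also have "\<dots> = (\<Sum>i\<le>n. Suc i)"
    using sum.nat_diff_reindex[of Suc "Suc n"] by (simp add: lessThan_Suc_atMost)
  also have "2 * \<dots> = (n + 1) * (n + 2)" by (induction n) auto
  finally show ?thesis .
qed

lemma M_inject [simp]: "M i j k = M i' j' k' \<longleftrightarrow> i = i' \<and> j = j' \<and> k = k'"
  using cf_M[of i j k i j k] cf_M[of i' j' k' i j k] by (auto split: if_splits)

lemma inj_on_M: "inj_on (\<lambda>(i,j,k). M i j k) (triples n)"
  by (auto simp: inj_on_def)

lemma independent_M: "VR.independent ((\<lambda>(i,j,k). M i j k) ` triples n)"
proof -
  note inj = inj_on_M[of n]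
  show ?thesis
  proof (rule VR.independent_if_scalars_zero)
    show "finite ((\<lambda>(i,j,k). M i j k) ` triples n)" using finite_triples by simp
    fix u v assume s: "(\<Sum>x\<in>(\<lambda>(i,j,k). M i j k) ` triples n. K (u x) * x) = 0"
      and v: "v \<in> (\<lambda>(i,j,k). M i j k) ` triples n"
    then obtain a b c where abc: "(a,b,c) \<in> triples n" "v = M a b c" by auto
    have "0 = cf (\<Sum>x\<in>(\<lambda>(i,j,k). M i j k) ` triples n. K (u x) * x) a b c" using s by simp
    also have "\<dots> = (\<Sum>x\<in>triples n. if x = (a,b,c) then u v else 0)"
      by (subst sum.reindex[OF inj]) (auto simp: cf_sum cf_M abc intro!: sum.cong)
    finally show "u v = 0" using abc finite_triples by simp
  qed
qed

lemma qdim_Sn: "VR.fin_quot (Sn n) {0}" "2 * VR.qdim (Sn n) {0} = (n + 1) * (n + 2)"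
proof -
  let ?B = "(\<lambda>(i,j,k). M i j k) ` triples n"
  note inj = inj_on_M[of n]
  have 1: "?B \<subseteq> Sn n" using hom_M by (auto simp: triples_def Sn_def)
  have 2: "Sn n \<subseteq> VR.span ?B"
  proof
    fix p assume p: "p \<in> Sn n"
    obtain F where F: "p = (\<Sum>(i,j,k)\<in>F. K (cf p i j k) * M i j k)" using M_expand by blast
    have "(\<Sum>(i,j,k)\<in>F. K (cf p i j k) * M i j k) \<in> VR.span ?B"
    proof (rule VR.span_sum, clarify)
      fix i j k
      show "K (cf p i j k) * M i j k \<in> VR.span ?B"
      proof (cases "cf p i j k = 0")
        case False
        then have "(i,j,k) \<in> triples n" using p by (auto simp: Sn_def hom_def triples_def)
        then have "M i j k \<in> ?B" by force
        then show ?thesis using VR.span_scale VR.span_base by blast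
      qed (use VR.span_zero in simp)
    qed
    then show "p \<in> VR.span ?B" using F by simp
  qed
  have 3: "finite ?B" using finite_triples by simp
  note q = VR.qdim_basis[OF independent_M 1 2 3]
  show "VR.fin_quot (Sn n) {0}" by (rule q(1))
  show "2 * VR.qdim (Sn n) {0} = (n + 1) * (n + 2)"
    using q(2) card_image[OF inj] card_triples[of n] by simp
qed

section \<open>Partial derivatives and coprimality\<close>

lemma lookup_pderiv:
  "lookup (Defs.pderiv i p) m
    = of_nat (Suc (lookup m i)) * lookup p (m + single i 1)"
proof -
  let ?e = "single i (1::nat)"
  have *: "lookup (single (m' - ?e) (of_nat (lookup m' i) * lookup p m')) m
    = (if m' = m + ?e then of_nat (Suc (lookup m i)) * lookup p (m + ?e) else 0)" for m'
  proof (cases "m' = m + ?e")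
    case True
    then show ?thesis by (simp add: lookup_add lookup_single)
  next
    case False
    \<comment> \<open>Subtraction of exponents truncates, so a monomial without the variable
      \<open>i\<close> can land on \<open>m\<close> as well; its coefficient is then multiplied by
      0.\<close>
    have "lookup m' i = 0" if "m' - ?e = m"
    proof (rule ccontr)
      assume "lookup m' i \<noteq> 0"
      then have "m' = (m' - ?e) + ?e"
        by (intro poly_mapping_eqI) (auto simp: lookup_add lookup_minus lookup_single when_def)
      then show False using that False by simp
    qed
    then show ?thesis using False by (auto simp: lookup_single when_def)
  qed
  show ?thesis
    unfolding Defs.pderiv_def lookup_sum * by (simp add: in_keys_iff)
qed

lemma pderiv_add: "Defs.pderiv i (p + q) = Defs.pderiv i p + Defs.pderiv i q"
  by (rule poly_mapping_eqI) (simp add: lookup_pderiv lookup_add algebra_simps)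

lemma pderiv_0: "Defs.pderiv i 0 = 0"
  by (rule poly_mapping_eqI) (simp add: lookup_pderiv)

lemma pderiv_sum: "Defs.pderiv i (sum g A) = (\<Sum>a\<in>A. Defs.pderiv i (g a))"
  by (induction A rule: infinite_finite_induct) (auto simp: pderiv_add pderiv_0)

lemma pderiv_single: "Defs.pderiv i (single m c)
    = single (m - single i 1) (of_nat (lookup m i) * c)"
  by (cases "c = 0") (simp_all add: Defs.pderiv_def)

lemma pderiv_mult_single:
  "Defs.pderiv i (single m a * single n b)
    = single m a * Defs.pderiv i (single n b)
      + Defs.pderiv i (single m a) * single n b"
proof -
  let ?e = "single i (1::nat)"
  have 1: "m + n - ?e = m + (n - ?e)" if "lookup n i > 0"
    using that by (intro poly_mapping_eqI) (auto simp: lookup_add lookup_minus lookup_single when_def)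
  have 2: "m + n - ?e = (m - ?e) + n" if "lookup m i > 0"
    using that by (intro poly_mapping_eqI) (auto simp: lookup_add lookup_minus lookup_single when_def)
  show ?thesis
    using 1 2 by (cases "lookup n i > 0"; cases "lookup m i > 0")
      (auto simp: mult_single pderiv_single lookup_add algebra_simps single_add[symmetric])
qed

lemma pderiv_mult: "Defs.pderiv i (p * q) = p * Defs.pderiv i q + Defs.pderiv i p * q"
proof -
  let ?s = "\<lambda>p m. single m (lookup p m)"
  have "Defs.pderiv i (p * q)
    = Defs.pderiv i ((\<Sum>m\<in>keys p. ?s p m) * (\<Sum>n\<in>keys q. ?s q n))"
    by (simp only: sum_single_lookup)
  also have "\<dots> = (\<Sum>m\<in>keys p. \<Sum>n\<in>keys q.
      ?s p m * Defs.pderiv i (?s q n)) + (\<Sum>m\<in>keys p. \<Sum>n\<in>keys q.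
      Defs.pderiv i (?s p m) * ?s q n)"
    by (simp add: sum_product pderiv_sum pderiv_mult_single sum.distrib)
  also have "\<dots> = (\<Sum>m\<in>keys p. ?s p m) * Defs.pderiv i (\<Sum>n\<in>keys q. ?s q n)
     + Defs.pderiv i (\<Sum>m\<in>keys p. ?s p m) * (\<Sum>n\<in>keys q. ?s q n)"
    by (simp add: sum_product pderiv_sum)
  finally show ?thesis by (simp only: sum_single_lookup)
qed

lemma in_S_pderiv:
  assumes "in_S p"
  shows "in_S (Defs.pderiv i p)"
  unfolding in_S_iff
proof
  fix m assume "m \<in> keys (Defs.pderiv i p)"
  then have "m + single i 1 \<in> keys p"
    by (auto simp: in_keys_iff lookup_pderiv)
  then have "keys (m + single i 1) \<subseteq> {0,1,2}" using assms by (auto simp: in_S_iff)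
  moreover have "keys m \<subseteq> keys (m + single i 1)"
    by (auto simp: in_keys_iff lookup_add)
  ultimately show "keys m \<subseteq> {0,1,2}" by blast
qed

lemma homog_pderiv:
  assumes "homog (Suc n) p"
  shows "homog n (Defs.pderiv i p)"
  unfolding homog_def
proof
  fix m assume "m \<in> keys (Defs.pderiv i p)"
  then have "m + single i 1 \<in> keys p"
    by (auto simp: in_keys_iff lookup_pderiv)
  then have "tdeg (m + single i 1) = Suc n" using assms by (auto simp: homog_def)
  then show "tdeg m = n" by (simp add: tdeg_add)
qed

lemma Var_mult_pderiv_single:
  "Var i * Defs.pderiv i (single m c) = single m (of_nat (lookup m i) * c)"
proof (cases "lookup m i = 0")
  case False
  then have "single i 1 + (m - single i 1) = m"
    by (intro poly_mapping_eqI) (auto simp: lookup_add lookup_minus lookup_single when_def)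
  then show ?thesis by (simp add: pderiv_single Var_def mult_single)
qed (simp add: pderiv_single)

lemma euler_formula:
  assumes "in_S f" "homog d f"
  shows "Var 0 * Defs.pderiv 0 f + Var 1 * Defs.pderiv 1 f + Var 2 * Defs.pderiv 2 f = const (of_nat d) * f"
proof -
  let ?s = "\<lambda>m. single m (lookup f m)"
  have f: "f = (\<Sum>m\<in>keys f. ?s m)" by (simp add: sum_single_lookup)
  have *: "Var 0 * Defs.pderiv 0 (?s m) + Var 1 * Defs.pderiv 1 (?s m) + Var 2 * Defs.pderiv 2 (?s m)
    = const (of_nat d) * ?s m" if m: "m \<in> keys f" for m
  proof -
    have k: "keys m \<subseteq> {0,1,2}" using assms m by (auto simp: in_S_iff)
    have "d = tdeg m" using assms m by (auto simp: homog_def)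
    then have "d = lookup m 0 + lookup m 1 + lookup m 2"
      using tdeg_superset[OF _ k] by simp
    then show ?thesis
      by (simp add: Var_mult_pderiv_single const_def mult_single single_add[symmetric] algebra_simps)
  qed
  have "Var 0 * Defs.pderiv 0 f + Var 1 * Defs.pderiv 1 f + Var 2 * Defs.pderiv 2 f
    = (\<Sum>m\<in>keys f. Var 0 * Defs.pderiv 0 (?s m) + Var 1 * Defs.pderiv 1 (?s m) + Var 2 * Defs.pderiv 2 (?s m))"
    by (subst (1 2 3) f) (simp add: pderiv_sum sum_distrib_left sum.distrib)
  also have "\<dots> = (\<Sum>m\<in>keys f. const (of_nat d) * ?s m)"
    by (rule sum.cong[OF refl *])
  also have "\<dots> = const (of_nat d) * f"
    by (simp add: sum_distrib_left[symmetric] sum_single_lookup)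
  finally show ?thesis .
qed

lemma top_degree_exists:
  assumes "p \<noteq> 0"
  shows "\<exists>a. hcomp a p \<noteq> 0 \<and> (\<forall>i>a. hcomp i p = 0)"
proof -
  obtain D where D: "\<forall>n>D. hcomp n p = 0" using hcomp_bound by blast
  have "\<exists>n. hcomp n p \<noteq> 0" using sum_hcomp[OF D] assms by (metis sum.neutral)
  moreover have "hcomp n p \<noteq> 0 \<Longrightarrow> n \<le> D" for n using D not_le by blast
  ultimately have "hcomp (GREATEST n. hcomp n p \<noteq> 0) p \<noteq> 0"
    "\<And>n. hcomp n p \<noteq> 0 \<Longrightarrow> n \<le> (GREATEST n. hcomp n p \<noteq> 0)"
    using GreatestI_nat[of "\<lambda>n. hcomp n p \<noteq> 0"] Greatest_le_nat[of "\<lambda>n. hcomp n p \<noteq> 0"] by blast+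
  then show ?thesis by (meson not_le)
qed

text \<open>A derivation lowers the degree. A nonzero multiple of \<open>p\<close> has a leading
  form of degree at least the degree \<open>a\<close> of \<open>p\<close>, but a monomial of degree
  \<open>a + b\<close> in the derivative comes from one of degree \<open>a + b + 1\<close> in
  \<open>p\<close>.\<close>

lemma dvd_pderiv_imp_0:
  assumes p: "in_S p" and dvd: "\<Phi> p dvd \<Phi> (Defs.pderiv i p)"
  shows "Defs.pderiv i p = 0"
proof (rule ccontr)
  assume ne: "Defs.pderiv i p \<noteq> 0"
  then have ne': "\<Phi> (Defs.pderiv i p) \<noteq> 0" using \<Phi>_eq_0_iff in_S_pderiv p by blast
  obtain s where s: "\<Phi> (Defs.pderiv i p) = \<Phi> p * s" using dvd by blast
  then have "\<Phi> p \<noteq> 0" "s \<noteq> 0" using ne' by auto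
  then obtain a b where ab: "hcomp a (\<Phi> p) \<noteq> 0" "\<forall>i>a. hcomp i (\<Phi> p) = 0"
      "hcomp b s \<noteq> 0" "\<forall>i>b. hcomp i s = 0"
    using top_degree_exists by metis
  then have "hcomp (a + b) (\<Phi> (Defs.pderiv i p)) \<noteq> 0" using s hcomp_mult_top(1)[of a "\<Phi> p" b s] by simp
  then obtain u v w where "cf (hcomp (a + b) (\<Phi> (Defs.pderiv i p))) u v w \<noteq> 0" using R_eqI cf_0 by metis
  then have uvw: "u + v + w = a + b" "lookup (Defs.pderiv i p) (expo u v w) \<noteq> 0"
    by (auto simp: cf_hcomp cf_\<Phi>[OF in_S_pderiv[OF p]] split: if_splits)
  then have l: "lookup p (expo u v w + single i 1) \<noteq> 0"
    by (simp add: lookup_pderiv)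
  then obtain u' v' w' where e: "expo u v w + single i 1 = expo u' v' w'"
    using in_S_lookup[OF p] by blast
  have "tdeg (expo u v w + single i 1) = a + b + 1" using uvw(1) by (simp add: tdeg_add tdeg_expo)
  then have "u' + v' + w' = a + b + 1" using e by (simp add: tdeg_expo)
  moreover have "cf (\<Phi> p) u' v' w' \<noteq> 0" using l e cf_\<Phi>[OF p] by simp
  ultimately have "hcomp (a + b + 1) (\<Phi> p) \<noteq> 0" by (metis cf_hcomp cf_0)
  then show False using ab(2) by (metis less_add_one add.assoc trans_less_add1 le_add1 le_less_trans)
qed

text \<open>In characteristic 0 a monomial that contains a variable survives the derivative by that
  variable.\<close>

lemma pderiv_all_0:
  assumes p: "in_S p" and "Defs.pderiv 0 p = 0" "Defs.pderiv 1 p = 0" "Defs.pderiv 2 p = 0"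
  shows "keys p \<subseteq> {0}"
proof
  fix m assume m: "m \<in> keys p"
  have "lookup m i = 0" for i
  proof (rule ccontr)
    assume i: "lookup m i \<noteq> 0"
    then have "i \<in> keys m" by (simp add: in_keys_iff)
    then have "i \<in> {0,1,2}" using p m unfolding in_S_iff by blast
    then have "lookup (Defs.pderiv i p) (m - single i 1) = 0" using assms by auto
    moreover have "(m - single i 1) + single i 1 = m"
      using i by (intro poly_mapping_eqI) (auto simp: lookup_add lookup_minus lookup_single when_def)
    ultimately show False using m i unfolding lookup_pderiv by (auto simp: in_keys_iff simp flip: of_nat_Suc)
  qed
  then show "m \<in> {0}" by (simp add: poly_mapping_eqI)
qed

lemma keys_const_is_unit:
  assumes "keys p \<subseteq> {0}" "\<Phi> p \<noteq> 0"
  shows "is_unit (\<Phi> p)"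
proof -
  have "p = const (lookup p 0)"
    unfolding const_def using assms(1) by (intro poly_mapping_eqI) (auto simp: lookup_single when_def in_keys_iff)
  then obtain c where c: "\<Phi> p = K c" by (metis \<Phi>_const)
  then have "K c * K (1 / c) = 1" using assms(2) by (simp flip: K_mult add: K_1)
  then show ?thesis using c by (metis dvdI)
qed

text \<open>A prime dividing all partial derivatives divides \<open>f\<close> by Euler's formula, and the product rule
  then shows that its square divides \<open>f\<close>.\<close>

lemma reduced_partials_coprime:
  assumes f: "in_S f" "homog d f" "f \<noteq> 0" "d \<ge> 1" "reduced f"
    and g: "g dvd \<Phi> (Defs.pderiv 0 f)" "g dvd \<Phi> (Defs.pderiv 1 f)" "g dvd \<Phi> (Defs.pderiv 2 f)"
  shows "is_unit g"
proof (rule ccontr)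
  assume nu: "\<not> is_unit g"
  have "K (of_nat d) * \<Phi> f = \<Phi> (const (of_nat d) * f)" by (simp add: \<Phi>_mult \<Phi>_const)
  also have "\<dots> = X * \<Phi> (Defs.pderiv 0 f) + Y * \<Phi> (Defs.pderiv 1 f) + Z * \<Phi> (Defs.pderiv 2 f)"
    by (simp flip: euler_formula[OF f(1,2)] add: \<Phi>_add \<Phi>_mult \<Phi>_Var vars3_def)
  finally have eu: "K (of_nat d) * \<Phi> f = X * \<Phi> (Defs.pderiv 0 f) + Y * \<Phi> (Defs.pderiv 1 f) + Z * \<Phi> (Defs.pderiv 2 f)" .
  have f0: "\<Phi> f \<noteq> 0" using f \<Phi>_eq_0_iff by blast
  have gf: "g dvd \<Phi> f"
  proof -
    have "g dvd K (of_nat d) * \<Phi> f" unfolding eu using g by (simp add: dvd_add dvd_mult)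
    then have "g dvd K (1 / of_nat d) * (K (of_nat d) * \<Phi> f)" by (rule dvd_mult)
    moreover have "K (1 / of_nat d) * (K (of_nat d) * \<Phi> f) = \<Phi> f"
    proof -
      have "K (1 / of_nat d) * K (of_nat d) = 1" using f(4) unfolding K_mult[symmetric] by (simp add: K_1)
      then show ?thesis by (simp flip: mult.assoc)
    qed
    ultimately show ?thesis by (simp only:)
  qed
  then have "g \<noteq> 0" using f0 by auto
  then obtain q where q: "q dvd g" "prime q" using prime_divisor_exists nu by blast
  then have qp: "prime_elem q" by auto
  obtain h where h: "\<Phi> f = q * h" using q gf by (meson dvdE dvd_trans)
  have feq: "f = \<Psi> q * \<Psi> h"
    using h f(1) by (metis \<Phi>_inject \<Phi>_mult \<Phi>_\<Psi> in_S_mult in_S_\<Psi>)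
  have dv: "q dvd h \<or> q dvd \<Phi> (Defs.pderiv i (\<Psi> q))" if "q dvd \<Phi> (Defs.pderiv i f)" for i
  proof -
    have "\<Phi> (Defs.pderiv i f) = q * \<Phi> (Defs.pderiv i (\<Psi> h)) + \<Phi> (Defs.pderiv i (\<Psi> q)) * h"
      by (subst feq) (simp add: pderiv_mult \<Phi>_add \<Phi>_mult \<Phi>_\<Psi>)
    then have "q dvd \<Phi> (Defs.pderiv i (\<Psi> q)) * h" using that
      by (metis dvd_add_right_iff dvd_triv_left)
    then show ?thesis using qp prime_elem_dvd_mult_iff by blast
  qed
  have qn: "\<not> keys (\<Psi> q) \<subseteq> {0}"
    using keys_const_is_unit[of "\<Psi> q"] qp by (auto simp: \<Phi>_\<Psi> prime_elem_def)
  show False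
  proof (cases "q dvd h")
    case True
    then obtain s where "\<Phi> f = q * (q * s)" using h by blast
    then have "f = \<Psi> q * (\<Psi> q * \<Psi> s)"
      using f(1) by (metis \<Phi>_inject \<Phi>_mult \<Phi>_\<Psi> in_S_mult in_S_\<Psi>)
    then have "\<Psi> q * \<Psi> q dvd f" by (simp add: mult.assoc[symmetric])
    then show False using f(5) qn by (auto simp: reduced_def)
  next
    case False
    have "q dvd \<Phi> (Defs.pderiv i (\<Psi> q))" if "g dvd \<Phi> (Defs.pderiv i f)" for i
      using dv False q that dvd_trans by blast
    then have "Defs.pderiv i (\<Psi> q) = 0" if "g dvd \<Phi> (Defs.pderiv i f)" for i
      using dvd_pderiv_imp_0[OF in_S_\<Psi>, of q i] that by (simp add: \<Phi>_\<Psi>)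
    then show False using pderiv_all_0[OF in_S_\<Psi>] g qn by blast
  qed
qed

section \<open>Cross products, syzygies and coprime triples\<close>

fun dot :: "'a::comm_ring_1 \<times> 'a \<times> 'a \<Rightarrow> 'a \<times> 'a \<times> 'a \<Rightarrow> 'a" where
  "dot (a, b, c) (a', b', c') = a * a' + b * b' + c * c'"

fun cross :: "'a::comm_ring_1 \<times> 'a \<times> 'a \<Rightarrow> 'a \<times> 'a \<times> 'a \<Rightarrow> 'a \<times> 'a \<times> 'a" where
  "cross (a, b, c) (a', b', c') = (b * c' - c * b', c * a' - a * c', a * b' - b * a')"

fun smul :: "'a::comm_ring_1 \<Rightarrow> 'a \<times> 'a \<times> 'a \<Rightarrow> 'a \<times> 'a \<times> 'a" where
  "smul p (a, b, c) = (p * a, p * b, p * c)"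

text \<open>For nonzero \<open>w\<close> over a factorial ring: the entries of \<open>w\<close> have no common factor.\<close>

definition Prim :: "'a::comm_ring_1 \<times> 'a \<times> 'a \<Rightarrow> bool" where
  "Prim w \<longleftrightarrow> (\<forall>v. cross v w = 0 \<longrightarrow> (\<exists>h. v = smul h w))"

lemma zero_triple: "(0 :: 'a::zero \<times> 'b::zero \<times> 'c::zero) = (0, 0, 0)"
  by (simp add: zero_prod_def)

text \<open>The triple product identity \<open>cross (cross \<rho> \<sigma>) w = smul (dot \<rho> w)
  \<sigma> - smul (dot \<sigma> w) \<rho>\<close>, written out in coordinates.\<close>

lemma cross_cross: "dot \<rho> w = 0 \<Longrightarrow> dot \<sigma> w = 0 \<Longrightarrow> cross (cross \<rho> \<sigma>) w = 0"
proof -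
  obtain a b c a' b' c' x y z where e: "\<rho> = (a, b, c)" "\<sigma> = (a', b', c')" "w = (x, y, z)"
    by (metis prod.exhaust)
  assume "dot \<rho> w = 0" "dot \<sigma> w = 0"
  then have 1: "a * x + b * y + c * z = 0" "a' * x + b' * y + c' * z = 0" by (auto simp: e)
  have "(c * a' - a * c') * z - (a * b' - b * a') * y = a' * (a * x + b * y + c * z) - a * (a' * x + b' * y + c' * z)"
    "(a * b' - b * a') * x - (b * c' - c * b') * z = b' * (a * x + b * y + c * z) - b * (a' * x + b' * y + c' * z)"
    "(b * c' - c * b') * y - (c * a' - a * c') * x = c' * (a * x + b * y + c * z) - c * (a' * x + b' * y + c' * z)"
    by (simp_all add: algebra_simps)
  then show ?thesis using 1 by (simp add: e zero_triple)
qed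

text \<open>By proportionality \<open>w1\<close> divides \<open>v1\<close> times each entry of
  \<open>w\<close>, hence \<open>v1\<close> times their gcd, which is a unit.\<close>

lemma parallel_core:
  fixes w1 :: "'a::{factorial_ring_gcd, semiring_gcd_mult_normalize}"
  assumes w1: "w1 \<noteq> 0" and v: "v1 * w2 = v2 * w1" "v1 * w3 = v3 * w1"
    and g: "\<And>g. g dvd w1 \<Longrightarrow> g dvd w2 \<Longrightarrow> g dvd w3 \<Longrightarrow> is_unit g"
  shows "\<exists>h. v1 = h * w1 \<and> v2 = h * w2 \<and> v3 = h * w3"
proof -
  have "is_unit (gcd w1 (gcd w2 w3))" by (rule g) (auto intro: dvd_trans)
  moreover have "w1 dvd gcd (v1 * w1) (gcd (v1 * w2) (v1 * w3))" by (simp add: v)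
  then have "w1 dvd v1 * gcd w1 (gcd w2 w3)" by (simp add: gcd_mult_left)
  ultimately have "w1 dvd v1" by (simp add: dvd_mult_unit_iff)
  then obtain h where h: "v1 = w1 * h" by blast
  then have "v2 = h * w2" "v3 = h * w3" using v w1 by (auto simp: mult_ac)
  then show ?thesis using h by (auto simp: mult.commute)
qed

lemma PrimI:
  fixes w1 :: "'a::{factorial_ring_gcd, semiring_gcd_mult_normalize}"
  assumes w: "(w1, w2, w3) \<noteq> 0"
    and g: "\<And>g. g dvd w1 \<Longrightarrow> g dvd w2 \<Longrightarrow> g dvd w3 \<Longrightarrow> is_unit g"
  shows "Prim (w1, w2, w3)"
  unfolding Prim_def
proof (intro allI impI)
  fix v assume c: "cross v (w1, w2, w3) = 0"
  obtain v1 v2 v3 where v: "v = (v1, v2, v3)" by (metis prod.exhaust)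
  have e: "v2 * w3 = v3 * w2" "v3 * w1 = v1 * w3" "v1 * w2 = v2 * w1" using c by (auto simp: v zero_triple)
  consider "w1 \<noteq> 0" | "w2 \<noteq> 0" | "w3 \<noteq> 0" using w by (auto simp: zero_triple)
  then have "\<exists>h. v1 = h * w1 \<and> v2 = h * w2 \<and> v3 = h * w3"
  proof cases
    case 1 then show ?thesis using parallel_core[of w1 v1 w2 v2 w3 v3] e g by auto
  next
    case 2 then show ?thesis using parallel_core[of w2 v2 w3 v3 w1 v1] e g by auto
  next
    case 3 then show ?thesis using parallel_core[of w3 v3 w1 v1 w2 v2] e g by auto
  qed
  then show "\<exists>h. v = smul h (w1, w2, w3)" by (auto simp: v)
qed

type_synonym R3 = "R \<times> R \<times> R"

fun hom3 :: "nat \<Rightarrow> R3 \<Rightarrow> bool" where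
  "hom3 n (a, b, c) \<longleftrightarrow> hom n a \<and> hom n b \<and> hom n c"

fun hcomp3 :: "nat \<Rightarrow> R3 \<Rightarrow> R3" where
  "hcomp3 n (a, b, c) = (hcomp n a, hcomp n b, hcomp n c)"

definition Syz :: "R3 \<Rightarrow> R3 set" where
  "Syz w = {\<rho>. dot \<rho> w = 0}"

definition min_syz :: "R3 \<Rightarrow> nat \<Rightarrow> R3 \<Rightarrow> bool" where
  "min_syz w r \<rho> \<longleftrightarrow> \<rho> \<in> Syz w \<and> hom3 r \<rho> \<and> \<rho> \<noteq> 0 \<and> (\<forall>k<r. \<forall>\<sigma>\<in>Syz w. hom3 k \<sigma> \<longrightarrow> \<sigma> = 0)"

lemma hom3_hcomp3: "hom3 n (hcomp3 n v)"
  by (cases v) (auto simp: hom_hcomp)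

lemma dot_hcomp3: "hom3 e w \<Longrightarrow> dot (hcomp3 m v) w = hcomp (e + m) (dot v w)"
proof -
  assume w: "hom3 e w"
  obtain a b c x y z where v: "v = (a, b, c)" "w = (x, y, z)" by (metis prod.exhaust)
  have d: "dot v w = x * a + y * b + z * c" by (simp add: v mult.commute)
  have "dot (hcomp3 m v) w = x * hcomp m a + y * hcomp m b + z * hcomp m c" by (simp add: v mult.commute)
  then show ?thesis using w unfolding d by (simp add: v hcomp_add hcomp_mult_hom)
qed

lemma hcomp3_Syz: "hom3 e w \<Longrightarrow> v \<in> Syz w \<Longrightarrow> hcomp3 m v \<in> Syz w"
  by (simp add: Syz_def dot_hcomp3)

text \<open>Dividing by a common factor \<open>g\<close> leaves a syzygy \<sigma>. Neither of them
  is known to be homogeneous, so leading forms are compared: if \<open>g\<close> has degree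
  \<open>n\<close> and \<sigma> has top degree \<open>m\<close>, then \<open>n + m = r\<close>. The
  top component of \<sigma> is again a nonzero syzygy, so minimality gives
  \<open>n = 0\<close>.\<close>

lemma min_syz_Prim:
  assumes w: "hom3 e w" and m: "min_syz w r \<rho>"
  shows "Prim \<rho>"
proof -
  obtain a b c where abc: "\<rho> = (a, b, c)" by (metis prod.exhaust)
  have rho: "\<rho> \<in> Syz w" "hom3 r \<rho>" "\<rho> \<noteq> 0" and min: "\<And>k \<sigma>. k < r \<Longrightarrow> \<sigma> \<in> Syz w \<Longrightarrow> hom3 k \<sigma> \<Longrightarrow> \<sigma> = 0"
    using m by (auto simp: min_syz_def)
  show ?thesis
    unfolding abc
  proof (rule PrimI)
    show "(a, b, c) \<noteq> 0" using rho abc by simp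
    fix g assume "g dvd a" "g dvd b" "g dvd c"
    then obtain a' b' c' where g: "a = g * a'" "b = g * b'" "c = g * c'" by blast
    let ?\<sigma> = "(a', b', c')"
    have g0: "g \<noteq> 0" using g rho abc by (auto simp: zero_triple)
    have "g * dot ?\<sigma> w = dot \<rho> w" using abc g by (cases w) (simp add: algebra_simps)
    then have s: "?\<sigma> \<in> Syz w" using rho(1) g0 by (simp add: Syz_def)
    obtain n where n: "hcomp n g \<noteq> 0" "\<forall>i>n. hcomp i g = 0" using top_degree_exists g0 by blast
    let ?P = "\<lambda>m. hcomp3 m ?\<sigma> \<noteq> 0"
    obtain D1 D2 D3 where D: "\<forall>n>D1. hcomp n a' = 0" "\<forall>n>D2. hcomp n b' = 0" "\<forall>n>D3. hcomp n c' = 0"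
      using hcomp_bound by metis
    have "?\<sigma> \<noteq> 0" using rho(3) abc g by (auto simp: zero_triple)
    then have ex: "\<exists>m. ?P m"
      using top_degree_exists[of a'] top_degree_exists[of b'] top_degree_exists[of c'] by (auto simp: zero_triple)
    have bd: "\<And>m. ?P m \<Longrightarrow> m \<le> D1 + D2 + D3" using D by (auto simp: zero_triple) (meson leI le_add1 le_add2 le_trans trans_le_add1)+
    obtain m where m: "?P m" "\<And>i. ?P i \<Longrightarrow> i \<le> m"
      using GreatestI_ex_nat[of ?P, OF ex bd] Greatest_le_nat[of ?P, OF _ bd] by blast
    have mi: "hcomp i a' = 0 \<and> hcomp i b' = 0 \<and> hcomp i c' = 0" if "i > m" for i
      using m(2)[of i] that by (auto simp: zero_triple)
    have top: "hcomp (n + m) a = hcomp n g * hcomp m a'" "hcomp (n + m) b = hcomp n g * hcomp m b'"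
      "hcomp (n + m) c = hcomp n g * hcomp m c'"
      unfolding g using mi n by (auto intro!: hcomp_mult_top(1))
    have "\<exists>x\<in>{a, b, c}. hcomp (n + m) x \<noteq> 0"
      using m(1) n(1) by (auto simp: zero_triple top)
    then have nm: "n + m = r" using rho(2) abc hcomp_hom by (metis hom3.simps insertE singletonD)
    have "\<not> m < r" using min[OF _ hcomp3_Syz[OF w s] hom3_hcomp3] m(1) by blast
    then have "n = 0" using nm by simp
    then have gh: "hom 0 g" using sum_hcomp[OF n(2)] hom_hcomp[of 0 g] by simp
    then have "\<Phi> (\<Psi> g) = g" "homog 0 (\<Psi> g)" by (auto simp: \<Phi>_\<Psi> homog_\<Psi>)
    then have "keys (\<Psi> g) \<subseteq> {0}"
    proof (intro subsetI)
      fix m assume m: "m \<in> keys (\<Psi> g)"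
      then have "tdeg m = 0" using \<open>homog 0 (\<Psi> g)\<close> by (auto simp: homog_def)
      then have "lookup m a = 0" for a by (cases "a \<in> keys m") (auto simp: tdeg_def in_keys_iff)
      then show "m \<in> {0}" by (simp add: poly_mapping_eqI)
    qed
    from keys_const_is_unit[OF this] g0 show "is_unit g" by (simp add: \<Phi>_\<Psi>)
  qed
qed

section \<open>Syzygies and Hilbert functions\<close>

abbreviation scR3 :: "complex \<Rightarrow> R3 \<Rightarrow> R3" where "scR3 \<equiv> \<lambda>c v. smul (K c) v"

interpretation VT: quot_space scR3
proof
  fix a b :: complex and x y :: R3
  obtain p q r p' q' r' where "x = (p, q, r)" "y = (p', q', r')" by (metis prod.exhaust)
  then show "smul (K a) (x + y) = smul (K a) x + smul (K a) y"
    "smul (K (a + b)) x = smul (K a) x + smul (K b) x"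
    "smul (K a) (smul (K b) x) = smul (K (a * b)) x" "smul (K 1) x = x"
    by (simp_all add: algebra_simps K_add K_mult K_1)
qed

interpretation VTR: quot_space_pair scR3 scR ..
interpretation VRT: quot_space_pair scR scR3 ..
interpretation VTT: quot_space_pair scR3 scR3 ..
interpretation VRR: quot_space_pair scR scR ..

lemma VRR_linearI:
  "\<lbrakk>\<And>x y. T (x + y) = T x + T y; \<And>c x. T (K c * x) = K c * T x\<rbrakk>
    \<Longrightarrow> Vector_Spaces.linear scR scR T"
  by (simp add: Vector_Spaces.linear_iff VR.vector_space_axioms)
lemma VTR_linearI:
  "\<lbrakk>\<And>x y. T (x + y) = T x + T y; \<And>c x. T (smul (K c) x) = K c * T x\<rbrakk>
    \<Longrightarrow> Vector_Spaces.linear scR3 scR T"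
  by (simp add: Vector_Spaces.linear_iff VR.vector_space_axioms VT.vector_space_axioms)
lemma VRT_linearI:
  "\<lbrakk>\<And>x y. T (x + y) = T x + T y; \<And>c x. T (K c * x) = smul (K c) (T x)\<rbrakk>
    \<Longrightarrow> Vector_Spaces.linear scR scR3 T"
  by (simp add: Vector_Spaces.linear_iff VR.vector_space_axioms VT.vector_space_axioms)
lemma VTT_linearI:
  "\<lbrakk>\<And>x y. T (x + y) = T x + T y; \<And>c x. T (smul (K c) x) = smul (K c) (T x)\<rbrakk>
    \<Longrightarrow> Vector_Spaces.linear scR3 scR3 T"
  by (simp add: Vector_Spaces.linear_iff VT.vector_space_axioms)

lemma dot_add_left: "dot (u + v) w = dot u w + dot v w"
  and dot_smul_left: "dot (smul p u) w = p * dot u w"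
  and dot_0_left [simp]: "dot 0 w = 0"
  by (cases u; cases v; cases w; simp add: algebra_simps zero_triple)+

lemma cross_add_right: "cross u (v + w) = cross u v + cross u w"
  and cross_smul_right: "cross u (smul p w) = smul p (cross u w)"
  and cross_anti: "cross v u = - cross u v"
  by (cases u; cases v; cases w; simp add: algebra_simps)+

lemma smul_add_left: "smul (p + q) w = smul p w + smul q w"
  and smul_smul: "smul p (smul q w) = smul (p * q) w"
  and smul_0_left [simp]: "smul 0 w = 0" and smul_0_right [simp]: "smul p 0 = 0"
  and smul_1 [simp]: "smul 1 w = w"
  and smul_uminus_left: "smul (- p) w = - smul p w"
  and smul_diff_right: "smul p (v - w) = smul p v - smul p w"
  by (cases v; cases w; simp add: algebra_simps zero_triple)+

lemma smul_eq_0_iff: "smul p w = 0 \<longleftrightarrow> p = 0 \<or> w = (0 :: 'a::idom \<times> 'a \<times> 'a)"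
  by (cases w) (auto simp: zero_triple)

lemma smul_cancel: "smul p w = smul q w \<longleftrightarrow> p = q \<or> w = (0 :: 'a::idom \<times> 'a \<times> 'a)"
  by (cases w) (auto simp: zero_triple)

lemma hom3_add: "hom3 n u \<Longrightarrow> hom3 n v \<Longrightarrow> hom3 n (u + v)"
  and hom3_smul: "hom m p \<Longrightarrow> hom3 n v \<Longrightarrow> hom3 (m + n) (smul p v)"
  and hom3_0 [simp]: "hom3 n 0"
  by (cases u; cases v; auto simp: hom_add hom_mult zero_triple)+

lemma hom3_K_smul: "hom3 n v \<Longrightarrow> hom3 n (smul (K c) v)"
  using hom3_smul[OF hom_K] by simp

lemma hom_dot: "hom3 m u \<Longrightarrow> hom3 n v \<Longrightarrow> hom (m + n) (dot u v)"
  by (cases u; cases v) (auto intro!: hom_add hom_mult)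

lemma hom3_cross: "hom3 m u \<Longrightarrow> hom3 n v \<Longrightarrow> hom3 (m + n) (cross u v)"
  by (cases u; cases v) (auto intro!: hom_diff hom_mult)

lemma hcomp3_smul: "hom3 n v \<Longrightarrow> hcomp3 (n + m) (smul p v) = smul (hcomp m p) v"
  by (cases v) (auto simp: hcomp_mult_hom mult.commute[of p] mult.commute[of _ "hcomp m p"])

lemma hcomp3_smul_small: "hom3 n v \<Longrightarrow> i < n \<Longrightarrow> hcomp3 i (smul p v) = 0"
  by (cases v) (auto simp: hcomp_mult_hom(2) mult.commute[of p] zero_triple)

lemma hcomp3_cross: "hom3 r \<rho> \<Longrightarrow> hcomp3 (r + k) (cross \<rho> \<sigma>) = cross \<rho> (hcomp3 k \<sigma>)"
  by (cases \<rho>; cases \<sigma>) (auto simp: hcomp_diff hcomp_mult_hom)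

lemma hcomp3_hom3: "hom3 m v \<Longrightarrow> hcomp3 n v = (if n = m then v else 0)"
  by (cases v) (auto simp: hcomp_hom zero_triple)

section \<open>Dimensions of the syzygy module and of the Jacobian algebra\<close>

definition S3 :: "nat \<Rightarrow> R3 set" where "S3 n = {v. hom3 n v}"

definition dimS :: "nat \<Rightarrow> nat" where "dimS n = VR.qdim (Sn n) {0}"

lemma dimS: "2 * dimS n = (n + 1) * (n + 2)"
  unfolding dimS_def by (rule qdim_Sn)

lemma subspace_S3: "VT.subspace (S3 n)"
  by (auto simp: VT.subspace_def S3_def hom3_add hom3_K_smul)

text \<open>Filter by the vanishing of the first and of the first two coordinates; each of the three
  layers is a copy of \<open>Sn n\<close>.\<close>

lemma qdim_S3: "VT.fin_quot (S3 n) {0}" "VT.qdim (S3 n) {0} = 3 * dimS n"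
proof -
  define U1 where "U1 = {v \<in> S3 n. fst v = 0}"
  define U2 where "U2 = {v \<in> U1. fst (snd v) = 0}"
  have s1: "VT.subspace U1" and s2: "VT.subspace U2"
    by (auto simp: VT.subspace_def U1_def U2_def S3_def hom3_add hom3_K_smul hom_add hom_K_mult)
  have l1: "Vector_Spaces.linear scR3 scR fst"
    and l2: "Vector_Spaces.linear scR3 scR (\<lambda>v. fst (snd v))"
    and l3: "Vector_Spaces.linear scR3 scR (\<lambda>v. snd (snd v))"
    by (rule VTR_linearI; auto)+
  note z = VR.subspace_single_0
  have i1: "VT.fin_quot (S3 n) U1 \<longleftrightarrow> VR.fin_quot (Sn n) {0}" "VT.fin_quot (S3 n) U1 \<Longrightarrow> VT.qdim (S3 n) U1 = VR.qdim (Sn n) {0}"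
    by (rule VTR.qdim_iso[OF l1 subspace_S3 s1 z]; force simp: S3_def U1_def Sn_def)+
  have i2: "VT.fin_quot U1 U2 \<longleftrightarrow> VR.fin_quot (Sn n) {0}" "VT.fin_quot U1 U2 \<Longrightarrow> VT.qdim U1 U2 = VR.qdim (Sn n) {0}"
    by (rule VTR.qdim_iso[OF l2 s1 s2 z]; force simp: S3_def U1_def U2_def Sn_def)+
  have i3: "VT.fin_quot U2 {0} \<longleftrightarrow> VR.fin_quot (Sn n) {0}" "VT.fin_quot U2 {0} \<Longrightarrow> VT.qdim U2 {0} = VR.qdim (Sn n) {0}"
    by (rule VTR.qdim_iso[OF l3 s2 VT.subspace_single_0 z]; force simp: S3_def U1_def U2_def Sn_def zero_triple)+
  have f1: "VT.fin_quot U1 {0}"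
    by (rule VT.fin_quot_trans[of U1 U2]) (use i2 i3 qdim_Sn in \<open>auto simp: U2_def\<close>)
  show F: "VT.fin_quot (S3 n) {0}"
    by (rule VT.fin_quot_trans[of _ U1]) (use i1 f1 qdim_Sn in \<open>auto simp: U1_def\<close>)
  have "VT.qdim (S3 n) {0} = VT.qdim (S3 n) U1 + VT.qdim U1 {0}"
    by (rule VT.qdim_add_0[OF s1 subspace_S3 _ F]) (auto simp: U1_def)
  also have "VT.qdim U1 {0} = VT.qdim U1 U2 + VT.qdim U2 {0}"
    by (rule VT.qdim_add_0[OF s2 s1 _ f1]) (auto simp: U2_def)
  finally show "VT.qdim (S3 n) {0} = 3 * dimS n"
    using i1 i2 i3 qdim_Sn(1) unfolding dimS_def by simp
qed

definition Jac :: "R3 \<Rightarrow> R set" where "Jac w = {dot v w | v. True}"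

definition hilb :: "R3 \<Rightarrow> nat \<Rightarrow> nat" where "hilb w n = VR.qdim (Sn n) (Jac w \<inter> Sn n)"

definition dimSyz :: "R3 \<Rightarrow> nat \<Rightarrow> nat" where "dimSyz w k = VT.qdim (Syz w \<inter> S3 k) {0}"

lemma subspace_Jac: "VR.subspace (Jac w)"
proof (rule VR.subspaceI)
  show "0 \<in> Jac w" unfolding Jac_def by (smt (verit) dot_0_left mem_Collect_eq)
  show "x + y \<in> Jac w" if "x \<in> Jac w" "y \<in> Jac w" for x y
    using that unfolding Jac_def by (smt (verit) dot_add_left mem_Collect_eq)
  show "K c * x \<in> Jac w" if "x \<in> Jac w" for c x
    using that unfolding Jac_def by (smt (verit) dot_smul_left mem_Collect_eq)
qed

lemma subspace_Syz: "VT.subspace (Syz w)"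
  by (auto simp: VT.subspace_def Syz_def dot_add_left dot_smul_left)

lemma Jac_hom:
  assumes w: "hom3 e w" and p: "p \<in> Jac w \<inter> Sn (e + k)"
  shows "\<exists>v\<in>S3 k. p = dot v w"
proof -
  obtain v where v: "p = dot v w" using p by (auto simp: Jac_def)
  have "p = hcomp (e + k) p" using p hcomp_hom by (auto simp: Sn_def)
  also have "\<dots> = dot (hcomp3 k v) w" using dot_hcomp3[OF w] v by simp
  finally show ?thesis using hom3_hcomp3[of k v] by (intro bexI[of _ "hcomp3 k v"]) (auto simp: S3_def)
qed

text \<open>Rank and nullity of \<open>v \<mapsto> dot v w\<close> from \<open>S3 k\<close> to
  \<open>Sn (e + k)\<close>.\<close>

lemma hilb_dimSyz:
  assumes w: "hom3 e w"
  shows "dimS (e + k) + dimSyz w k = hilb w (e + k) + 3 * dimS k"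
proof -
  let ?J = "Jac w \<inter> Sn (e + k)" and ?Z = "Syz w \<inter> S3 k"
  have sJ: "VR.subspace ?J" by (simp add: VR.subspace_inter subspace_Jac subspace_Sn)
  have sZ: "VT.subspace ?Z" by (simp add: VT.subspace_inter subspace_Syz subspace_S3)
  have l: "Vector_Spaces.linear scR3 scR (\<lambda>v. dot v w)"
    by (rule VTR_linearI) (auto simp: dot_add_left dot_smul_left)
  have 1: "VT.qdim (S3 k) {0} = VT.qdim (S3 k) ?Z + VT.qdim ?Z {0}" and f: "VT.fin_quot (S3 k) ?Z"
    by (rule VT.qdim_add_0[OF sZ subspace_S3 _ qdim_S3(1)]; auto)+
  have 2: "VT.qdim (S3 k) ?Z = VR.qdim ?J {0}"
  proof (rule VTR.qdim_iso(2)[OF l subspace_S3 sZ VR.subspace_single_0 _ _ _ _ f])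
    show "(\<lambda>v. dot v w) ` S3 k \<subseteq> ?J" using hom_dot[OF _ w, of k] by (auto simp: Jac_def Sn_def S3_def add.commute[of e] simp del: hom3.simps)
    show "\<exists>v\<in>S3 k. v' - dot v w \<in> {0}" if "v' \<in> ?J" for v' using Jac_hom[OF w that] by auto
  qed (auto simp: Syz_def)
  have 3: "VR.qdim (Sn (e + k)) {0} = VR.qdim (Sn (e + k)) ?J + VR.qdim ?J {0}"
    by (rule VR.qdim_add_0[OF sJ subspace_Sn _ qdim_Sn(1)]) auto
  show ?thesis using 1 2 3 qdim_S3(2)[of k] by (simp add: dimS_def hilb_def dimSyz_def)
qed

text \<open>A Bourbaki ideal of the syzygy module: for a syzygy \<rho>, with both \<open>w\<close>
  and \<rho> primitive, it is \<open>Syz w\<close> modulo the multiples of \<rho>, up to a shift of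
  degrees.\<close>

definition quot_ideal :: "R3 \<Rightarrow> R3 \<Rightarrow> R set" where
  "quot_ideal w \<rho> = {h. \<exists>\<sigma>\<in>Syz w. cross \<rho> \<sigma> = smul h w}"

definition hilbI :: "R3 \<Rightarrow> R3 \<Rightarrow> nat \<Rightarrow> nat" where
  "hilbI w \<rho> m = VR.qdim (Sn m) (quot_ideal w \<rho> \<inter> Sn m)"

lemma subspace_quot_ideal: "VR.subspace (quot_ideal w \<rho>)"
  unfolding VR.subspace_def quot_ideal_def
proof (intro conjI ballI allI; clarsimp)
  show "\<exists>\<sigma>\<in>Syz w. cross \<rho> \<sigma> = 0" by (rule bexI[of _ 0]; cases \<rho>; cases w; auto simp: zero_triple Syz_def)
  show "\<exists>\<tau>\<in>Syz w. cross \<rho> \<tau> = smul (x + y) w"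
    if "\<sigma> \<in> Syz w" "\<sigma>' \<in> Syz w" "cross \<rho> \<sigma> = smul x w" "cross \<rho> \<sigma>' = smul y w" for x y \<sigma> \<sigma>'
    using that by (intro bexI[of _ "\<sigma> + \<sigma>'"]) (auto simp: cross_add_right smul_add_left VT.subspace_add[OF subspace_Syz])
  show "\<exists>\<tau>\<in>Syz w. cross \<rho> \<tau> = smul (K c * x) w" if "\<sigma> \<in> Syz w" "cross \<rho> \<sigma> = smul x w" for c x \<sigma>
    using that by (intro bexI[of _ "smul (K c) \<sigma>"]) (auto simp: cross_smul_right smul_smul VT.subspace_scale[OF subspace_Syz])
qed

lemma smul_hom_divide:
  assumes "hom3 n w" "w \<noteq> 0" "hom3 m (smul p w)"
  shows "p = 0 \<or> (n \<le> m \<and> hom (m - n) p)"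
proof (cases "n \<le> m")
  case True
  then have "smul (hcomp (m - n) p) w = smul p w"
    using hcomp3_smul[OF assms(1), of "m - n" p] hcomp3_hom3[OF assms(3), of m] by simp
  then have "hcomp (m - n) p = p" using smul_cancel assms(2) by blast
  then show ?thesis using True hom_hcomp by metis
next
  case False
  then have "smul p w = 0" using hcomp3_smul_small[OF assms(1), of m p] hcomp3_hom3[OF assms(3), of m] by simp
  then show ?thesis using smul_eq_0_iff assms(2) by blast
qed

text \<open>Degree \<open>k\<close> of the exact sequence in which multiplication by \<rho> embeds S
  into \<open>Syz w\<close> and \<open>cross \<rho>\<close>, divided by \<open>w\<close>, maps
  \<open>Syz w\<close> onto \<open>quot_ideal w \<rho>\<close>. Exactness in the middle is
  primitivity of \<rho>; that the division by \<open>w\<close> is possible is primitivity of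
  \<open>w\<close>. Degrees move by \<open>r\<close> and by \<open>r - e\<close>.\<close>

lemma dimSyz_eq:
  assumes w: "hom3 e w" "w \<noteq> 0" "Prim w" and m: "min_syz w r \<rho>" and k: "k \<ge> r" "k + r \<ge> e"
  shows "dimSyz w k + hilbI w \<rho> (k + r - e) = dimS (k - r) + dimS (k + r - e)"
proof -
  have rho: "\<rho> \<in> Syz w" "hom3 r \<rho>" "\<rho> \<noteq> 0" using m by (auto simp: min_syz_def)
  have prho: "Prim \<rho>" by (rule min_syz_Prim[OF w(1) m])
  let ?m = "k + r - e" and ?Z = "Syz w \<inter> S3 k"
  let ?I = "quot_ideal w \<rho> \<inter> Sn ?m" and ?N = "(\<lambda>p. smul p \<rho>) ` Sn (k - r)"
  have sZ: "VT.subspace ?Z" by (simp add: VT.subspace_inter subspace_Syz subspace_S3)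
  have sI: "VR.subspace ?I" by (simp add: VR.subspace_inter subspace_quot_ideal subspace_Sn)
  have fZ: "VT.fin_quot ?Z {0}" by (rule VT.qdim_add_0[OF sZ subspace_S3 _ qdim_S3(1)]) auto
  have lr: "Vector_Spaces.linear scR scR3 (\<lambda>p. smul p v)" for v
    by (rule VRT_linearI) (auto simp: smul_add_left smul_smul)
  have lc: "Vector_Spaces.linear scR3 scR3 (cross \<rho>)"
    by (rule VTT_linearI) (auto simp: cross_add_right cross_smul_right)
  have sN: "VT.subspace ?N" by (rule VRT.linear_subspace_image[OF lr subspace_Sn])
  have NZ: "?N \<subseteq> ?Z"
  proof (rule image_subsetI)
    fix p assume "p \<in> Sn (k - r)"
    then have "hom3 (k - r + r) (smul p \<rho>)" using rho hom3_smul by (auto simp: Sn_def)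
    then show "smul p \<rho> \<in> ?Z" using rho k by (auto simp: S3_def Syz_def dot_smul_left)
  qed
  have ker: "cross \<rho> v \<in> {0} \<longleftrightarrow> v \<in> ?N" if "v \<in> ?Z" for v
  proof
    assume "cross \<rho> v \<in> {0}"
    then have "cross v \<rho> = 0" using cross_anti[of v \<rho>] by simp
    then obtain p where p: "v = smul p \<rho>" using prho unfolding Prim_def by blast
    have "hom (k - r) p" using smul_hom_divide[OF rho(2,3), of k p] p that by (auto simp: S3_def)
    then show "v \<in> ?N" using p by (auto simp: Sn_def)
  next
    assume "v \<in> ?N"
    then show "cross \<rho> v \<in> {0}" by (cases \<rho>) (auto simp: zero_triple algebra_simps)
  qed
  have 1: "VT.qdim ?Z {0} = VT.qdim ?Z ?N + VT.qdim ?N {0}" and fN: "VT.fin_quot ?Z ?N"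
    by (rule VT.qdim_add_0(3)[OF sN sZ NZ fZ], rule VT.qdim_add_0(1)[OF sN sZ NZ fZ])
  have 2: "VR.qdim (Sn (k - r)) {0} = VT.qdim ?N {0}"
    by (rule VRT.qdim_iso(2)[OF lr subspace_Sn VR.subspace_single_0 VT.subspace_single_0 _ _ _ _ qdim_Sn(1)])
      (auto simp: smul_eq_0_iff rho Sn_def)
  let ?Im = "(\<lambda>h. smul h w) ` ?I"
  have im: "cross \<rho> ` ?Z \<subseteq> ?Im"
  proof (rule image_subsetI)
    fix \<sigma> assume "\<sigma> \<in> ?Z"
    then have s: "\<sigma> \<in> Syz w" "\<sigma> \<in> S3 k" by auto
    have "cross (cross \<rho> \<sigma>) w = 0" by (rule cross_cross) (use rho s in \<open>auto simp: Syz_def\<close>)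
    then obtain h where h: "cross \<rho> \<sigma> = smul h w" using w(3) unfolding Prim_def by blast
    then have hI: "h \<in> quot_ideal w \<rho>" using s by (auto simp: quot_ideal_def)
    have "hom3 (r + k) (smul h w)" using hom3_cross[OF rho(2), of k \<sigma>] s h by (auto simp: S3_def)
    then have "h = 0 \<or> hom ?m h" using smul_hom_divide[OF w(1,2)] by (auto simp: add.commute)
    then have "h \<in> ?I" using hI by (auto simp: Sn_def)
    then show "cross \<rho> \<sigma> \<in> ?Im" using h by auto
  qed
  have im': "\<exists>v\<in>?Z. v' - cross \<rho> v \<in> {0}" if v': "v' \<in> ?Im" for v'
  proof -
    obtain h \<sigma> where h: "h \<in> Sn ?m" "v' = smul h w" "\<sigma> \<in> Syz w" "cross \<rho> \<sigma> = smul h w"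
      using v' by (auto simp: quot_ideal_def)
    \<comment> \<open>The preimage \<sigma> need not be homogeneous; its component of degree
      \<open>k\<close> has the same image, since \<open>smul h w\<close> has degree
      \<open>r + k\<close>.\<close>
    have "cross \<rho> (hcomp3 k \<sigma>) = hcomp3 (r + k) (smul h w)" using hcomp3_cross[OF rho(2)] h by metis
    also have "r + k = e + ?m" using k by simp
    also have "hcomp3 (e + ?m) (smul h w) = smul h w"
      using hcomp3_smul[OF w(1)] h hcomp_hom by (auto simp: Sn_def)
    finally show ?thesis using h hcomp3_Syz[OF w(1)] hom3_hcomp3 by (intro bexI[of _ "hcomp3 k \<sigma>"]) (auto simp: S3_def)
  qed
  have 3: "VT.qdim ?Z ?N = VT.qdim ?Im {0}"
    by (rule VTT.qdim_iso(2)[OF lc sZ sN VT.subspace_single_0 NZ im ker im' fN])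
  have 4: "VR.qdim (Sn ?m) {0} = VR.qdim (Sn ?m) ?I + VR.qdim ?I {0}" and fI: "VR.fin_quot ?I {0}"
    by (rule VR.qdim_add_0[OF sI subspace_Sn _ qdim_Sn(1)]; auto)+
  have 5: "VR.qdim ?I {0} = VT.qdim ?Im {0}"
    by (rule VRT.qdim_iso(2)[OF lr sI VR.subspace_single_0 VT.subspace_single_0 _ _ _ _ fI])
      (use VR.subspace_0[OF sI] in \<open>auto simp: smul_eq_0_iff w\<close>)
  show ?thesis using 1 2 3 4 5 unfolding dimSyz_def hilbI_def dimS_def by linarith
qed

text \<open>The two counts share the term \<open>dimSyz w k\<close>, which cancels. The remaining
  binomial coefficients are quadratic in \<open>k\<close>, but their combination is constant.
  Everything is doubled to stay within integer polynomials.\<close>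

lemma hilb_formula:
  assumes w: "hom3 e w" "w \<noteq> 0" "Prim w" and m: "min_syz w r \<rho>" and k: "k \<ge> r" "k + r \<ge> e"
  shows "int (hilb w (e + k)) + int (hilbI w \<rho> (k + r - e)) = (int e)\<^sup>2 - int r * (int e - int r)"
proof -
  have d: "2 * int (dimS n) = (int n + 1) * (int n + 2)" for n
    using arg_cong[OF dimS[of n], of int] by (simp only: of_nat_mult of_nat_add of_nat_numeral of_nat_1)
  have 1: "int (dimS (e + k)) + int (dimSyz w k) = int (hilb w (e + k)) + 3 * int (dimS k)"
    using hilb_dimSyz[OF w(1), of k] by linarith
  have 2: "int (dimSyz w k) + int (hilbI w \<rho> (k + r - e)) = int (dimS (k - r)) + int (dimS (k + r - e))"
    using dimSyz_eq[OF w m k] by linarith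
  have aux: "A + B = C + 3 * D \<Longrightarrow> B + E = F + G \<Longrightarrow> 2 * (C + E) = 2 * A - 3 * (2 * D) + 2 * F + 2 * G"
    for A B C D E F G :: int
  proof -
    assume "A + B = C + 3 * D" "B + E = F + G"
    then have "C = A + B - 3 * D" "E = F + G - B" by auto
    then show "2 * (C + E) = 2 * A - 3 * (2 * D) + 2 * F + 2 * G" by simp
  qed
  have i: "int (k - r) = int k - int r" "int (k + r - e) = int k + int r - int e" using k by auto
  have "2 * (int (hilb w (e + k)) + int (hilbI w \<rho> (k + r - e)))
    = 2 * int (dimS (e + k)) - 3 * (2 * int (dimS k)) + 2 * int (dimS (k - r)) + 2 * int (dimS (k + r - e))"
    by (rule aux[OF 1 2])
  also have "\<dots> = 2 * ((int e)\<^sup>2 - int r * (int e - int r))"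
    unfolding d i by (simp add: algebra_simps power2_eq_square)
  finally show ?thesis by simp
qed

text \<open>A Koszul relation bounds the least degree of a syzygy by \<open>e\<close>.\<close>

lemma Koszul_syz:
  assumes w: "hom3 e w" "w \<noteq> 0"
  shows "\<exists>\<sigma>\<in>Syz w. hom3 e \<sigma> \<and> \<sigma> \<noteq> 0"
proof -
  obtain a b c where abc: "w = (a, b, c)" by (metis prod.exhaust)
  then have h: "hom e a" "hom e b" "hom e c" using w by auto
  show ?thesis
  proof (cases "a = 0 \<and> b = 0")
    case True
    then show ?thesis using w h abc by (intro bexI[of _ "(c, 0, 0)"]) (auto simp: Syz_def zero_triple)
  next
    case False
    then show ?thesis using w h abc by (intro bexI[of _ "(b, - a, 0)"]) (auto simp: Syz_def zero_triple hom_uminus)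
  qed
qed

lemma min_syz_exists:
  assumes w: "hom3 e w" "w \<noteq> 0"
  shows "\<exists>r \<rho>. min_syz w r \<rho> \<and> r \<le> e"
proof -
  let ?P = "\<lambda>r. \<exists>\<sigma>\<in>Syz w. hom3 r \<sigma> \<and> \<sigma> \<noteq> 0"
  have e: "?P e" by (rule Koszul_syz[OF w])
  define r where "r = (LEAST r. ?P r)"
  have "?P r" unfolding r_def by (rule LeastI[of ?P, OF e])
  moreover have "\<not> ?P k" if "k < r" for k using not_less_Least[of k ?P] that unfolding r_def by blast
  moreover have "r \<le> e" unfolding r_def by (rule Least_le[of ?P, OF e])
  ultimately show ?thesis unfolding min_syz_def by blast
qed

text \<open>Drop the nonnegative term \<open>hilbI\<close> from the formula. For
  \<open>n \<ge> 3 * e\<close> the value \<open>k = n - e\<close> satisfies both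
  \<open>k \<ge> r\<close> and \<open>k + r \<ge> e\<close>, as \<open>r \<le> e\<close>. The lemma
  is later applied to the gradient and to its minimal syzygy.\<close>

lemma hilb_bounded:
  assumes w: "hom3 e w" "w \<noteq> 0" "Prim w"
  shows "\<exists>B. \<forall>n\<ge>3 * e. hilb w n \<le> B"
proof -
  obtain r \<rho> where m: "min_syz w r \<rho>" "r \<le> e" using min_syz_exists[OF w(1,2)] by blast
  have "hilb w n \<le> nat ((int e)\<^sup>2 - int r * (int e - int r))" if n: "n \<ge> 3 * e" for n
  proof -
    have "int (hilb w (e + (n - e))) + int (hilbI w \<rho> ((n - e) + r - e)) = (int e)\<^sup>2 - int r * (int e - int r)"
      by (rule hilb_formula[OF w m(1)]) (use n m in auto)
    moreover have "e + (n - e) = n" using n by simp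
    ultimately have "int (hilb w n) \<le> (int e)\<^sup>2 - int r * (int e - int r)" by simp
    then show ?thesis by linarith
  qed
  then show ?thesis by blast
qed

section \<open>Homogeneous ideals and their zeros\<close>

definition idl :: "R set \<Rightarrow> bool" where
  "idl I \<longleftrightarrow> 0 \<in> I \<and> (\<forall>a\<in>I. \<forall>b\<in>I. a + b \<in> I) \<and> (\<forall>r. \<forall>a\<in>I. r * a \<in> I)"

definition hidl :: "R set \<Rightarrow> bool" where
  "hidl I \<longleftrightarrow> idl I \<and> (\<forall>p\<in>I. \<forall>n. hcomp n p \<in> I)"

definition isum :: "R set \<Rightarrow> R set \<Rightarrow> R set" where
  "isum A B = {a + b | a b. a \<in> A \<and> b \<in> B}"

definition prin :: "R \<Rightarrow> R set" where
  "prin c = {c * r | r. True}"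

lemma idl_0: "idl I \<Longrightarrow> 0 \<in> I"
  and idl_add: "idl I \<Longrightarrow> a \<in> I \<Longrightarrow> b \<in> I \<Longrightarrow> a + b \<in> I"
  and idl_mult: "idl I \<Longrightarrow> a \<in> I \<Longrightarrow> r * a \<in> I"
  and idl_mult': "idl I \<Longrightarrow> a \<in> I \<Longrightarrow> a * r \<in> I"
  by (auto simp: idl_def mult.commute[of a])

lemma idl_uminus: "idl I \<Longrightarrow> a \<in> I \<Longrightarrow> - a \<in> I"
  using idl_mult[of I a "-1"] by simp

lemma idl_diff: "idl I \<Longrightarrow> a \<in> I \<Longrightarrow> b \<in> I \<Longrightarrow> a - b \<in> I"
  using idl_add[of I a "- b"] idl_uminus[of I b] by simp

lemma idl_sum: "idl I \<Longrightarrow> (\<And>a. a \<in> A \<Longrightarrow> g a \<in> I) \<Longrightarrow> sum g A \<in> I"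
  by (induction A rule: infinite_finite_induct) (auto simp: idl_0 idl_add)

lemma hidl_idl: "hidl I \<Longrightarrow> idl I"
  by (simp add: hidl_def)

lemma subspace_idl: "idl I \<Longrightarrow> VR.subspace I"
  by (auto simp: VR.subspace_def idl_def)

lemma idl_isum: "idl A \<Longrightarrow> idl B \<Longrightarrow> idl (isum A B)"
  unfolding idl_def[of "isum A B"]
proof (intro conjI ballI allI)
  assume AB: "idl A" "idl B"
  show "0 \<in> isum A B" unfolding isum_def using idl_0 AB by force
  show "x + y \<in> isum A B" if xy: "x \<in> isum A B" "y \<in> isum A B" for x y
  proof -
    obtain a b a' b' where "x = a + b" "y = a' + b'" "a \<in> A" "b \<in> B" "a' \<in> A" "b' \<in> B"
      using xy unfolding isum_def by blast
    then have "x + y = (a + a') + (b + b')" "a + a' \<in> A" "b + b' \<in> B" using AB by (auto simp: idl_add)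
    then show ?thesis unfolding isum_def by blast
  qed
  show "r * x \<in> isum A B" if x: "x \<in> isum A B" for r x
  proof -
    obtain a b where "x = a + b" "a \<in> A" "b \<in> B" using x unfolding isum_def by blast
    then have "r * x = r * a + r * b" "r * a \<in> A" "r * b \<in> B" using AB by (auto simp: idl_mult idl_mult' algebra_simps)
    then show ?thesis unfolding isum_def by blast
  qed
qed

lemma isum_left: "idl B \<Longrightarrow> a \<in> A \<Longrightarrow> a \<in> isum A B"
  using idl_0[of B] unfolding isum_def by force

lemma isum_right: "idl A \<Longrightarrow> b \<in> B \<Longrightarrow> b \<in> isum A B"
  using idl_0[of A] unfolding isum_def by force

lemma isum_subset: "idl I \<Longrightarrow> A \<subseteq> I \<Longrightarrow> B \<subseteq> I \<Longrightarrow> isum A B \<subseteq> I"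
  using idl_add unfolding isum_def by blast

lemma isumE: assumes "p \<in> isum A B" obtains a b where "a \<in> A" "b \<in> B" "p = a + b"
  using assms unfolding isum_def by blast

lemma idl_prin: "idl (prin c)"
  unfolding idl_def prin_def
  by (auto intro: exI[of _ 0]) (metis distrib_left mult.left_commute)+

lemma hidl_isum: "hidl A \<Longrightarrow> hidl B \<Longrightarrow> hidl (isum A B)"
  unfolding hidl_def using idl_isum
  proof (intro conjI ballI allI, blast)
  fix p n assume AB: "idl A \<and> (\<forall>p\<in>A. \<forall>n. hcomp n p \<in> A)" "idl B \<and> (\<forall>p\<in>B. \<forall>n. hcomp n p \<in> B)"
    and p: "p \<in> isum A B"
  obtain a b where "a \<in> A" "b \<in> B" "p = a + b" using p by (rule isumE)
  then have "hcomp n a \<in> A" "hcomp n b \<in> B" "hcomp n p = hcomp n a + hcomp n b" using AB by (auto simp: hcomp_add)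
  then show "hcomp n p \<in> isum A B" unfolding isum_def by blast
qed

lemma hidl_prin: assumes "hom m c" shows "hidl (prin c)"
  unfolding hidl_def
proof (intro conjI idl_prin ballI allI)
  fix p n assume "p \<in> prin c"
  then obtain r where p: "p = c * r" unfolding prin_def by blast
  show "hcomp n p \<in> prin c"
  proof (cases "m \<le> n")
    case True
    then have "hcomp n p = c * hcomp (n - m) r" using hcomp_mult_hom(1)[OF assms, of "n - m" r] p by simp
    then show ?thesis unfolding prin_def by blast
  next
    case False
    then have "hcomp n p = 0" using hcomp_mult_hom(2)[OF assms] p by simp
    then show ?thesis using idl_0[OF idl_prin] by simp
  qed
qed

lemma hidl_Jac: assumes "hom3 e w" shows "hidl (Jac w)"
  unfolding hidl_def
proof (intro conjI ballI allI)
  show "idl (Jac w)"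
    unfolding idl_def
  proof (intro conjI ballI allI)
    show "0 \<in> Jac w" and "\<And>x y. x \<in> Jac w \<Longrightarrow> y \<in> Jac w \<Longrightarrow> x + y \<in> Jac w"
      using VR.subspace_0 VR.subspace_add subspace_Jac by blast+
    show "r * x \<in> Jac w" if "x \<in> Jac w" for r x
      using that unfolding Jac_def by (smt (verit) dot_smul_left mem_Collect_eq)
  qed
  fix p n assume "p \<in> Jac w"
  then obtain v where p: "p = dot v w" unfolding Jac_def by blast
  show "hcomp n p \<in> Jac w"
  proof (cases "e \<le> n")
    case True
    then have "hcomp n p = dot (hcomp3 (n - e) v) w" using dot_hcomp3[OF assms, of "n - e" v] p by simp
    then show ?thesis unfolding Jac_def by blast
  next
    case False
    obtain a b c x y z where v: "v = (a, b, c)" "w = (x, y, z)" by (metis prod.exhaust)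
    have "p = x * a + y * b + z * c" using p v by (simp add: mult.commute)
    moreover have "hcomp n (x * a) = 0" "hcomp n (y * b) = 0" "hcomp n (z * c) = 0"
      using False assms v by (auto intro!: hcomp_mult_hom(2)[of e])
    ultimately have "hcomp n p = 0" by (simp add: hcomp_add)
    then show ?thesis using VR.subspace_0[OF subspace_Jac] by simp
  qed
qed

text \<open>Homogenizing with powers of \<open>l\<close> annihilates multiples of \<open>l - 1\<close>.\<close>

lemma homogenize:
  assumes I: "hidl I" and l: "hom 1 l" and p: "hom n p" and mem: "p \<in> isum I (prin (l - 1))"
  shows "\<exists>m. l ^ m * p \<in> I"
proof -
  obtain k u where ku: "k \<in> I" "p = k + (l - 1) * u" using mem unfolding isum_def prin_def by blast
  obtain D where D: "\<forall>i>D. hcomp i u = 0" using hcomp_bound by blast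
  define N where "N = Suc D + n"
  \<comment> \<open>Homogenization to degree \<open>N\<close>, additive in its argument. The cut-off
    \<open>N\<close> lies beyond the degrees of \<open>p\<close> and of \<open>u\<close>, so that no
    component of either is lost and \<theta> takes the same value at \<open>l * u\<close> and at
    \<open>u\<close>.\<close>
  define \<theta> where "\<theta> q = (\<Sum>i\<le>N. l ^ (N - i) * hcomp i q)" for q
  have add: "\<theta> (q + q') = \<theta> q + \<theta> q'" for q q' by (simp add: \<theta>_def hcomp_add algebra_simps sum.distrib)
  have "\<theta> p = (\<Sum>i\<le>N. if i = n then l ^ (N - n) * p else 0)"
    unfolding \<theta>_def by (intro sum.cong refl) (auto simp: hcomp_hom[OF p])
  then have tp: "\<theta> p = l ^ (N - n) * p" by (simp add: N_def)
  have tk: "\<theta> k \<in> I" unfolding \<theta>_def using I ku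
    by (intro idl_sum[OF hidl_idl[OF I]] idl_mult[OF hidl_idl[OF I]]) (auto simp: hidl_def)
  have "\<theta> (l * u) = \<theta> u"
  proof -
    obtain N' where N': "N = Suc N'" "N' \<ge> D" unfolding N_def by auto
    have h0: "hcomp 0 (l * u) = 0" using hcomp_mult_hom(2)[OF l, of 0] by simp
    have hs: "hcomp (Suc i) (l * u) = l * hcomp i u" for i using hcomp_mult_hom(1)[OF l, of i] by simp
    have "\<theta> (l * u) = (\<Sum>i\<le>N'. l ^ (N' - i) * (l * hcomp i u))"
      unfolding \<theta>_def N' by (subst sum.atMost_Suc_shift) (simp add: h0 hs)
    also have "\<dots> = (\<Sum>i\<le>N'. l ^ (N - i) * hcomp i u)"
      by (intro sum.cong refl) (simp add: N' Suc_diff_le mult_ac)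
    also have "\<dots> = \<theta> u" unfolding \<theta>_def N' using D N' by simp
    finally show ?thesis .
  qed
  moreover have "\<theta> (l * u) = \<theta> ((l - 1) * u) + \<theta> u" using add[of "(l - 1) * u" u] by (simp add: algebra_simps)
  ultimately have "\<theta> ((l - 1) * u) = 0" by simp
  then have "\<theta> p = \<theta> k" using ku add by simp
  then show ?thesis using tp tk by metis
qed

section \<open>Points of the projective plane and finiteness of zero sets\<close>

abbreviation evp :: "R \<Rightarrow> (nat \<Rightarrow> complex) \<Rightarrow> complex" where
  "evp p a \<equiv> ev3 p (a 0) (a 1) (a 2)"

definition vanish :: "R3 \<Rightarrow> (nat \<Rightarrow> complex) \<Rightarrow> bool" where
  "vanish w a \<longleftrightarrow> evp (fst w) a = 0 \<and> evp (fst (snd w)) a = 0 \<and> evp (snd (snd w)) a = 0"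

definition zeros :: "R3 \<Rightarrow> (nat \<Rightarrow> complex) set" where
  "zeros w = {a \<in> proj_pts. vanish w a}"

lemma proj_pts_norm:
  assumes "(a, b, c) \<noteq> (0, 0, 0)"
  shows "\<exists>p\<in>proj_pts. \<exists>s. s \<noteq> 0 \<and> a = s * p 0 \<and> b = s * p 1 \<and> c = s * p 2"
proof (cases "a = 0")
  case False
  then show ?thesis
    by (intro bexI[of _ "\<lambda>i. if i = 0 then 1 else if i = 1 then b / a else if i = 2 then c / a else 0"] exI[of _ a])
      (auto simp: proj_pts_def intro!: exI[of _ 0])
next
  case a: True
  show ?thesis
  proof (cases "b = 0")
    case False
    then show ?thesis using a
      by (intro bexI[of _ "\<lambda>i. if i = 1 then 1 else if i = 2 then c / b else 0"] exI[of _ b])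
        (auto simp: proj_pts_def intro!: exI[of _ 1])
  next
    case True
    then show ?thesis using a assms
      by (intro bexI[of _ "\<lambda>i. if i = 2 then 1 else 0"] exI[of _ c])
        (auto simp: proj_pts_def intro!: exI[of _ 2])
  qed
qed

lemma proj_pts_nonzero: "a \<in> proj_pts \<Longrightarrow> a 0 \<noteq> 0 \<or> a 1 \<noteq> 0 \<or> a 2 \<noteq> 0"
proof -
  assume "a \<in> proj_pts"
  then obtain k where k: "k \<le> 2" "a k = 1" by (auto simp: proj_pts_def)
  then have "k = 0 \<or> k = 1 \<or> k = 2" by auto
  then show ?thesis using k by auto
qed

lemma proj_pts_parallel:
  assumes a: "a \<in> proj_pts" and b: "b \<in> proj_pts"
    and p: "a 0 * b 1 = a 1 * b 0" "a 0 * b 2 = a 2 * b 0" "a 1 * b 2 = a 2 * b 1"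
  shows "a = b"
proof -
  obtain k where k: "k \<le> 2" "a k = 1" "\<forall>j<k. a j = 0" and a3: "\<forall>i>2. a i = 0" using a by (auto simp: proj_pts_def)
  obtain l where l: "l \<le> 2" "b l = 1" "\<forall>j<l. b j = 0" and b3: "\<forall>i>2. b i = 0" using b by (auto simp: proj_pts_def)
  have "k = 0 \<or> k = 1 \<or> k = 2" "l = 0 \<or> l = 1 \<or> l = 2" using k l by auto
  then have "a 0 = b 0 \<and> a 1 = b 1 \<and> a 2 = b 2" using k l p by (elim disjE) auto
  moreover have "i = 0 \<or> i = 1 \<or> i = 2 \<or> i > 2" for i :: nat by auto
  ultimately show "a = b" using a3 b3 by (intro ext) metis
qed

lemma separating_form:
  assumes a: "a \<in> proj_pts" and b: "b \<in> proj_pts" and ab: "a \<noteq> b"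
  shows "\<exists>q. hom 1 q \<and> evp q a \<noteq> 0 \<and> evp q b = 0"
proof -
  have "a 0 * b 1 \<noteq> a 1 * b 0 \<or> a 0 * b 2 \<noteq> a 2 * b 0 \<or> a 1 * b 2 \<noteq> a 2 * b 1"
    using proj_pts_parallel[OF a b] ab by blast
  then consider "a 0 * b 1 \<noteq> a 1 * b 0" | "a 0 * b 2 \<noteq> a 2 * b 0" | "a 1 * b 2 \<noteq> a 2 * b 1" by blast
  then show ?thesis
  proof cases
    case 1
    then show ?thesis
      by (intro exI[of _ "K (b 1) * X - K (b 0) * Y"] conjI hom_diff hom_K_mult hom_X hom_Y)
        (use 1 in \<open>simp_all add: mult.commute\<close>)
  next
    case 2
    then show ?thesis
      by (intro exI[of _ "K (b 2) * X - K (b 0) * Z"] conjI hom_diff hom_K_mult hom_X hom_Z)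
        (use 2 in \<open>simp_all add: mult.commute\<close>)
  next
    case 3
    then show ?thesis
      by (intro exI[of _ "K (b 2) * Y - K (b 1) * Z"] conjI hom_diff hom_K_mult hom_Y hom_Z)
        (use 3 in \<open>simp_all add: mult.commute\<close>)
  qed
qed

lemma nonvanishing_form:
  assumes a: "a \<in> proj_pts"
  shows "\<exists>q. hom 1 q \<and> evp q a \<noteq> 0"
  using proj_pts_nonzero[OF a] hom_X hom_Y hom_Z ev3_simps(9-11) by metis

lemma hom_prod_linear:
  assumes "finite A" "\<And>b. b \<in> A \<Longrightarrow> hom 1 (g b)"
  shows "hom (card A) (prod g A)"
  using assms
proof (induction A rule: finite_induct)
  case (insert x A)
  then have "hom (1 + card A) (g x * prod g A)" by (intro hom_mult) auto
  then show ?case using insert by simp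
qed (simp add: hom_1)

lemma ev3_prod: "ev3 (prod g A) a b c = (\<Prod>x\<in>A. ev3 (g x) a b c)"
  by (induction A rule: infinite_finite_induct) auto

lemma evp_Jac: "vanish w a \<Longrightarrow> p \<in> Jac w \<Longrightarrow> evp p a = 0"
  unfolding Jac_def vanish_def by (cases w) auto

lemma fin_quot_hilb: "VR.fin_quot (Sn n) (Jac w \<inter> Sn n)"
  by (rule VR.fin_quot_mono[OF qdim_Sn(1)]) (simp add: VR.subspace_0[OF subspace_Jac] Sn_def)

text \<open>Interpolation: for \<open>B + 1\<close> common zeros there are forms of one degree, each
  nonzero at exactly one of them. As the ideal vanishes at these points, the forms are independent
  modulo it, so \<open>hilb\<close> would exceed \<open>B\<close>.\<close>

lemma finite_zeros:
  assumes w: "hom3 e w" and B: "\<forall>n\<ge>n0. hilb w n \<le> B"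
  shows "finite (zeros w)"
proof (rule ccontr)
  assume "infinite (zeros w)"
  then obtain F where F: "finite F" "card F = Suc B" "F \<subseteq> zeros w" using infinite_arbitrarily_large by blast
  have Fp: "a \<in> proj_pts" if "a \<in> F" for a using F that by (auto simp: zeros_def)
  obtain L where L: "\<And>a b. a \<in> F \<Longrightarrow> b \<in> F \<Longrightarrow> a \<noteq> b \<Longrightarrow> hom 1 (L a b) \<and> evp (L a b) a \<noteq> 0 \<and> evp (L a b) b = 0"
    using separating_form Fp by metis
  obtain N where N: "\<And>a. a \<in> F \<Longrightarrow> hom 1 (N a) \<and> evp (N a) a \<noteq> 0" using nonvanishing_form Fp by metis
  \<comment> \<open>The \<open>B\<close> lines kill the other points; the factor
    \<open>N a ^ n0\<close>, nonzero at \<open>a\<close>, lifts the degree into the range where the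
    bound holds.\<close>
  define g where "g a = N a ^ n0 * (\<Prod>b\<in>F - {a}. L a b)" for a
  have gS: "g a \<in> Sn (n0 + B)" if "a \<in> F" for a
  proof -
    have "hom (card (F - {a})) (\<Prod>b\<in>F - {a}. L a b)" by (rule hom_prod_linear) (use L that F in auto)
    then have "hom B (\<Prod>b\<in>F - {a}. L a b)" using F that by simp
    moreover have "hom n0 (N a ^ n0)" using hom_power[of 1 "N a" n0] N[OF that] by simp
    ultimately show ?thesis unfolding g_def Sn_def by (simp add: hom_mult)
  qed
  have g1: "evp (g a) a \<noteq> 0" if "a \<in> F" for a
    unfolding g_def ev3_simps ev3_prod using N[OF that] L that F by auto
  have g2: "evp (g a) b = 0" if "a \<in> F" "b \<in> F" "a \<noteq> b" for a b
    unfolding g_def ev3_simps ev3_prod using L[OF that] that F by auto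
  have "card F \<le> VR.qdim (Sn (n0 + B)) (Jac w \<inter> Sn (n0 + B))"
  proof (rule VR.card_le_qdim[OF _ fin_quot_hilb F(1) gS])
    show "VR.subspace (Jac w \<inter> Sn (n0 + B))" by (simp add: VR.subspace_inter subspace_Jac subspace_Sn)
    fix u a assume s: "(\<Sum>a\<in>F. K (u a) * g a) \<in> Jac w \<inter> Sn (n0 + B)" and a: "a \<in> F"
    have "0 = evp (\<Sum>a\<in>F. K (u a) * g a) a" using evp_Jac[of w a] s a F by (auto simp: zeros_def)
    also have "\<dots> = (\<Sum>b\<in>F. if b = a then u a * evp (g a) a else 0)"
      unfolding ev3_sum using g2 a by (intro sum.cong refl) auto
    also have "\<dots> = u a * evp (g a) a" using a F by simp
    finally show "u a = 0" using g1[OF a] by simp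
  qed
  then have "Suc B \<le> hilb w (n0 + B)" using F by (simp add: hilb_def)
  then show False using B[rule_format, of "n0 + B"] by simp
qed

text \<open>A point lies on at most two of the lines \<open>x + t y + t\<^sup>2 z = 0\<close>, so some line avoids any given finite set.\<close>

definition lt :: "complex \<Rightarrow> R" where "lt t = X + K t * Y + K (t\<^sup>2) * Z"

lemma hom_lt: "hom 1 (lt t)"
  unfolding lt_def by (intro hom_add hom_K_mult hom_X hom_Y hom_Z)

lemma avoiding_line:
  assumes "finite F" "F \<subseteq> proj_pts"
  shows "\<exists>t. \<forall>a\<in>F. evp (lt t) a \<noteq> 0"
proof -
  let ?p = "\<lambda>a :: nat \<Rightarrow> complex. [:a 0, a 1, a 2:]"
  have "finite (\<Union>a\<in>F. {t. poly (?p a) t = 0})"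
  proof (intro finite_UN_I assms(1) poly_roots_finite)
    show "?p a \<noteq> 0" if "a \<in> F" for a using proj_pts_nonzero[of a] assms that by auto
  qed
  then obtain t where "t \<notin> (\<Union>a\<in>F. {t. poly (?p a) t = 0})"
    using infinite_UNIV_char_0 ex_new_if_finite by blast
  then have "\<forall>a\<in>F. poly (?p a) t \<noteq> 0" by blast
  then show ?thesis
    by (intro exI[of _ t]) (simp add: lt_def power2_eq_square algebra_simps)
qed

text \<open>\<open>sub t\<close> restricts to the line \<open>lt t\<close> by eliminating \<open>x\<close>.\<close>

definition ct :: "complex \<Rightarrow> complex poly poly" where "ct t = [:[:0, - (t\<^sup>2):], [:- t:]:]"

definition sub :: "complex \<Rightarrow> R \<Rightarrow> complex poly poly" where "sub t q = poly q (ct t)"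

lemma lt_eq: "lt t = [:- ct t, 1:]"
  by (simp add: lt_def ct_def X_def Y_def Z_def K_def)

lemma sub_simps [simp]: "sub t (p + q) = sub t p + sub t q" "sub t (p - q) = sub t p - sub t q"
  "sub t (p * q) = sub t p * sub t q" "sub t [:c:] = c" "sub t Y = [:0, 1:]" "sub t Z = [:[:0, 1:]:]"
  "sub t (p ^ n) = sub t p ^ n" "sub t 1 = 1" "sub t 0 = 0" "sub t (lt t) = 0"
  by (simp_all add: sub_def Y_def Z_def lt_eq)

lemma sub_eq_0: "sub t q = 0 \<Longrightarrow> \<exists>s. q = lt t * s"
  unfolding sub_def poly_eq_0_iff_dvd lt_eq by blast

lemma ev3_sub: "poly (poly (sub t q) [:b:]) c = ev3 q (- t * b - t\<^sup>2 * c) b c"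
proof (induction q rule: R_induct)
  case (1 d) show ?case by (simp add: sub_def K_def ev3_def)
next
  case 2 show ?case by (simp add: sub_def X_def ct_def ev3_def algebra_simps)
qed (simp_all)

text \<open>The pair \<open>(b, c)\<close> parametrizes the line by its last two coordinates; the
  first one is found by solving \<open>lt t = 0\<close>.\<close>

lemma no_common_zero_on_line:
  assumes w: "hom3 e w" and av: "\<forall>a\<in>zeros w. evp (lt t) a \<noteq> 0" and bc: "(b, c) \<noteq> (0, 0)"
  shows "\<exists>q\<in>{fst w, fst (snd w), snd (snd w)}. ev3 q (- t * b - t\<^sup>2 * c) b c \<noteq> 0"
proof (rule ccontr)
  assume no: "\<not> ?thesis"
  let ?a = "- t * b - t\<^sup>2 * c"
  have "(?a, b, c) \<noteq> (0, 0, 0)" using bc by auto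
  from proj_pts_norm[OF this]
  obtain p s where p: "p \<in> proj_pts" "s \<noteq> 0" "?a = s * p 0" "b = s * p 1" "c = s * p 2"
    by (elim bexE exE conjE)
  have h: "hom e (fst w)" "hom e (fst (snd w))" "hom e (snd (snd w))" using w by (cases w; auto)+
  have z: "evp q p = 0" if "hom e q" "ev3 q ?a b c = 0" for q
    using that ev3_scale[OF that(1), of s "p 0" "p 1" "p 2"] p by simp
  have "vanish w p" using no h z unfolding vanish_def by auto
  then have "evp (lt t) p \<noteq> 0" using av p(1) by (auto simp: zeros_def)
  moreover have "ev3 (lt t) ?a b c = 0" by (simp add: lt_def)
  then have "s * evp (lt t) p = 0" using ev3_scale[OF hom_lt, of t s "p 0" "p 1" "p 2"] p by simp
  ultimately show False using p(2) by simp
qed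

section \<open>The Nullstellensatz on a line\<close>

lemma bezout3:
  fixes u1 u2 u3 :: "complex poly"
  assumes "\<And>z. poly u1 z \<noteq> 0 \<or> poly u2 z \<noteq> 0 \<or> poly u3 z \<noteq> 0"
  shows "\<exists>p1 p2 p3. p1 * u1 + p2 * u2 + p3 * u3 = 1"
proof -
  let ?g2 = "gcd u2 u3" and ?g = "gcd u1 (gcd u2 u3)"
  have d: "?g dvd u1" "?g dvd u2" "?g dvd u3" by (auto intro: dvd_trans[OF gcd_dvd2])
  have nr: "poly ?g z \<noteq> 0" for z using assms[of z] d by (metis dvd_trans poly_eq_0_iff_dvd)
  have "degree ?g = 0"
    using fundamental_theorem_of_algebra[of ?g] nr constant_degree by auto
  then obtain k where k: "?g = [:k:]" by (metis degree_eq_zeroE)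
  with nr[of 0] have k0: "k \<noteq> 0" by auto
  obtain x y where xy: "x * u1 + y * ?g2 = ?g" using bezout_coefficients_fst_snd by blast
  obtain x' y' where xy': "x' * u2 + y' * u3 = ?g2" using bezout_coefficients_fst_snd by blast
  have "[:1 / k:] * x * u1 + [:1 / k:] * y * x' * u2 + [:1 / k:] * y * y' * u3 = [:1 / k:] * (x * u1 + y * (x' * u2 + y' * u3))"
    by (simp add: algebra_simps)
  also have "\<dots> = 1" unfolding xy' xy k using k0 by (simp add: one_pCons)
  finally show ?thesis by blast
qed

lemma idl_power_add:
  assumes I: "idl I" and a: "a ^ m \<in> I" and b: "b ^ k \<in> I"
  shows "(a + b) ^ (m + k) \<in> I"
  unfolding binomial_ring
proof (rule idl_sum[OF I])
  fix i assume "i \<in> {..m + k}"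
  show "of_nat (m + k choose i) * a ^ i * b ^ (m + k - i) \<in> I"
  proof (cases "i \<ge> m")
    case True
    then have "a ^ i = a ^ m * a ^ (i - m)" by (simp flip: power_add)
    then have "of_nat (m + k choose i) * a ^ i * b ^ (m + k - i)
      = (of_nat (m + k choose i) * a ^ (i - m) * b ^ (m + k - i)) * a ^ m" by (simp add: mult_ac)
    then show ?thesis using idl_mult[OF I a] by metis
  next
    case False
    then have "m + k - i = k + (m - i)" by simp
    then have "b ^ (m + k - i) = b ^ k * b ^ (m - i)" by (simp only: power_add)
    then have "of_nat (m + k choose i) * a ^ i * b ^ (m + k - i)
      = (of_nat (m + k choose i) * a ^ i * b ^ (m - i)) * b ^ k" by (simp add: mult_ac)
    then show ?thesis using idl_mult[OF I b] by metis
  qed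
qed

lemma idl_power_mono: "idl I \<Longrightarrow> a ^ m \<in> I \<Longrightarrow> m \<le> n \<Longrightarrow> a ^ n \<in> I"
  using idl_mult[of I "a ^ m" "a ^ (n - m)"] by (simp flip: power_add)

text \<open>On the line the entries of \<open>w\<close> are forms in two variables without a common
  zero. For \<open>y = 1\<close> they are univariate, and homogenizing a Bezout identity puts a
  power of \<open>Y\<close> into the ideal. The one point of the line with \<open>y = 0\<close>
  accounts for a power of \<open>Z\<close>, and then a power of \<open>X\<close> follows from the
  equation of the line.\<close>

lemma binary_nullstellensatz:
  assumes w: "hom3 e w" and av: "\<forall>a\<in>zeros w. evp (lt t) a \<noteq> 0"
  shows "\<exists>m. X ^ m \<in> isum (Jac w) (prin (lt t)) \<and> Y ^ m \<in> isum (Jac w) (prin (lt t))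
    \<and> Z ^ m \<in> isum (Jac w) (prin (lt t))"
proof -
  let ?I = "isum (Jac w) (prin (lt t))"
  have hJ: "hidl (Jac w)" by (rule hidl_Jac[OF w])
  have hI: "hidl ?I" by (rule hidl_isum[OF hJ hidl_prin[OF hom_lt]])
  note iI = hidl_idl[OF hI]
  obtain w1 w2 w3 where w123: "w = (w1, w2, w3)" by (metis prod.exhaust)
  have J: "a * w1 + b * w2 + c * w3 \<in> ?I" for a b c
    by (rule isum_left[OF idl_prin]) (auto simp: Jac_def w123 intro: exI[of _ a] exI[of _ b] exI[of _ c])
  have L: "lt t * s \<in> ?I" for s by (rule isum_right[OF hidl_idl[OF hJ]]) (auto simp: prin_def)
  \<comment> \<open>The outer variable of \<open>sub t q\<close> is y; it is set to 1, leaving a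
    polynomial in z.\<close>
  let ?u = "\<lambda>q. poly (sub t q) 1"
  have "poly (?u w1) z \<noteq> 0 \<or> poly (?u w2) z \<noteq> 0 \<or> poly (?u w3) z \<noteq> 0" for z
    using no_common_zero_on_line[OF w av, of 1 z] ev3_sub[of t _ 1 z] by (auto simp: w123 one_pCons)
  then obtain p1 p2 p3 where p: "p1 * ?u w1 + p2 * ?u w2 + p3 * ?u w3 = 1" using bezout3 by blast
  define g where "g = [:[:p1:]:] * w1 + [:[:p2:]:] * w2 + [:[:p3:]:] * w3 - 1"
  have "poly (sub t g) 1 = 0" unfolding g_def using p by (simp del: mult_pCons_left)
  then obtain v where v: "sub t g = [:-1, 1:] * v" by (auto simp: poly_eq_0_iff_dvd elim!: dvdE)
  have "[:-1, 1:] = [:0, 1:] - (1 :: complex poly poly)" by (simp add: one_pCons)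
  then have "sub t (g - (Y - 1) * [:v:]) = 0" using v by (simp only: sub_simps) simp
  then obtain s where s: "g - (Y - 1) * [:v:] = lt t * s" using sub_eq_0 by blast
  have "1 = (([:[:p1:]:] * w1 + [:[:p2:]:] * w2 + [:[:p3:]:] * w3) - lt t * s) + (Y - 1) * (- [:v:])"
    using s unfolding g_def by (simp add: algebra_simps)
  moreover have "([:[:p1:]:] * w1 + [:[:p2:]:] * w2 + [:[:p3:]:] * w3) - lt t * s \<in> ?I"
    by (intro idl_diff[OF iI] J L)
  ultimately have "1 \<in> isum ?I (prin (Y - 1))" unfolding isum_def[of ?I] prin_def[of "Y - 1"] by blast
  then obtain m where m: "Y ^ m \<in> ?I" using homogenize[OF hI hom_Y hom_1] by auto
  \<comment> \<open>The point \<open>(- t^2, 0, 1)\<close> is the one on the line with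
    \<open>y = 0\<close>; some entry of \<open>w\<close> does not vanish there.\<close>
  obtain q where q: "q \<in> {w1, w2, w3}" "ev3 q (- (t\<^sup>2)) 0 1 \<noteq> 0"
    using no_common_zero_on_line[OF w av, of 0 1] by (auto simp: w123)
  have qI: "q \<in> ?I" using q(1) J[of 1 0 0] J[of 0 1 0] J[of 0 0 1] by auto
  have qh: "hom e q" using q(1) w w123 by auto
  define q0 where "q0 = poly (sub t q) 0"
  have "poly (sub t q - [:q0:]) 0 = 0" by (simp add: q0_def)
  then obtain v' where v': "sub t q - [:q0:] = [:0, 1:] * v'"
    unfolding poly_eq_0_iff_dvd dvd_def by auto
  have "sub t (q - [:[:q0:]:] - Y * [:v':]) = 0" using v' by (simp only: sub_simps) simp
  then obtain s' where s': "q - [:[:q0:]:] - Y * [:v':] = lt t * s'" using sub_eq_0 by blast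
  \<comment> \<open>Up to multiples of \<open>lt t\<close> and \<open>Y\<close> the form
    \<open>q\<close> equals \<open>c * Z^e\<close>, where \<open>c\<close> is its value at that
    point. Instead of showing that \<open>q0\<close> is a monomial, its component of degree
    \<open>e\<close> is extracted.\<close>
  define c where "c = coeff q0 e"
  have he: "hcomp e [:[:q0:]:] = K c * Z ^ e"
  proof (rule R_eqI)
    fix i j k
    have "K c * Z ^ e = K c * M 0 0 e" by (simp add: M_def)
    then show "cf (hcomp e [:[:q0:]:]) i j k = cf (K c * Z ^ e) i j k"
      by (auto simp: cf_hcomp cf_M c_def split: if_splits) (auto simp: cf_def coeff_pCons split: nat.splits)
  qed
  have "hidl (isum (prin (lt t)) (prin Y))" by (rule hidl_isum[OF hidl_prin[OF hom_lt] hidl_prin[OF hom_Y]])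
  moreover have "q - [:[:q0:]:] \<in> isum (prin (lt t)) (prin Y)"
  proof -
    have "q - [:[:q0:]:] = lt t * s' + Y * [:v':]" using s' by (simp add: algebra_simps)
    then show ?thesis unfolding isum_def prin_def by blast
  qed
  ultimately have "hcomp e (q - [:[:q0:]:]) \<in> isum (prin (lt t)) (prin Y)" unfolding hidl_def by blast
  then obtain a b where ab: "q - K c * Z ^ e = lt t * a + Y * b"
    unfolding hcomp_diff he hcomp_hom[OF qh] isum_def prin_def by auto
  have "c \<noteq> 0"
  proof
    assume "c = 0"
    then have "ev3 q (- (t\<^sup>2)) 0 1 = ev3 (lt t * a + Y * b) (- (t\<^sup>2)) 0 1" using ab by simp
    also have "\<dots> = 0" by (simp add: lt_def)
    finally show False using q(2) by simp
  qed
  then have Kc: "K (1 / c) * K c = 1" unfolding K_mult[symmetric] by (simp add: K_1)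
  have "Z ^ e = K (1 / c) * K c * Z ^ e" using Kc by simp
  also have "\<dots> = K (1 / c) * (q - lt t * a) + Y * (- (K (1 / c) * b))"
    using ab by (simp add: algebra_simps)
  finally have Ze: "Z ^ e = K (1 / c) * (q - lt t * a) + Y * (- (K (1 / c) * b))" .
  have "K (1 / c) * (q - lt t * a) \<in> ?I" by (intro idl_mult[OF iI] idl_diff[OF iI] qI L)
  moreover have "(Y * (- (K (1 / c) * b))) ^ m \<in> ?I" unfolding power_mult_distrib by (rule idl_mult'[OF iI m])
  ultimately have "(Z ^ e) ^ (1 + m) \<in> ?I" unfolding Ze by (intro idl_power_add[OF iI]) auto
  then have Zm: "Z ^ (e * (1 + m)) \<in> ?I" by (simp only: power_mult)
  define m' where "m' = m + e * (1 + m)"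
  have Y': "Y ^ m' \<in> ?I" and Z': "Z ^ m' \<in> ?I"
    using idl_power_mono[OF iI m, of m'] idl_power_mono[OF iI Zm, of m'] by (auto simp: m'_def)
  \<comment> \<open>\<open>X\<close> is \<open>lt t\<close> minus a combination of \<open>Y\<close>
    and \<open>Z\<close>, all of them nilpotent modulo the ideal.\<close>
  have "(K (- t) * Y) ^ m' \<in> ?I" "(K (- (t\<^sup>2)) * Z) ^ m' \<in> ?I"
    unfolding power_mult_distrib by (intro idl_mult[OF iI] Y' Z')+
  then have P: "(K (- t) * Y + K (- (t\<^sup>2)) * Z) ^ (m' + m') \<in> ?I" by (rule idl_power_add[OF iI])
  have "lt t ^ 1 \<in> ?I" using L[of 1] by simp
  then have "(lt t + (K (- t) * Y + K (- (t\<^sup>2)) * Z)) ^ (1 + (m' + m')) \<in> ?I"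
    by (rule idl_power_add[OF iI _ P])
  moreover have "lt t + (K (- t) * Y + K (- (t\<^sup>2)) * Z) = X" by (simp add: lt_def K_uminus)
  ultimately have "X ^ (1 + (m' + m')) \<in> ?I" by simp
  moreover have "Y ^ (1 + (m' + m')) \<in> ?I" "Z ^ (1 + (m' + m')) \<in> ?I"
    by (rule idl_power_mono[OF iI Y'], simp) (rule idl_power_mono[OF iI Z'], simp)
  ultimately show ?thesis by blast
qed

lemma Sn_subset_idl:
  assumes I: "idl I" and m: "X ^ m \<in> I" "Y ^ m \<in> I" "Z ^ m \<in> I" and n: "n \<ge> 3 * m"
  shows "Sn n \<subseteq> I"
proof
  fix p assume p: "p \<in> Sn n"
  obtain F where F: "p = (\<Sum>(i,j,k)\<in>F. K (cf p i j k) * M i j k)" using M_expand by blast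
  have "K (cf p i j k) * M i j k \<in> I" for i j k
  proof (cases "cf p i j k = 0")
    case True then show ?thesis using idl_0[OF I] by simp
  next
    case False
    then have "i + j + k = n" using p by (auto simp: Sn_def hom_def)
    then have "i \<ge> m \<or> j \<ge> m \<or> k \<ge> m" using n by linarith
    then have "X ^ i \<in> I \<or> Y ^ j \<in> I \<or> Z ^ k \<in> I" using m idl_power_mono[OF I] by blast
    then have "M i j k \<in> I" unfolding M_def using idl_mult[OF I] idl_mult'[OF I] by blast
    then show ?thesis by (rule idl_mult[OF I])
  qed
  then have "(\<Sum>(i,j,k)\<in>F. K (cf p i j k) * M i j k) \<in> I" by (intro idl_sum[OF I]) auto
  then show "p \<in> I" using F by simp
qed

section \<open>A nonzerodivisor modulo the ideal of multipliers\<close>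

lemma dvd_YZ_unit:
  assumes "g dvd [:0, 1:] ^ m" "g dvd [:[:0, 1:]:] ^ m"
  shows "is_unit (g :: complex poly poly)"
proof -
  have c: "coprime [:0, 1:] ([:[:0, 1:]:] :: complex poly poly)"
  proof (rule coprimeI)
    fix d :: "complex poly poly" assume d: "d dvd [:0, 1:]" "d dvd [:[:0, 1:]:]"
    then obtain h h' where h: "[:0, 1:] = d * h" "[:[:0, 1:]:] = d * h'" by (metis dvdE)
    then have "d \<noteq> 0" "h' \<noteq> 0" by auto
    then have "degree d = 0" using h(2) degree_mult_eq[of d h'] by (metis add_is_0 degree_pCons_0)
    then obtain s where s: "d = [:s:]" by (metis degree_eq_zeroE)
    have "1 = coeff (d * h) 1" unfolding h(1)[symmetric] by simp
    also have "\<dots> = s * coeff h 1" by (simp add: s)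
    finally have "is_unit s" by (metis dvdI)
    then show "is_unit d" unfolding s by (simp add: is_unit_const_poly_iff)
  qed
  have "coprime ([:0, 1:] ^ m) ([:[:0, 1:]:] ^ m :: complex poly poly)" using c by simp
  then show ?thesis using assms by (meson coprime_common_divisor)
qed

text \<open>Take a line that misses the finitely many zeros of \<rho>. A common factor of \<rho> on
  this line divides powers of both y and z, so \<rho> stays primitive there. If
  \<open>cross \<rho> \<sigma>\<close> is divisible by \<open>lt t\<close>, then on the line
  \<sigma> is a multiple of \<rho>; hence \<sigma> is a multiple of \<rho> plus \<open>lt t\<close>
  times a triple, and this triple is the witness for \<open>h\<close>.\<close>

lemma quot_ideal_nonzerodivisor:
  assumes rho: "hom3 r \<rho>" "\<rho> \<noteq> 0" "Prim \<rho>" "\<rho> \<in> Syz w"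
  shows "\<exists>t. \<forall>h. lt t * h \<in> quot_ideal w \<rho> \<longrightarrow> h \<in> quot_ideal w \<rho>"
proof -
  obtain B where "\<forall>n\<ge>3 * r. hilb \<rho> n \<le> B" using hilb_bounded[OF rho(1-3)] by blast
  then have "finite (zeros \<rho>)" by (rule finite_zeros[OF rho(1)])
  then obtain t where t: "\<forall>a\<in>zeros \<rho>. evp (lt t) a \<noteq> 0" using avoiding_line[of "zeros \<rho>"] by (auto simp: zeros_def)
  obtain m where m: "Y ^ m \<in> isum (Jac \<rho>) (prin (lt t))" "Z ^ m \<in> isum (Jac \<rho>) (prin (lt t))"
    using binary_nullstellensatz[OF rho(1) t] by blast
  obtain r1 r2 r3 where r123: "\<rho> = (r1, r2, r3)" by (metis prod.exhaust)
  have sb: "\<exists>a b c. sub t p = a * sub t r1 + b * sub t r2 + c * sub t r3" if pI: "p \<in> isum (Jac \<rho>) (prin (lt t))" for p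
  proof -
    obtain a b c s where "p = dot (a, b, c) \<rho> + lt t * s"
      using pI unfolding isum_def Jac_def prin_def by auto
    then have "sub t p = sub t a * sub t r1 + sub t b * sub t r2 + sub t c * sub t r3" by (simp add: r123)
    then show ?thesis by blast
  qed
  have P: "Prim (sub t r1, sub t r2, sub t r3)"
  proof (rule PrimI)
    show "(sub t r1, sub t r2, sub t r3) \<noteq> 0"
    proof
      assume "(sub t r1, sub t r2, sub t r3) = 0"
      then have "sub t (Y ^ m) = 0" using sb[OF m(1)] by (auto simp: zero_triple)
      then show False by simp
    qed
    fix g assume "g dvd sub t r1" "g dvd sub t r2" "g dvd sub t r3"
    then have "g dvd sub t (Y ^ m)" "g dvd sub t (Z ^ m)" using sb[OF m(1)] sb[OF m(2)] by (metis dvd_add dvd_mult)+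
    then show "is_unit g" by (intro dvd_YZ_unit[of g m]) auto
  qed
  have "h \<in> quot_ideal w \<rho>" if lh: "lt t * h \<in> quot_ideal w \<rho>" for h
  proof -
    obtain \<sigma> where s: "\<sigma> \<in> Syz w" "cross \<rho> \<sigma> = smul (lt t * h) w" using lh by (auto simp: quot_ideal_def)
    obtain s1 s2 s3 where s123: "\<sigma> = (s1, s2, s3)" by (metis prod.exhaust)
    obtain w1 w2 w3 where w123: "w = (w1, w2, w3)" by (metis prod.exhaust)
    have e: "r2 * s3 - r3 * s2 = lt t * h * w1" "r3 * s1 - r1 * s3 = lt t * h * w2" "r1 * s2 - r2 * s1 = lt t * h * w3"
      using s(2) by (auto simp: r123 s123 w123)
    have "cross (sub t s1, sub t s2, sub t s3) (sub t r1, sub t r2, sub t r3) = 0"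
      using arg_cong[OF e(1), of "sub t"] arg_cong[OF e(2), of "sub t"] arg_cong[OF e(3), of "sub t"]
      by (simp add: zero_triple mult.commute)
    then obtain c where c: "(sub t s1, sub t s2, sub t s3) = smul c (sub t r1, sub t r2, sub t r3)"
      using P unfolding Prim_def by blast
    have "\<exists>q. s - [:c:] * r = lt t * q" if "sub t s = c * sub t r" for s r
      by (rule sub_eq_0) (simp only: sub_simps that, simp)
    then obtain q1 q2 q3 where q: "s1 = [:c:] * r1 + lt t * q1" "s2 = [:c:] * r2 + lt t * q2" "s3 = [:c:] * r3 + lt t * q3"
      using c by (simp add: diff_eq_eq add.commute) metis
    let ?q = "(q1, q2, q3)"
    have l0: "lt t \<noteq> 0" by (simp add: lt_eq)
    have sq: "\<sigma> = smul [:c:] \<rho> + smul (lt t) ?q" using q by (simp add: s123 r123)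
    have "lt t * dot ?q w = 0" using s(1) rho(4) unfolding sq Syz_def by (simp only: mem_Collect_eq dot_add_left dot_smul_left) simp
    then have "?q \<in> Syz w" using l0 by (simp add: Syz_def)
    moreover have "cross \<rho> \<sigma> = smul (lt t) (cross \<rho> ?q)"
      unfolding sq cross_add_right cross_smul_right by (cases \<rho>) (simp add: algebra_simps)
    then have "smul (lt t) (cross \<rho> ?q - smul h w) = 0" using s(2) by (simp add: smul_diff_right smul_smul)
    then have "cross \<rho> ?q - smul h w = 0" using l0 smul_eq_0_iff by blast
    then have "cross \<rho> ?q = smul h w" by simp
    ultimately show ?thesis by (auto simp: quot_ideal_def)
  qed
  then show ?thesis by blast
qed

section \<open>Dehomogenization\<close>

lemma quot_ideal_mult: "h \<in> quot_ideal w \<rho> \<Longrightarrow> p * h \<in> quot_ideal w \<rho>"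
proof -
  assume "h \<in> quot_ideal w \<rho>"
  then obtain \<sigma> where "\<sigma> \<in> Syz w" "cross \<rho> \<sigma> = smul h w" unfolding quot_ideal_def by blast
  then have "smul p \<sigma> \<in> Syz w" "cross \<rho> (smul p \<sigma>) = smul (p * h) w"
    by (auto simp: Syz_def dot_smul_left cross_smul_right smul_smul)
  then show ?thesis unfolding quot_ideal_def by blast
qed

lemma linear_times: "Vector_Spaces.linear scR scR (\<lambda>p. l * p)"
  by (rule VRR_linearI) (auto simp: algebra_simps)

lemma fin_quot_Sn: "VR.subspace I \<Longrightarrow> VR.fin_quot (Sn n) (I \<inter> Sn n)"
  by (rule VR.fin_quot_mono[OF qdim_Sn(1)]) (simp add: VR.subspace_0 Sn_def)

lemma subspace_Int_Sn: "VR.subspace I \<Longrightarrow> VR.subspace (I \<inter> Sn n)"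
  by (simp add: VR.subspace_inter subspace_Sn)

lemma times_Sn: "hom 1 l \<Longrightarrow> p \<in> Sn n \<Longrightarrow> l * p \<in> Sn (Suc n)"
  unfolding Sn_def using hom_mult[of 1 l n p] by simp

lemma hilbI_mono:
  assumes w: "hom3 e w" and m: "min_syz w r \<rho>" and mn: "m \<le> n"
  shows "hilbI w \<rho> m \<le> hilbI w \<rho> n"
proof -
  have rho: "hom3 r \<rho>" "\<rho> \<noteq> 0" "\<rho> \<in> Syz w" using m by (auto simp: min_syz_def)
  obtain t where t: "\<And>h. lt t * h \<in> quot_ideal w \<rho> \<Longrightarrow> h \<in> quot_ideal w \<rho>"
    using quot_ideal_nonzerodivisor[OF rho(1,2) min_syz_Prim[OF w m] rho(3)] by blast
  have "hilbI w \<rho> i \<le> hilbI w \<rho> (Suc i)" for i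
    unfolding hilbI_def
  proof (rule VRR.qdim_inj_mono[OF linear_times[of "lt t"] subspace_Sn _ subspace_Sn])
    show "VR.subspace (quot_ideal w \<rho> \<inter> Sn i)" "VR.subspace (quot_ideal w \<rho> \<inter> Sn (Suc i))"
      "VR.fin_quot (Sn (Suc i)) (quot_ideal w \<rho> \<inter> Sn (Suc i))"
      by (intro subspace_Int_Sn fin_quot_Sn subspace_quot_ideal)+
    show "(*) (lt t) ` Sn i \<subseteq> Sn (Suc i)" using times_Sn[OF hom_lt] by auto
    show "lt t * v \<in> quot_ideal w \<rho> \<inter> Sn (Suc i) \<longleftrightarrow> v \<in> quot_ideal w \<rho> \<inter> Sn i" if "v \<in> Sn i" for v
      using that t quot_ideal_mult times_Sn[OF hom_lt] by blast
  qed auto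
  then show ?thesis using mn lift_Suc_mono_le[of "hilbI w \<rho>"] by blast
qed

lemma eventually_constant_nat:
  fixes a :: "nat \<Rightarrow> nat"
  assumes "\<And>n. n \<ge> n0 \<Longrightarrow> a (Suc n) \<le> a n"
  shows "\<exists>n1\<ge>n0. \<forall>n\<ge>n1. a n = a n1"
proof -
  define m where "m = (LEAST v. \<exists>n\<ge>n0. a n = v)"
  have "\<exists>n\<ge>n0. a n = m" unfolding m_def by (rule LeastI[of _ "a n0"]) auto
  then obtain n1 where n1: "n1 \<ge> n0" "a n1 = m" by blast
  have low: "m \<le> a n" if "n \<ge> n0" for n unfolding m_def by (rule Least_le) (use that in auto)
  have "a n = a n1" if "n \<ge> n1" for n using that
  proof (induction n rule: dec_induct)
    case (step n)
    then have "a (Suc n) \<le> m" using assms[of n] n1 by simp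
    then show ?case using low[of "Suc n"] step n1 by simp
  qed simp
  then show ?thesis using n1 by blast
qed

lemma prin_power_minus_1: "l ^ k * p - p \<in> prin (l - 1)"
proof -
  have "l ^ k - 1 = (l - 1) * (\<Sum>i<k. l ^ i)" by (rule power_diff_1_eq)
  then have "(l ^ k - 1) * p = (l - 1) * ((\<Sum>i<k. l ^ i) * p)" by (simp only: mult.assoc)
  then have "l ^ k * p - p = (l - 1) * ((\<Sum>i<k. l ^ i) * p)" by (simp add: left_diff_distrib)
  then show ?thesis unfolding prin_def by blast
qed

text \<open>For large \<open>n\<close> multiplication by \<open>l\<close> is an isomorphism on the degree \<open>n\<close> parts of \<open>R / I\<close>,
  so the graded pieces can be identified with \<open>R / (I + (l - 1))\<close>.\<close>

lemma dehomogenize: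
  assumes I: "hidl I" and l: "hom 1 l" and sub: "\<And>n. n \<ge> n0 \<Longrightarrow> Sn n \<subseteq> isum I (prin l)"
  shows "\<exists>n1. \<forall>n\<ge>n1. VR.fin_quot UNIV (isum I (prin (l - 1)))
    \<and> VR.qdim UNIV (isum I (prin (l - 1))) = VR.qdim (Sn n) (I \<inter> Sn n)"
proof -
  let ?B = "isum I (prin (l - 1))"
  note iI = hidl_idl[OF I]
  have sI: "VR.subspace I" by (rule subspace_idl[OF iI])
  have iB: "idl ?B" by (rule idl_isum[OF iI idl_prin])
  have sB: "VR.subspace ?B" by (rule subspace_idl[OF iB])
  have IB: "p \<in> ?B" if "p \<in> I" for p using isum_left[OF idl_prin that] .
  have LB: "p \<in> ?B" if "p \<in> prin (l - 1)" for p using isum_right[OF iI that] .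
  define a where "a n = VR.qdim (Sn n) (I \<inter> Sn n)" for n
  have sur: "\<exists>v\<in>Sn n. v' - l * v \<in> I \<inter> Sn (Suc n)" if n: "n \<ge> n0" and v': "v' \<in> Sn (Suc n)" for n v'
  proof -
    have "v' \<in> isum I (prin l)" using sub[of "Suc n"] n v' by auto
    then obtain k r where kr: "k \<in> I" "v' = k + l * r" unfolding isum_def prin_def by blast
    have "v' = hcomp (Suc n) v'" using v' hcomp_hom by (simp add: Sn_def)
    also have "\<dots> = hcomp (Suc n) k + l * hcomp n r" using hcomp_mult_hom(1)[OF l, of n r] kr by (simp add: hcomp_add)
    finally have "v' - l * hcomp n r = hcomp (Suc n) k" by simp
    moreover have "hcomp (Suc n) k \<in> I \<inter> Sn (Suc n)" using I kr hom_hcomp by (auto simp: hidl_def Sn_def)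
    ultimately show ?thesis using hom_hcomp[of n r] by (intro bexI[of _ "hcomp n r"]) (auto simp: Sn_def)
  qed
  have tS: "(\<lambda>p. l * p) ` Sn n \<subseteq> Sn (Suc n)" for n using times_Sn[OF l] by auto
  have tI: "(\<lambda>p. l * p) ` (I \<inter> Sn n) \<subseteq> I \<inter> Sn (Suc n)" for n using times_Sn[OF l] idl_mult[OF iI] by auto
  have dec: "a (Suc n) \<le> a n" if "n \<ge> n0" for n
    unfolding a_def by (rule VRR.qdim_image(2)[OF linear_times tS tI sur[OF that] fin_quot_Sn[OF sI]])
  obtain n1 where n1: "n1 \<ge> n0" "\<And>n. n \<ge> n1 \<Longrightarrow> a n = a n1" using eventually_constant_nat[of n0 a] dec by blast
  \<comment> \<open>From \<open>n1\<close> on the dimensions no longer drop, so the surjections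
    given by multiplication with \<open>l\<close> have zero kernel \<open>U\<close> modulo
    \<open>I\<close>.\<close>
  have inj: "p \<in> I" if n: "n \<ge> n1" and p: "p \<in> Sn n" "l * p \<in> I" for n p
  proof -
    define U where "U = {p \<in> Sn n. l * p \<in> I}"
    have U: "VR.subspace U"
      using VR.subspace_add[OF sI] VR.subspace_scale[OF sI] VR.subspace_0[OF sI] subspace_Sn[of n]
      by (auto simp: VR.subspace_def U_def distrib_left mult.left_commute[of l "K _"])
    have IU: "I \<inter> Sn n \<subseteq> U" using idl_mult[OF iI] by (auto simp: U_def)
    note q = VR.qdim_add[OF subspace_Int_Sn[OF sI] U subspace_Sn[of n] IU _ fin_quot_Sn[OF sI]]
    have "VR.qdim (Sn n) U = VR.qdim (Sn (Suc n)) (I \<inter> Sn (Suc n))"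
    proof (rule VRR.qdim_iso(2)[OF linear_times[of l] subspace_Sn U subspace_Int_Sn[OF sI] _ tS])
      show "U \<subseteq> Sn n" "VR.fin_quot (Sn n) U" using q(1) by (auto simp: U_def)
      show "l * v \<in> I \<inter> Sn (Suc n) \<longleftrightarrow> v \<in> U" if "v \<in> Sn n" for v
        using that times_Sn[OF l] by (auto simp: U_def)
      show "\<exists>v\<in>Sn n. v' - l * v \<in> I \<inter> Sn (Suc n)" if "v' \<in> Sn (Suc n)" for v'
        by (rule sur[OF _ that]) (use n n1 in simp)
    qed
    then have "a n = a (Suc n) + VR.qdim U (I \<inter> Sn n)" unfolding a_def using q(3) by (auto simp: U_def)
    then have "VR.qdim U (I \<inter> Sn n) = 0" using n1(2)[of n] n1(2)[of "Suc n"] n by simp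
    moreover have "VR.fin_quot U (I \<inter> Sn n)" using q(2) by (auto simp: U_def)
    ultimately have "U \<subseteq> I \<inter> Sn n" using VR.qdim_eq_0_iff[OF _ subspace_Int_Sn[OF sI]] by blast
    then show "p \<in> I" using p by (auto simp: U_def)
  qed
  have inj_pow: "p \<in> I" if "n \<ge> n1" "p \<in> Sn n" "l ^ k * p \<in> I" for n p k
    using that
  proof (induction k arbitrary: p n)
    case (Suc k)
    have "l ^ k * (l * p) \<in> I" using Suc.prems by (simp add: mult_ac)
    then have "l * p \<in> I" using Suc.IH[of "Suc n" "l * p"] Suc.prems times_Sn[OF l] by simp
    then show ?case using inj[of n p] Suc.prems by blast
  qed simp
  show ?thesis
  proof (intro exI[of _ n1] allI impI)
    fix n assume n: "n \<ge> n1"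
    \<comment> \<open>Modulo \<open>l - 1\<close> every component can be moved to degree
      \<open>n\<close>: higher ones by the surjectivity of multiplication with \<open>l\<close>,
      lower ones by multiplying with powers of \<open>l\<close>.\<close>
    have down: "\<exists>v\<in>Sn n. q - v \<in> ?B" if "q \<in> Sn (n + k)" for q k
      using that
    proof (induction k arbitrary: q)
      case 0
      then show ?case using idl_0[OF iB] by (intro bexI[of _ q]) auto
    next
      case (Suc k)
      obtain v where v: "v \<in> Sn (n + k)" "q - l * v \<in> I" using sur[of "n + k" q] Suc.prems n n1 by auto
      obtain v' where v': "v' \<in> Sn n" "v - v' \<in> ?B" using Suc.IH[OF v(1)] by blast
      have "l * v - v \<in> ?B" using LB[OF prin_power_minus_1[of l 1 v]] by simp
      from idl_add[OF iB idl_add[OF iB IB[OF v(2)] this] v'(2)] show ?case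
        using v'(1) by (intro bexI[of _ v']) (simp_all add: algebra_simps)
    qed
    have hs: "\<exists>v\<in>Sn n. hcomp i q - v \<in> ?B" for i q
    proof (cases "i \<le> n")
      case True
      have "hom (n - i + i) (l ^ (n - i) * hcomp i q)" using hom_mult[OF hom_power[OF l] hom_hcomp] by simp
      then have "l ^ (n - i) * hcomp i q \<in> Sn n" using True by (simp add: Sn_def)
      moreover have "hcomp i q - l ^ (n - i) * hcomp i q \<in> ?B"
        using idl_uminus[OF iB LB[OF prin_power_minus_1[of l "n - i" "hcomp i q"]]] by simp
      ultimately show ?thesis by blast
    next
      case False
      then have "hcomp i q \<in> Sn (n + (i - n))" using hom_hcomp by (simp add: Sn_def)
      then show ?thesis by (rule down)
    qed
    have sur': "\<exists>v\<in>Sn n. q - v \<in> ?B" for q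
    proof -
      obtain D where D: "\<forall>i>D. hcomp i q = 0" using hcomp_bound by blast
      have "\<forall>i. \<exists>v. v \<in> Sn n \<and> hcomp i q - v \<in> ?B" using hs by blast
      from choice[OF this] obtain v where v: "\<And>i. v i \<in> Sn n" "\<And>i. hcomp i q - v i \<in> ?B" by blast
      have "q - (\<Sum>i\<le>D. v i) = (\<Sum>i\<le>D. hcomp i q - v i)" using sum_hcomp[OF D] by (simp add: sum_subtractf)
      moreover have "(\<Sum>i\<le>D. hcomp i q - v i) \<in> ?B" by (rule idl_sum[OF iB v(2)])
      moreover have "(\<Sum>i\<le>D. v i) \<in> Sn n" by (rule VR.subspace_sum[OF subspace_Sn v(1)])
      ultimately show ?thesis by metis
    qed
    have i: "p \<in> ?B \<longleftrightarrow> p \<in> I \<inter> Sn n" if p: "p \<in> Sn n" for p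
    proof
      assume "p \<in> ?B"
      then obtain m where "l ^ m * p \<in> I" using homogenize[OF I l, of n p] p by (auto simp: Sn_def)
      then show "p \<in> I \<inter> Sn n" using inj_pow[OF n p] p by blast
    qed (use IB in auto)
    note iso = VRR.qdim_iso[OF VR.linear_id' subspace_Sn subspace_Int_Sn[OF sI] sB _ _ i sur', of UNIV]
    show "VR.fin_quot UNIV ?B \<and> VR.qdim UNIV ?B = VR.qdim (Sn n) (I \<inter> Sn n)"
      using iso fin_quot_Sn[OF sI, of n] by auto
  qed
qed

text \<open>Same shape as \<open>gen_ideal\<close>, so that the two correspond term by term under
  \<open>\<Phi>\<close>.\<close>

definition genR :: "R set \<Rightarrow> R set" where
  "genR G = {h. \<exists>F c. finite F \<and> F \<subseteq> G \<and> h = (\<Sum>g\<in>F. c g * g)}"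

lemma genR_base: "g \<in> G \<Longrightarrow> g \<in> genR G"
  unfolding genR_def by (intro CollectI exI[of _ "{g}"] exI[of _ "\<lambda>_. 1"]) auto

lemma idl_genR: "idl (genR G)"
  unfolding idl_def
proof (intro conjI ballI allI)
  show "0 \<in> genR G" unfolding genR_def by (intro CollectI exI[of _ "{}"]) auto
  show "a + b \<in> genR G" if a: "a \<in> genR G" and b: "b \<in> genR G" for a b
  proof -
    obtain F c where F: "finite F" "F \<subseteq> G" "a = (\<Sum>g\<in>F. c g * g)" using a unfolding genR_def by blast
    obtain F' c' where F': "finite F'" "F' \<subseteq> G" "b = (\<Sum>g\<in>F'. c' g * g)" using b unfolding genR_def by blast
    let ?c = "\<lambda>g. (if g \<in> F then c g else 0) + (if g \<in> F' then c' g else 0)"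
    have "a = (\<Sum>g\<in>F \<union> F'. (if g \<in> F then c g else 0) * g)"
      unfolding F(3) by (rule sum.mono_neutral_cong_left) (use F F' in auto)
    moreover have "b = (\<Sum>g\<in>F \<union> F'. (if g \<in> F' then c' g else 0) * g)"
      unfolding F'(3) by (rule sum.mono_neutral_cong_left) (use F F' in auto)
    ultimately have "a + b = (\<Sum>g\<in>F \<union> F'. ?c g * g)" by (simp add: distrib_right sum.distrib)
    then show ?thesis unfolding genR_def using F F' by (intro CollectI exI[of _ "F \<union> F'"] exI[of _ ?c]) auto
  qed
  show "r * a \<in> genR G" if a: "a \<in> genR G" for r a
  proof -
    obtain F c where F: "finite F" "F \<subseteq> G" "a = (\<Sum>g\<in>F. c g * g)" using a unfolding genR_def by blast
    then have "r * a = (\<Sum>g\<in>F. (r * c g) * g)" by (simp add: sum_distrib_left mult_ac)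
    then show ?thesis unfolding genR_def using F by (intro CollectI exI[of _ F] exI[of _ "\<lambda>g. r * c g"]) auto
  qed
qed

lemma genR_least: "idl I \<Longrightarrow> G \<subseteq> I \<Longrightarrow> genR G \<subseteq> I"
  unfolding genR_def by (auto intro!: idl_sum idl_mult)

lemma hidl_genR:
  assumes "\<And>g. g \<in> G \<Longrightarrow> \<exists>n. hom n g"
  shows "hidl (genR G)"
  unfolding hidl_def
proof (intro conjI idl_genR ballI allI)
  fix p n assume "p \<in> genR G"
  then obtain F c where F: "finite F" "F \<subseteq> G" "p = (\<Sum>g\<in>F. c g * g)" unfolding genR_def by blast
  have "hcomp n (c g * g) \<in> genR G" if "g \<in> F" for g
  proof -
    have g: "g \<in> G" using that F by blast
    obtain m where m: "hom m g" using assms[OF g] by blast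
    have "g * r \<in> genR G" for r by (rule idl_mult'[OF idl_genR genR_base[OF g]])
    moreover have "0 \<in> genR G" by (rule idl_0[OF idl_genR])
    ultimately show ?thesis
      using hcomp_mult_hom[OF m, of "n - m" "c g"] hcomp_mult_hom(2)[OF m, of n "c g"]
      by (cases "m \<le> n") (auto simp: mult.commute[of "c g"])
  qed
  then show "hcomp n p \<in> genR G" unfolding F(3) hcomp_sum by (rule idl_sum[OF idl_genR])
qed

section \<open>Powers of maximal ideals\<close>

text \<open>The \<open>N\<close>-th power of the ideal generated by \<open>g1\<close>, \<open>g2\<close>, \<open>g3\<close>.\<close>

definition Mp :: "R \<Rightarrow> R \<Rightarrow> R \<Rightarrow> nat \<Rightarrow> R set" where
  "Mp g1 g2 g3 N = genR {g1 ^ i * g2 ^ j * g3 ^ k | i j k. i + j + k = N}"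

lemma idl_Mp: "idl (Mp g1 g2 g3 N)"
  unfolding Mp_def by (rule idl_genR)

lemma Mp_base: "i + j + k = N \<Longrightarrow> g1 ^ i * g2 ^ j * g3 ^ k \<in> Mp g1 g2 g3 N"
  unfolding Mp_def by (rule genR_base) blast

lemma Mp_least: "idl I \<Longrightarrow> (\<And>i j k. i + j + k = N \<Longrightarrow> g1 ^ i * g2 ^ j * g3 ^ k \<in> I) \<Longrightarrow> Mp g1 g2 g3 N \<subseteq> I"
  unfolding Mp_def by (rule genR_least) auto

lemma idl_colon: "idl I \<Longrightarrow> idl {x. x * y \<in> I}"
  by (auto simp: idl_def algebra_simps)

text \<open>Bilinearity by colon ideals: with one factor fixed, the admissible other factors form an
  ideal, so it is enough to treat generators, once for each factor.\<close>

lemma Mp_mult: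
  assumes "x \<in> Mp g1 g2 g3 m" "y \<in> Mp g1 g2 g3 n"
  shows "x * y \<in> Mp g1 g2 g3 (m + n)"
proof -
  let ?I = "Mp g1 g2 g3 (m + n)"
  have 1: "Mp g1 g2 g3 m \<subseteq> {x. x * (g1 ^ i * g2 ^ j * g3 ^ k) \<in> ?I}" if "i + j + k = n" for i j k
  proof (rule Mp_least[OF idl_colon[OF idl_Mp]])
    fix i' j' k' assume "i' + j' + k' = m"
    then have "g1 ^ (i' + i) * g2 ^ (j' + j) * g3 ^ (k' + k) \<in> ?I" using that by (intro Mp_base) simp
    moreover have "g1 ^ (i' + i) * g2 ^ (j' + j) * g3 ^ (k' + k) = g1 ^ i' * g2 ^ j' * g3 ^ k' * (g1 ^ i * g2 ^ j * g3 ^ k)"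
      by (simp add: power_add mult_ac)
    ultimately show "g1 ^ i' * g2 ^ j' * g3 ^ k' \<in> {x. x * (g1 ^ i * g2 ^ j * g3 ^ k) \<in> ?I}" by simp
  qed
  have "Mp g1 g2 g3 n \<subseteq> {y. y * x \<in> ?I}"
    by (rule Mp_least[OF idl_colon[OF idl_Mp]]) (use 1 assms in \<open>auto simp: mult.commute[of _ x]\<close>)
  then show ?thesis using assms by (auto simp: mult.commute)
qed

lemma isum_Mp_mult:
  assumes A: "idl A" and x: "x \<in> isum (Mp g1 g2 g3 m) A" and y: "y \<in> isum (Mp g1 g2 g3 n) A"
  shows "x * y \<in> isum (Mp g1 g2 g3 (m + n)) A"
proof -
  obtain a b where ab: "a \<in> Mp g1 g2 g3 m" "b \<in> A" "x = a + b" using x by (rule isumE)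
  obtain c d where cd: "c \<in> Mp g1 g2 g3 n" "d \<in> A" "y = c + d" using y by (rule isumE)
  have "x * y = a * c + (a * d + b * (c + d))" using ab cd by (simp add: algebra_simps)
  moreover have "a * c \<in> Mp g1 g2 g3 (m + n)" by (rule Mp_mult[OF ab(1) cd(1)])
  moreover have "a * d + b * (c + d) \<in> A" using ab cd by (intro idl_add[OF A] idl_mult[OF A] idl_mult'[OF A])
  ultimately show ?thesis unfolding isum_def by blast
qed

lemma Mp_0: "Mp g1 g2 g3 0 = UNIV"
proof -
  have "1 \<in> Mp g1 g2 g3 0" using Mp_base[of 0 0 0 0 g1 g2 g3] by simp
  then have "r \<in> Mp g1 g2 g3 0" for r using idl_mult[OF idl_Mp, of 1 g1 g2 g3 0 r] by simp
  then show ?thesis by blast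
qed

lemma isum_Mp_power:
  assumes A: "idl A" and x: "x \<in> isum (Mp g1 g2 g3 1) A"
  shows "x ^ n \<in> isum (Mp g1 g2 g3 n) A"
proof (induction n)
  case 0
  show ?case by (rule isum_left[OF A]) (simp add: Mp_0)
next
  case (Suc n)
  then show ?case using isum_Mp_mult[OF A x Suc] by simp
qed

text \<open>Change of generators for powers of an ideal, modulo \<open>A\<close>; inclusions in
  degree 1 carry over to every power.\<close>

lemma Mp_subset_isum:
  assumes A: "idl A" and h: "h1 \<in> isum (Mp g1 g2 g3 1) A" "h2 \<in> isum (Mp g1 g2 g3 1) A" "h3 \<in> isum (Mp g1 g2 g3 1) A"
  shows "Mp h1 h2 h3 N \<subseteq> isum (Mp g1 g2 g3 N) A"
proof (rule Mp_least[OF idl_isum[OF idl_Mp A]])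
  fix i j k assume "i + j + k = N"
  then show "h1 ^ i * h2 ^ j * h3 ^ k \<in> isum (Mp g1 g2 g3 N) A"
    using isum_Mp_mult[OF A isum_Mp_mult[OF A isum_Mp_power[OF A h(1), of i] isum_Mp_power[OF A h(2), of j]]
        isum_Mp_power[OF A h(3), of k]] by simp
qed

lemma Mp_1_gens: "g1 \<in> Mp g1 g2 g3 1" "g2 \<in> Mp g1 g2 g3 1" "g3 \<in> Mp g1 g2 g3 1"
  using Mp_base[of 1 0 0 1 g1 g2 g3] Mp_base[of 0 1 0 1 g1 g2 g3] Mp_base[of 0 0 1 1 g1 g2 g3] by auto

lemma Mp_antimono: "Mp g1 g2 g3 (Suc N) \<subseteq> Mp g1 g2 g3 N"
proof (rule Mp_least[OF idl_Mp])
  fix i j k assume s: "i + j + k = Suc N"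
  note m = idl_mult[OF idl_Mp]
  consider i' where "i = Suc i'" | j' where "j = Suc j'" | k' where "k = Suc k'"
    using s by (metis add_eq_self_zero old.nat.exhaust nat.distinct(1) add_0)
  then show "g1 ^ i * g2 ^ j * g3 ^ k \<in> Mp g1 g2 g3 N"
  proof cases
    case 1
    then show ?thesis using m[OF Mp_base[of i' j k N g1 g2 g3], of g1] s by (simp add: mult_ac)
  next
    case 2
    then show ?thesis using m[OF Mp_base[of i j' k N g1 g2 g3], of g2] s by (simp add: mult_ac)
  next
    case 3
    then show ?thesis using m[OF Mp_base[of i j k' N g1 g2 g3], of g3] s by (simp add: mult_ac)
  qed
qed

definition mpt :: "complex \<Rightarrow> complex \<Rightarrow> complex \<Rightarrow> nat \<Rightarrow> R set" where
  "mpt a b c N = Mp (X - K a) (Y - K b) (Z - K c) N"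

lemma idl_mpt: "idl (mpt a b c N)"
  unfolding mpt_def by (rule idl_Mp)

lemma taylor: "\<exists>r1 r2 r3. q = K (ev3 q a b c) + (X - K a) * r1 + (Y - K b) * r2 + (Z - K c) * r3"
proof (induction q rule: R_induct)
  case (1 d) show ?case by (intro exI[of _ 0]) simp
next
  case 2 show ?case by (rule exI[of _ 1], intro exI[of _ 0]) simp
next
  case 3 show ?case by (rule exI[of _ 0], rule exI[of _ 1], intro exI[of _ 0]) simp
next
  case 4 show ?case by (rule exI[of _ 0], rule exI[of _ 0], intro exI[of _ 1]) simp
next
  case (5 p q)
  then obtain r1 r2 r3 s1 s2 s3 where
    p: "p = K (ev3 p a b c) + (X - K a) * r1 + (Y - K b) * r2 + (Z - K c) * r3" and
    q: "q = K (ev3 q a b c) + (X - K a) * s1 + (Y - K b) * s2 + (Z - K c) * s3" by blast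
  show ?case
  proof (intro exI)
    show "p + q = K (ev3 (p + q) a b c) + (X - K a) * (r1 + s1) + (Y - K b) * (r2 + s2) + (Z - K c) * (r3 + s3)"
      by (subst p, subst q) (simp add: K_add algebra_simps)
  qed
next
  case (6 p q)
  then obtain r1 r2 r3 s1 s2 s3 where
    p: "p = K (ev3 p a b c) + (X - K a) * r1 + (Y - K b) * r2 + (Z - K c) * r3" and
    q: "q = K (ev3 q a b c) + (X - K a) * s1 + (Y - K b) * s2 + (Z - K c) * s3" by blast
  let ?P = "K (ev3 p a b c)"
  have "p * q = ?P * q + (X - K a) * (r1 * q) + (Y - K b) * (r2 * q) + (Z - K c) * (r3 * q)"
    by (subst p) (simp add: distrib_right mult.assoc)
  also have "?P * q = K (ev3 (p * q) a b c) + (X - K a) * (?P * s1) + (Y - K b) * (?P * s2) + (Z - K c) * (?P * s3)"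
    by (subst q) (simp add: K_mult distrib_left mult_ac)
  finally have "p * q = K (ev3 (p * q) a b c) + (X - K a) * (?P * s1 + r1 * q) + (Y - K b) * (?P * s2 + r2 * q)
    + (Z - K c) * (?P * s3 + r3 * q)" by (simp add: distrib_left add_ac)
  then show ?case by blast
qed

section \<open>Finite-dimensional quotients and their points\<close>

definition lprod :: "R \<Rightarrow> complex list \<Rightarrow> R" where
  "lprod x L = (\<Prod>c\<leftarrow>L. x - K c)"

lemma lprod_simps [simp]: "lprod x [] = 1" "lprod x (c # L) = (x - K c) * lprod x L"
  by (simp_all add: lprod_def)

definition up :: "R \<Rightarrow> complex poly \<Rightarrow> R" where
  "up x s = poly (map_poly K s) x"

lemma up_pCons: "up x (pCons a s) = K a + x * up x s"
  by (simp add: up_def map_poly_pCons)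

lemma up_0 [simp]: "up x 0 = 0"
  by (simp add: up_def)

lemma up_add: "up x (s + t) = up x s + up x t"
  by (induction s t rule: poly_induct2) (auto simp: up_pCons K_add algebra_simps)

lemma up_smult: "up x (Polynomial.smult c s) = K c * up x s"
  by (induction s) (auto simp: up_pCons K_mult algebra_simps)

lemma up_linear_mult: "up x ([:- c, 1:] * s) = (x - K c) * up x s"
proof -
  have "[:- c, 1:] * s = Polynomial.smult (- c) s + pCons 0 s" by simp
  then show ?thesis by (simp only: up_add up_smult up_pCons K_uminus K_0) (simp add: algebra_simps)
qed

lemma up_sum: "up x (\<Sum>i\<le>n. monom (a i) i) = (\<Sum>i\<le>n. K (a i) * x ^ i)"
proof -
  have "up x (monom d i) = K d * x ^ i" for d i
    by (simp add: up_def map_poly_monom poly_monom)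
  then show ?thesis by (induction n) (auto simp: up_add)
qed

text \<open>In a finite-dimensional quotient the powers of \<open>x\<close> are dependent, so some
  nonzero univariate polynomial in \<open>x\<close> lies in \<open>B\<close>; over the complex
  numbers it splits into linear factors.\<close>

lemma exists_lprod:
  assumes B: "idl B" and fin: "VR.fin_quot UNIV B"
  shows "\<exists>L. lprod x L \<in> B"
proof -
  obtain n a where na: "\<exists>i\<le>n. a i \<noteq> 0" "(\<Sum>i\<le>n. K (a i) * x ^ i) \<in> B"
    using VR.exists_dependent_combination[OF subspace_idl[OF B] fin, of "\<lambda>i. x ^ i"] by blast
  let ?s = "\<Sum>i\<le>n. monom (a i) i"
  have s0: "?s \<noteq> 0"
  proof
    assume "?s = 0"
    then have "coeff ?s i = 0" for i by simp
    then have "(\<Sum>j\<le>n. if j = i then a j else 0) = 0" for i by (simp add: coeff_sum coeff_monom)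
    then have "(if i \<le> n then a i else 0) = 0" for i by simp
    then show False using na(1) by metis
  qed
  \<comment> \<open>The multiplier \<open>g\<close> collects the linear factors already split off;
    the remaining constant is inverted at the end.\<close>
  have "\<exists>L. lprod x L * g \<in> B" if "s \<noteq> 0" "up x s * g \<in> B" "degree s = d" for d s g
    using that
  proof (induction d arbitrary: s g)
    case 0
    then obtain k where k: "s = [:k:]" by (metis degree_eq_zeroE)
    then have "K k * g \<in> B" using 0 by (simp add: up_pCons)
    then have "K (1 / k) * (K k * g) \<in> B" by (rule idl_mult[OF B])
    moreover have "K (1 / k) * (K k * g) = g"
      using 0 k unfolding mult.assoc[symmetric] K_mult[symmetric] by (simp add: K_1)
    ultimately show ?case by (intro exI[of _ "[]"]) (simp only: lprod_simps mult_1)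
  next
    case (Suc d)
    then obtain c where "poly s c = 0"
      using fundamental_theorem_of_algebra[of s] constant_degree[of s] by auto
    then obtain q where q: "s = [:- c, 1:] * q" by (auto simp: poly_eq_0_iff_dvd elim: dvdE)
    have q0: "q \<noteq> 0" using q Suc.prems by auto
    then have "degree q = d" using q Suc.prems(3) degree_mult_eq[of "[:- c, 1:]" q] by simp
    moreover have "up x q * ((x - K c) * g) \<in> B" using Suc.prems(2) unfolding q up_linear_mult by (simp add: mult_ac)
    ultimately obtain L where "lprod x L * ((x - K c) * g) \<in> B" using Suc.IH[OF q0] by blast
    then show ?case by (intro exI[of _ "c # L"]) (simp add: mult_ac)
  qed
  from this[OF s0, of 1] na(2) show ?thesis by (simp add: up_sum)
qed

text \<open>Multiplying \<open>g\<close> by the linear factors one at a time, there is a factor at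
  which it passes from outside \<open>B\<close> into \<open>B\<close>. The element just before is an
  eigenvector of \<open>x\<close> modulo \<open>B\<close>.\<close>

lemma partial_product:
  assumes g: "g \<notin> B" and L: "lprod x L * g \<in> B"
  shows "\<exists>s c. s * g \<notin> B \<and> (x - K c) * (s * g) \<in> B"
  using L
proof (induction L)
  case Nil
  then show ?case using g by simp
next
  case (Cons c L)
  show ?case
  proof (cases "lprod x L * g \<in> B")
    case True
    then show ?thesis by (rule Cons.IH)
  next
    case False
    then show ?thesis using Cons.prems by (intro exI[of _ "lprod x L"] exI[of _ c]) (simp add: mult_ac)
  qed
qed

lemma lprod_split:
  "lprod x L = (x - K c) ^ length (filter (\<lambda>d. d = c) L) * lprod x (filter (\<lambda>d. d \<noteq> c) L)"
  by (induction L) (auto simp: mult_ac)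

lemma ev3_lprod_filter: "ev3 x a b c = d \<Longrightarrow> ev3 (lprod x (filter (\<lambda>d'. d' \<noteq> d) L)) a b c \<noteq> 0"
  by (induction L) auto

text \<open>If \<open>g \<notin> B\<close>, some multiple \<open>g3\<close> of \<open>g\<close> outside \<open>B\<close> is annihilated modulo \<open>B\<close> by the maximal
  ideal of a point \<open>p\<close>, which then lies in the zero set of \<open>B\<close>. Some \<open>s\<close> with \<open>s(p) \<noteq> 0\<close> multiplies a
  power of that maximal ideal into \<open>B\<close>, hence \<open>s * g3 \<in> B\<close>, a contradiction.\<close>

lemma local_membership:
  assumes B: "idl B" and L: "lprod X L1 \<in> B" "lprod Y L2 \<in> B" "lprod Z L3 \<in> B"
    and N: "N \<ge> length L1 + length L2 + length L3"
    and loc: "\<And>a b c. (\<And>q. q \<in> B \<Longrightarrow> ev3 q a b c = 0) \<Longrightarrow> g \<in> isum B (mpt a b c N)"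
  shows "g \<in> B"
proof (rule ccontr)
  assume g: "g \<notin> B"
  obtain s1 a where 1: "s1 * g \<notin> B" "(X - K a) * (s1 * g) \<in> B"
    using partial_product[OF g] idl_mult'[OF B L(1)] by blast
  obtain s2 b where 2: "s2 * (s1 * g) \<notin> B" "(Y - K b) * (s2 * (s1 * g)) \<in> B"
    using partial_product[OF 1(1)] idl_mult'[OF B L(2)] by blast
  obtain s3 c where 3: "s3 * (s2 * (s1 * g)) \<notin> B" "(Z - K c) * (s3 * (s2 * (s1 * g))) \<in> B"
    using partial_product[OF 2(1)] idl_mult'[OF B L(3)] by blast
  let ?g3 = "s3 * (s2 * (s1 * g))"
  have x3: "(X - K a) * ?g3 \<in> B" using idl_mult[OF B 1(2), of "s3 * s2"] by (simp add: mult_ac)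
  have y3: "(Y - K b) * ?g3 \<in> B" using idl_mult[OF B 2(2), of s3] by (simp add: mult_ac)
  \<comment> \<open>Modulo \<open>B\<close> the coordinates act on \<open>?g3\<close> by the scalars
    \<open>a\<close>, \<open>b\<close>, \<open>c\<close>, so \<open>q\<close> acts by its value at
    that point.\<close>
  have red: "K (ev3 q a b c) * ?g3 \<in> B" if "q * ?g3 \<in> B" for q
  proof -
    obtain r1 r2 r3 where r: "q = K (ev3 q a b c) + (X - K a) * r1 + (Y - K b) * r2 + (Z - K c) * r3"
      using taylor by blast
    have "K (ev3 q a b c) * ?g3 = q * ?g3 - ((X - K a) * ?g3 * r1 + (Y - K b) * ?g3 * r2 + (Z - K c) * ?g3 * r3)"
      by (subst (2) r) (simp add: algebra_simps)
    moreover have "q * ?g3 - ((X - K a) * ?g3 * r1 + (Y - K b) * ?g3 * r2 + (Z - K c) * ?g3 * r3) \<in> B"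
      by (intro idl_diff[OF B that] idl_add[OF B] idl_mult'[OF B] x3 y3 3(2))
    ultimately show ?thesis by simp
  qed
  have red': "ev3 q a b c = 0" if "q * ?g3 \<in> B" for q
  proof (rule ccontr)
    assume ne: "ev3 q a b c \<noteq> 0"
    have "K (1 / ev3 q a b c) * (K (ev3 q a b c) * ?g3) \<in> B" by (rule idl_mult[OF B red[OF that]])
    moreover have "K (1 / ev3 q a b c) * (K (ev3 q a b c) * ?g3) = ?g3"
      using ne unfolding mult.assoc[symmetric] K_mult[symmetric] by (simp add: K_1)
    ultimately show False using 3(1) by (simp only:)
  qed
  have "g \<in> isum B (mpt a b c N)" by (rule loc) (use red' idl_mult'[OF B] in blast)
  then obtain u v where uv: "u \<in> B" "v \<in> mpt a b c N" "g = u + v" by (rule isumE)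
  \<comment> \<open>The factors that do not vanish at the point. The remaining ones are powers of
    exponents \<open>k1\<close>, \<open>k2\<close>, \<open>k3\<close> with sum at most
    \<open>N\<close>, so each monomial of degree \<open>N\<close> in the generators is divisible by
    one of these powers.\<close>
  let ?e1 = "lprod X (filter (\<lambda>d. d \<noteq> a) L1)" and ?e2 = "lprod Y (filter (\<lambda>d. d \<noteq> b) L2)"
    and ?e3 = "lprod Z (filter (\<lambda>d. d \<noteq> c) L3)"
  define k1 where "k1 = length (filter (\<lambda>d. d = a) L1)"
  define k2 where "k2 = length (filter (\<lambda>d. d = b) L2)"
  define k3 where "k3 = length (filter (\<lambda>d. d = c) L3)"
  have k: "k1 \<le> length L1" "k2 \<le> length L2" "k3 \<le> length L3" by (auto simp: k1_def k2_def k3_def)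
  define s where "s = ?e1 * ?e2 * ?e3"
  have e: "(X - K a) ^ k1 * ?e1 \<in> B" "(Y - K b) ^ k2 * ?e2 \<in> B" "(Z - K c) ^ k3 * ?e3 \<in> B"
    using L lprod_split[of X L1 a] lprod_split[of Y L2 b] lprod_split[of Z L3 c] by (simp_all add: k1_def k2_def k3_def)
  have s0: "ev3 s a b c \<noteq> 0" unfolding s_def by (simp add: ev3_lprod_filter)
  have "mpt a b c N \<subseteq> {v. v * s \<in> B}"
    unfolding mpt_def
  proof (rule Mp_least[OF idl_colon[OF B]])
    fix i j l assume ijl: "i + j + l = N"
    let ?m = "(X - K a) ^ i * (Y - K b) ^ j * (Z - K c) ^ l"
    have "i \<ge> k1 \<or> j \<ge> k2 \<or> l \<ge> k3" using ijl k N by linarith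
    then have "?m * s \<in> B"
    proof (elim disjE)
      assume "i \<ge> k1"
      then have "(X - K a) ^ i = (X - K a) ^ k1 * (X - K a) ^ (i - k1)" by (simp flip: power_add)
      then have "?m * s = ((X - K a) ^ k1 * ?e1) * ((X - K a) ^ (i - k1) * (Y - K b) ^ j * (Z - K c) ^ l * ?e2 * ?e3)"
        by (simp add: s_def mult_ac)
      then show ?thesis using idl_mult'[OF B e(1)] by (simp only:)
    next
      assume "j \<ge> k2"
      then have "(Y - K b) ^ j = (Y - K b) ^ k2 * (Y - K b) ^ (j - k2)" by (simp flip: power_add)
      then have "?m * s = ((Y - K b) ^ k2 * ?e2) * ((X - K a) ^ i * (Y - K b) ^ (j - k2) * (Z - K c) ^ l * ?e1 * ?e3)"
        by (simp add: s_def mult_ac)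
      then show ?thesis using idl_mult'[OF B e(2)] by (simp only:)
    next
      assume "l \<ge> k3"
      then have "(Z - K c) ^ l = (Z - K c) ^ k3 * (Z - K c) ^ (l - k3)" by (simp flip: power_add)
      then have "?m * s = ((Z - K c) ^ k3 * ?e3) * ((X - K a) ^ i * (Y - K b) ^ j * (Z - K c) ^ (l - k3) * ?e1 * ?e2)"
        by (simp add: s_def mult_ac)
      then show ?thesis using idl_mult'[OF B e(3)] by (simp only:)
    qed
    then show "?m \<in> {v. v * s \<in> B}" by simp
  qed
  then have "v * s \<in> B" using uv by blast
  then have "g * s \<in> B" unfolding uv(3) distrib_right by (intro idl_add[OF B] idl_mult'[OF B uv(1)])
  then have "s * ?g3 \<in> B" using idl_mult[OF B, of "g * s" "s3 * s2 * s1"] by (simp add: mult_ac)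
  then show False using red' s0 by blast
qed

section \<open>Comaximal ideals\<close>

lemma isum_comm: "isum A B = isum B A"
  unfolding isum_def by (auto; rule exI, rule exI, rule conjI, rule add.commute, simp)

text \<open>A differing coordinate writes 1 as a sum of elements of the two maximal ideals. Since
  powers of 1 are 1, \<open>isum_Mp_power\<close> raises the exponent of one summand, then of the
  other.\<close>

lemma comax_mpt:
  assumes "(a, b, c) \<noteq> (a', b', c')"
  shows "1 \<in> isum (mpt a b c N) (mpt a' b' c' N)"
proof -
  have lin: "1 \<in> isum I J" if I: "idl I" and J: "idl J" and ne: "u \<noteq> u'" and x: "x - K u \<in> I" "x - K u' \<in> J" for I J u u' x
  proof -
    have "K (1 / (u' - u)) * (K u' - K u) = 1" unfolding K_diff[symmetric] K_mult[symmetric] using ne by (simp add: K_1)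
    then have "1 = K (1 / (u' - u)) * (x - K u) + (- K (1 / (u' - u))) * (x - K u')" by (simp add: algebra_simps)
    moreover have "K (1 / (u' - u)) * (x - K u) \<in> I" "(- K (1 / (u' - u))) * (x - K u') \<in> J"
      by (rule idl_mult[OF I x(1)], rule idl_mult[OF J x(2)])
    ultimately show ?thesis unfolding isum_def by blast
  qed
  have "1 \<in> isum (mpt a b c 1) (mpt a' b' c' 1)"
  proof -
    consider "a \<noteq> a'" | "b \<noteq> b'" | "c \<noteq> c'" using assms by auto
    then show ?thesis
    proof cases
      case 1
      show ?thesis unfolding mpt_def by (rule lin[OF idl_Mp idl_Mp 1]) (rule Mp_1_gens)+
    next
      case 2
      show ?thesis unfolding mpt_def by (rule lin[OF idl_Mp idl_Mp 2]) (rule Mp_1_gens)+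
    next
      case 3
      show ?thesis unfolding mpt_def by (rule lin[OF idl_Mp idl_Mp 3]) (rule Mp_1_gens)+
    qed
  qed
  then have "1 \<in> isum (mpt a b c N) (mpt a' b' c' 1)"
    using isum_Mp_power[OF idl_mpt, of 1 _ _ _ a' b' c' 1 N] by (simp add: mpt_def)
  then have "1 \<in> isum (mpt a' b' c' 1) (mpt a b c N)" by (simp add: isum_comm)
  then have "1 \<in> isum (mpt a' b' c' N) (mpt a b c N)"
    using isum_Mp_power[OF idl_mpt, of 1 _ _ _ a b c N N] by (simp add: mpt_def)
  then show ?thesis by (simp add: isum_comm)
qed

lemma isum_mono: "A \<subseteq> A' \<Longrightarrow> B \<subseteq> B' \<Longrightarrow> isum A B \<subseteq> isum A' B'"
  unfolding isum_def by blast

lemma idl_Inter: "(\<And>i. i \<in> F \<Longrightarrow> idl (I i)) \<Longrightarrow> idl (\<Inter>i\<in>F. I i)"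
  by (auto simp: idl_def)

text \<open>In the product of two decompositions of 1 every term except \<open>y' * y\<close> lies
  in \<open>A\<close>, and that one lies in all ideals of the intersection.\<close>

lemma comax_Inter:
  assumes F: "finite F" and A: "idl A" and I: "\<And>i. i \<in> F \<Longrightarrow> idl (I i)" and c: "\<And>i. i \<in> F \<Longrightarrow> 1 \<in> isum A (I i)"
  shows "1 \<in> isum A (\<Inter>i\<in>F. I i)"
  using F I c
proof (induction F rule: finite_induct)
  case empty
  show ?case by (rule isum_right[OF A]) simp
next
  case (insert i F)
  have ii: "idl (I i)" using insert by simp
  have iF: "idl (\<Inter>i\<in>F. I i)" by (rule idl_Inter) (use insert in simp)
  have "1 \<in> isum A (\<Inter>i\<in>F. I i)" using insert by simp
  then obtain x y where xy: "x \<in> A" "y \<in> (\<Inter>i\<in>F. I i)" "1 = x + y" by (rule isumE)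
  have "1 \<in> isum A (I i)" using insert by simp
  then obtain x' y' where xy': "x' \<in> A" "y' \<in> I i" "1 = x' + y'" by (rule isumE)
  have "1 = (x + y) * (x' + y')" using xy(3)[symmetric] xy'(3)[symmetric] by simp
  also have "\<dots> = (x * (x' + y') + y * x') + y' * y" by (simp add: algebra_simps)
  finally have e: "1 = (x * (x' + y') + y * x') + y' * y" .
  have "x * (x' + y') + y * x' \<in> A" using xy xy' by (intro idl_add[OF A] idl_mult[OF A] idl_mult'[OF A])
  moreover have "y' * y \<in> (\<Inter>i\<in>insert i F. I i)"
    using idl_mult'[OF ii xy'(2), of y] idl_mult[OF iF xy(2), of y'] by simp
  ultimately show ?case using e unfolding isum_def by blast
qed

lemma qdim_UNIV: "VR.fin_quot UNIV UNIV" "VR.qdim UNIV UNIV = 0"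
proof -
  have "VR.spans_mod UNIV UNIV {}" unfolding VR.spans_mod_def by (auto intro: VR.span_base)
  then show "VR.fin_quot UNIV UNIV" by (rule VR.fin_quotI)
  then show "VR.qdim UNIV UNIV = 0" using VR.qdim_eq_0_iff[OF _ VR.subspace_UNIV] by simp
qed

lemma qdim_Inter:
  assumes F: "finite F" and I: "\<And>i. i \<in> F \<Longrightarrow> idl (I i)" and fin: "\<And>i. i \<in> F \<Longrightarrow> VR.fin_quot UNIV (I i)"
    and c: "\<And>i j. i \<in> F \<Longrightarrow> j \<in> F \<Longrightarrow> i \<noteq> j \<Longrightarrow> 1 \<in> isum (I i) (I j)"
  shows "VR.fin_quot UNIV (\<Inter>i\<in>F. I i) \<and> VR.qdim UNIV (\<Inter>i\<in>F. I i) = (\<Sum>i\<in>F. VR.qdim UNIV (I i))"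
  using F I fin c
proof (induction F rule: finite_induct)
  case empty
  show ?case using qdim_UNIV by simp
next
  case (insert i F)
  have ii: "idl (I i)" using insert by simp
  have iF: "idl (\<Inter>i\<in>F. I i)" by (rule idl_Inter) (use insert in simp)
  have IH: "VR.fin_quot UNIV (\<Inter>i\<in>F. I i)" "VR.qdim UNIV (\<Inter>i\<in>F. I i) = (\<Sum>i\<in>F. VR.qdim UNIV (I i))"
    using insert by auto
  have "1 \<in> isum (I i) (\<Inter>i\<in>F. I i)" by (rule comax_Inter[OF insert(1) ii]) (use insert in auto)
  then obtain x y where xy: "x \<in> I i" "y \<in> (\<Inter>i\<in>F. I i)" "1 = x + y" by (rule isumE)
  have "\<exists>x\<in>I i. \<exists>y\<in>(\<Inter>i\<in>F. I i). v = x + y" for v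
    using idl_mult[OF ii xy(1), of v] idl_mult[OF iF xy(2), of v] xy(3)
    by (metis distrib_left mult_1_right)
  from VR.qdim_comax[OF subspace_idl[OF ii] subspace_idl[OF iF] this insert(5) IH(1)] IH(2) insert(1,2)
  show ?case by simp
qed

section \<open>Local multiplicities\<close>

definition lf :: "complex \<Rightarrow> complex \<Rightarrow> complex \<Rightarrow> R" where
  "lf \<alpha> \<beta> \<gamma> = K \<alpha> * X + K \<beta> * Y + K \<gamma> * Z"

text \<open>For a linear form \<open>l\<close> with \<open>l(a) = 1\<close> the forms \<open>x\<^sub>i - a\<^sub>i l\<close> generate the homogeneous ideal of the
  projective point \<open>a\<close>; so \<open>Pl a l N\<close> depends neither on \<open>l\<close> nor on the scaling of \<open>a\<close>.\<close>

definition Pl :: "(nat \<Rightarrow> complex) \<Rightarrow> R \<Rightarrow> nat \<Rightarrow> R set" where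
  "Pl a l N = Mp (X - K (a 0) * l) (Y - K (a 1) * l) (Z - K (a 2) * l) N"

lemma hom_lf: "hom 1 (lf \<alpha> \<beta> \<gamma>)"
  unfolding lf_def by (intro hom_add hom_K_mult hom_X hom_Y hom_Z)

lemma ev3_lf [simp]: "ev3 (lf \<alpha> \<beta> \<gamma>) a b c = \<alpha> * a + \<beta> * b + \<gamma> * c"
  by (simp add: lf_def)

lemma lf_decompose:
  "lf \<alpha> \<beta> \<gamma> = K \<alpha> * (X - K p0 * l) + K \<beta> * (Y - K p1 * l) + K \<gamma> * (Z - K p2 * l)
     + K (\<alpha> * p0 + \<beta> * p1 + \<gamma> * p2) * l"
  by (simp add: lf_def K_add K_mult algebra_simps)

lemma lf_in_Pl:
  assumes "evp (lf \<alpha> \<beta> \<gamma>) p = 0"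
  shows "lf \<alpha> \<beta> \<gamma> \<in> Pl p l 1"
proof -
  have "\<alpha> * p 0 + \<beta> * p 1 + \<gamma> * p 2 = 0" using assms by simp
  then have "lf \<alpha> \<beta> \<gamma> = K \<alpha> * (X - K (p 0) * l) + K \<beta> * (Y - K (p 1) * l) + K \<gamma> * (Z - K (p 2) * l)"
    using lf_decompose[of \<alpha> \<beta> \<gamma> "p 0" l "p 1" "p 2"] by simp
  moreover have "K \<alpha> * (X - K (p 0) * l) + K \<beta> * (Y - K (p 1) * l) + K \<gamma> * (Z - K (p 2) * l) \<in> Pl p l 1"
    unfolding Pl_def by (intro idl_add[OF idl_Mp] idl_mult[OF idl_Mp] Mp_1_gens)
  ultimately show ?thesis by simp
qed

lemma idl_zero: "idl {0}"
  by (simp add: idl_def)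

lemma isum_zero: "isum A {0} = A"
  by (auto simp: isum_def)

lemma Pl_subset:
  assumes l: "evp (lf \<alpha> \<beta> \<gamma>) a = 1" and s: "a 0 = s * p 0" "a 1 = s * p 1" "a 2 = s * p 2"
  shows "Pl a (lf \<alpha> \<beta> \<gamma>) N \<subseteq> Pl p l' N"
proof -
  have e: "\<alpha> * (s * p 0) + \<beta> * (s * p 1) + \<gamma> * (s * p 2) = 1" using l s by simp
  then have s0: "s \<noteq> 0" by auto
  have e': "\<alpha> * p 0 + \<beta> * p 1 + \<gamma> * p 2 = 1 / s" using e s0 by (simp add: field_simps)
  let ?l = "lf \<alpha> \<beta> \<gamma>"
  have ev: "evp ?l p = 1 / s" using e' by simp
  \<comment> \<open>For \<open>d\<close> the matching coordinate of \<open>a\<close> these forms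
    vanish at \<open>a\<close>, hence at \<open>p\<close>, and linear forms vanishing at
    \<open>p\<close> lie in \<open>Pl p l' 1\<close>.\<close>
  have f: "X - K d * ?l = lf (1 - d * \<alpha>) (- (d * \<beta>)) (- (d * \<gamma>))"
    "Y - K d * ?l = lf (- (d * \<alpha>)) (1 - d * \<beta>) (- (d * \<gamma>))"
    "Z - K d * ?l = lf (- (d * \<alpha>)) (- (d * \<beta>)) (1 - d * \<gamma>)" for d
    by (simp_all add: lf_def K_diff K_uminus K_mult K_1 algebra_simps)
  have "X - K (a 0) * ?l \<in> Pl p l' 1" unfolding f
    by (rule lf_in_Pl, unfold f[symmetric]) (use ev s s0 in simp)
  moreover have "Y - K (a 1) * ?l \<in> Pl p l' 1" unfolding f
    by (rule lf_in_Pl, unfold f[symmetric]) (use ev s s0 in simp)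
  moreover have "Z - K (a 2) * ?l \<in> Pl p l' 1" unfolding f
    by (rule lf_in_Pl, unfold f[symmetric]) (use ev s s0 in simp)
  ultimately show ?thesis
    using Mp_subset_isum[OF idl_zero] unfolding Pl_def isum_zero by blast
qed

lemma hidl_Pl:
  assumes l: "hom 1 l"
  shows "hidl (Pl a l N)"
  unfolding Pl_def Mp_def
proof (rule hidl_genR)
  fix g assume "g \<in> {(X - K (a 0) * l) ^ i * (Y - K (a 1) * l) ^ j * (Z - K (a 2) * l) ^ k |i j k. i + j + k = N}"
  then obtain i j k where g: "g = (X - K (a 0) * l) ^ i * (Y - K (a 1) * l) ^ j * (Z - K (a 2) * l) ^ k" by blast
  have "hom (i * 1 + j * 1 + k * 1) g" unfolding g
    by (intro hom_mult hom_power hom_diff hom_K_mult hom_X hom_Y hom_Z l)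
  then show "\<exists>n. hom n g" ..
qed

text \<open>Built with the homogeneous ideal \<open>Pl\<close>, so that \<open>dehomogenize\<close>
  applies; \<open>loc_eq\<close> shows that modulo \<open>l - 1\<close> it may be replaced by the
  power of the maximal ideal of the affine point.\<close>

definition loc :: "R3 \<Rightarrow> (nat \<Rightarrow> complex) \<Rightarrow> R \<Rightarrow> nat \<Rightarrow> R set" where
  "loc w a l N = isum (isum (Jac w) (Pl a l N)) (prin (l - 1))"

lemma loc_dehomogenize:
  assumes w: "hom3 e w" and l: "hom 1 l"
  shows "\<exists>n1. \<forall>n\<ge>n1. VR.fin_quot UNIV (loc w a l N)
    \<and> VR.qdim UNIV (loc w a l N) = VR.qdim (Sn n) (isum (Jac w) (Pl a l N) \<inter> Sn n)"
  unfolding loc_def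
proof (rule dehomogenize[OF hidl_isum[OF hidl_Jac[OF w] hidl_Pl[OF l]] l])
  let ?I = "isum (Jac w) (Pl a l N)"
  have iI: "idl ?I" by (rule idl_isum[OF hidl_idl[OF hidl_Jac[OF w]] hidl_idl[OF hidl_Pl[OF l]]])
  have i: "idl (isum ?I (prin l))" by (rule idl_isum[OF iI idl_prin])
  have lin: "l \<in> isum ?I (prin l)" by (rule isum_right[OF iI]) (auto simp: prin_def intro: exI[of _ 1])
  have P: "x \<in> isum ?I (prin l)" if "x \<in> Pl a l N" for x
    by (rule isum_left[OF idl_prin isum_right[OF hidl_idl[OF hidl_Jac[OF w]] that]])
  \<comment> \<open>Here \<open>x = (x - K c * l) + K c * l\<close>, with the \<open>N\<close>-th
    power of the first summand and the second summand itself in the ideal.\<close>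
  have pw: "x ^ (N + 1) \<in> isum ?I (prin l)" if "(x - K c * l) ^ N \<in> Pl a l N" for x c
  proof -
    have "(K c * l) ^ 1 \<in> isum ?I (prin l)" using idl_mult[OF i lin] by simp
    from idl_power_add[OF i P[OF that] this] show ?thesis by simp
  qed
  have "X ^ (N + 1) \<in> isum ?I (prin l)"
    by (rule pw[of _ "a 0"]) (use Mp_base[of N 0 0 N "X - K (a 0) * l"] in \<open>simp add: Pl_def\<close>)
  moreover have "Y ^ (N + 1) \<in> isum ?I (prin l)"
    by (rule pw[of _ "a 1"]) (use Mp_base[of 0 N 0 N _ "Y - K (a 1) * l"] in \<open>simp add: Pl_def\<close>)
  moreover have "Z ^ (N + 1) \<in> isum ?I (prin l)"
    by (rule pw[of _ "a 2"]) (use Mp_base[of 0 0 N N _ _ "Z - K (a 2) * l"] in \<open>simp add: Pl_def\<close>)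
  ultimately show "\<And>n. n \<ge> 3 * (N + 1) \<Longrightarrow> Sn n \<subseteq> isum ?I (prin l)" by (intro Sn_subset_idl[OF i])
qed

text \<open>Change of chart: \<open>Pl\<close> is the same on both sides, so both dimensions equal
  that of one large graded piece of the same homogeneous quotient, which does not involve
  \<open>l\<close>.\<close>

lemma loc_independent:
  assumes w: "hom3 e w" and l: "l = lf \<alpha> \<beta> \<gamma>" "evp l a = 1" and l': "l' = lf \<alpha>' \<beta>' \<gamma>'" "evp l' p = 1"
    and s: "s \<noteq> 0" "a 0 = s * p 0" "a 1 = s * p 1" "a 2 = s * p 2"
  shows "VR.qdim UNIV (loc w a l N) = VR.qdim UNIV (loc w p l' N)"
proof -
  have "Pl a l N = Pl p l' N"
  proof
    show "Pl a l N \<subseteq> Pl p l' N"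
      using Pl_subset[OF l(2)[unfolded l(1)] s(2-4)] unfolding l(1) .
    show "Pl p l' N \<subseteq> Pl a l N"
    proof -
      have "p 0 = 1 / s * a 0" "p 1 = 1 / s * a 1" "p 2 = 1 / s * a 2"
        using s(1) unfolding s(2-4) by simp_all
      from Pl_subset[OF l'(2)[unfolded l'(1)] this] show ?thesis unfolding l'(1) .
    qed
  qed
  moreover obtain n1 where "\<forall>n\<ge>n1. VR.qdim UNIV (loc w a l N) = VR.qdim (Sn n) (isum (Jac w) (Pl a l N) \<inter> Sn n)"
    using loc_dehomogenize[OF w, of l a N] hom_lf l by blast
  moreover obtain n2 where "\<forall>n\<ge>n2. VR.qdim UNIV (loc w p l' N) = VR.qdim (Sn n) (isum (Jac w) (Pl p l' N) \<inter> Sn n)"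
    using loc_dehomogenize[OF w, of l' p N] hom_lf l' by blast
  ultimately show ?thesis by (metis (no_types, lifting) nat_le_linear)
qed

lemma loc_eq:
  assumes w: "hom3 e w"
  shows "loc w a l N = isum (isum (Jac w) (prin (l - 1))) (mpt (a 0) (a 1) (a 2) N)"
proof -
  let ?A = "prin (l - 1)"
  have J: "idl (Jac w)" by (rule hidl_idl[OF hidl_Jac[OF w]])
  have P: "idl (Pl a l N)" unfolding Pl_def by (rule idl_Mp)
  have A: "idl ?A" by (rule idl_prin)
  have AK: "K c * (l - 1) \<in> ?A" for c unfolding prin_def by (auto simp: mult.commute)
  have g: "x - K c = (x - K c * l) + K c * (l - 1)" "x - K c * l = (x - K c) + K (- c) * (l - 1)" for x c
    by (simp_all add: algebra_simps K_uminus)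
  have "x - K c \<in> isum (Pl a l 1) ?A" if "x - K c * l \<in> Pl a l 1" for x c
    unfolding g(1) isum_def using that AK by blast
  note h = this[unfolded Pl_def, OF Mp_1_gens(1)] this[unfolded Pl_def, OF Mp_1_gens(2)] this[unfolded Pl_def, OF Mp_1_gens(3)]
  have 1: "mpt (a 0) (a 1) (a 2) N \<subseteq> isum (Pl a l N) ?A"
    unfolding mpt_def Pl_def by (rule Mp_subset_isum[OF A h])
  have "x - K c * l \<in> isum (mpt (a 0) (a 1) (a 2) 1) ?A" if "x - K c \<in> mpt (a 0) (a 1) (a 2) 1" for x c
    unfolding g(2) isum_def using that AK by blast
  note h = this[unfolded mpt_def, OF Mp_1_gens(1)] this[unfolded mpt_def, OF Mp_1_gens(2)] this[unfolded mpt_def, OF Mp_1_gens(3)]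
  have 2: "Pl a l N \<subseteq> isum (mpt (a 0) (a 1) (a 2) N) ?A"
    unfolding mpt_def Pl_def by (rule Mp_subset_isum[OF A h])
  let ?L = "isum (isum (Jac w) (Pl a l N)) ?A" and ?R = "isum (isum (Jac w) ?A) (mpt (a 0) (a 1) (a 2) N)"
  have iL: "idl ?L" and iR: "idl ?R" by (intro idl_isum J P A idl_mpt)+
  have JL: "Jac w \<subseteq> ?L" "Pl a l N \<subseteq> ?L" "?A \<subseteq> ?L"
    by (intro subsetI isum_left[OF A] isum_left[OF P], assumption)
      (intro subsetI isum_left[OF A] isum_right[OF J], assumption,
        intro subsetI isum_right[OF idl_isum[OF J P]], assumption)
  have JR: "Jac w \<subseteq> ?R" "?A \<subseteq> ?R" "mpt (a 0) (a 1) (a 2) N \<subseteq> ?R"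
    by (intro subsetI isum_left[OF idl_mpt] isum_left[OF A], assumption)
      (intro subsetI isum_left[OF idl_mpt] isum_right[OF J], assumption,
        intro subsetI isum_right[OF idl_isum[OF J A]], assumption)
  show ?thesis unfolding loc_def
  proof
    have "Pl a l N \<subseteq> ?R" using 2 isum_subset[OF iR JR(3) JR(2)] by blast
    then show "?L \<subseteq> ?R" by (intro isum_subset[OF iR] JR)
    have "mpt (a 0) (a 1) (a 2) N \<subseteq> ?L" using 1 isum_subset[OF iL JL(2) JL(3)] by blast
    then show "?R \<subseteq> ?L" by (intro isum_subset[OF iL] JL)
  qed
qed

lemma proj_pts_chart:
  assumes "a \<in> proj_pts"
  shows "chart a \<le> 2" "a (chart a) = 1"
proof -
  obtain k where k: "k \<le> 2" "a k = 1" "\<forall>j<k. a j = 0" using assms by (auto simp: proj_pts_def)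
  have "chart a = k" unfolding chart_def by (rule Least_equality) (use k in \<open>auto simp: not_less[symmetric]\<close>)
  then show "chart a \<le> 2" "a (chart a) = 1" using k by auto
qed

lemma vars3_chart:
  assumes a: "a \<in> proj_pts"
  shows "\<exists>\<alpha> \<beta> \<gamma>. vars3 (chart a) = lf \<alpha> \<beta> \<gamma>" "evp (vars3 (chart a)) a = 1"
proof -
  have c: "chart a = 0 \<or> chart a = 1 \<or> chart a = 2" using proj_pts_chart(1)[OF a] by auto
  have "X = lf 1 0 0" "Y = lf 0 1 0" "Z = lf 0 0 1" by (simp_all add: lf_def K_1 K_0)
  then show "\<exists>\<alpha> \<beta> \<gamma>. vars3 (chart a) = lf \<alpha> \<beta> \<gamma>" using c unfolding vars3_def by metis
  show "evp (vars3 (chart a)) a = 1" using c proj_pts_chart(2)[OF a] by (auto simp: vars3_def)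
qed

lemma lt_lf: "lt t = lf 1 t (t\<^sup>2)"
  by (simp add: lt_def lf_def K_1)

text \<open>The chart \<open>lt t = 1\<close> contains all zeros. There \<open>B\<close> is the
  intersection of the comaximal ideals \<open>C N a\<close>, one for each zero, so their
  codimensions add up to \<open>h\<close>. Afterwards each summand is carried over to the coordinate
  chart of its point.\<close>

theorem local_multiplicities:
  assumes w: "hom3 e w" and fin: "finite (zeros w)"
  shows "\<exists>h n1 c N1. (\<forall>n\<ge>n1. hilb w n = h) \<and> (\<Sum>a\<in>zeros w. c a) = h
    \<and> (\<forall>a\<in>zeros w. \<forall>N\<ge>N1. VR.qdim UNIV (loc w a (vars3 (chart a)) N) = c a)"
proof -
  have zp: "zeros w \<subseteq> proj_pts" by (auto simp: zeros_def)
  obtain t where t: "\<forall>a\<in>zeros w. evp (lt t) a \<noteq> 0" using avoiding_line[OF fin zp] by blast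
  let ?l = "lt t"
  have hJ: "hidl (Jac w)" by (rule hidl_Jac[OF w])
  note J = hidl_idl[OF hJ]
  have iJl: "idl (isum (Jac w) (prin ?l))" by (rule idl_isum[OF J idl_prin])
  obtain m where "X ^ m \<in> isum (Jac w) (prin ?l)" "Y ^ m \<in> isum (Jac w) (prin ?l)" "Z ^ m \<in> isum (Jac w) (prin ?l)"
    using binary_nullstellensatz[OF w t] by blast
  from Sn_subset_idl[OF iJl this] obtain n1 where n1:
    "\<forall>n\<ge>n1. VR.fin_quot UNIV (isum (Jac w) (prin (?l - 1)))
      \<and> VR.qdim UNIV (isum (Jac w) (prin (?l - 1))) = VR.qdim (Sn n) (Jac w \<inter> Sn n)"
    using dehomogenize[OF hJ hom_lt, of "3 * m" t] by blast
  define B where "B = isum (Jac w) (prin (?l - 1))"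
  define h where "h = VR.qdim UNIV B"
  have hil: "\<forall>n\<ge>n1. hilb w n = h" and finB: "VR.fin_quot UNIV B" using n1 by (auto simp: hilb_def h_def B_def)
  have B: "idl B" unfolding B_def by (rule idl_isum[OF J idl_prin])
  \<comment> \<open>The representative of the projective point \<open>a\<close> on the affine plane
    \<open>lt t = 1\<close>.\<close>
  define p where "p a i = a i / evp ?l a" for a :: "nat \<Rightarrow> complex" and i :: nat
  define C where "C N a = isum B (mpt (p a 0) (p a 1) (p a 2) N)" for N a
  have iC: "idl (C N a)" for N a unfolding C_def by (rule idl_isum[OF B idl_mpt])
  have BC: "B \<subseteq> C N a" for N a unfolding C_def using isum_left[OF idl_mpt] by blast
  have fC: "VR.fin_quot UNIV (C N a)" for N a by (rule VR.fin_quot_mono[OF finB BC])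
  have mono: "VR.qdim UNIV (C N a) \<le> VR.qdim UNIV (C (Suc N) a)" for N a
    by (rule VR.qdim_antimono[OF fC]) (unfold C_def mpt_def, intro isum_mono Mp_antimono order_refl)
  have mono': "VR.qdim UNIV (C N a) \<le> VR.qdim UNIV (C N' a)" if "N \<le> N'" for N N' a
    by (rule lift_Suc_mono_le[of "\<lambda>N. VR.qdim UNIV (C N a)", OF mono that])
  have evl: "evp ?l a \<noteq> 0" if "a \<in> zeros w" for a using t that by blast
  have pinj: "(p a 0, p a 1, p a 2) \<noteq> (p b 0, p b 1, p b 2)" if ab: "a \<in> zeros w" "b \<in> zeros w" "a \<noteq> b" for a b
  proof
    assume eq: "(p a 0, p a 1, p a 2) = (p b 0, p b 1, p b 2)"
    have a: "a i = evp ?l a * p a i" and b: "b i = evp ?l b * p b i" for i using evl ab by (auto simp: p_def)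
    have "a 0 * b 1 = a 1 * b 0" "a 0 * b 2 = a 2 * b 0" "a 1 * b 2 = a 2 * b 1"
      using eq by (subst (1 2) a, subst (1 2) b, simp add: mult_ac)+
    then have "a = b" by (intro proj_pts_parallel) (use ab zp in auto)
    then show False using ab by simp
  qed
  obtain L1 L2 L3 where L: "lprod X L1 \<in> B" "lprod Y L2 \<in> B" "lprod Z L3 \<in> B"
    using exists_lprod[OF B finB] by metis
  \<comment> \<open>Total degree of the polynomials annihilating the three coordinates modulo
    \<open>B\<close>, the bound required by \<open>local_membership\<close>; from here on the local
    ideals no longer lose information.\<close>
  define N1 where "N1 = length L1 + length L2 + length L3"
  have inter: "(\<Inter>a\<in>zeros w. C N a) = B" if N: "N \<ge> N1" for N
  proof
    show "B \<subseteq> (\<Inter>a\<in>zeros w. C N a)" using BC by blast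
    show "(\<Inter>a\<in>zeros w. C N a) \<subseteq> B"
    proof
      fix g assume g: "g \<in> (\<Inter>a\<in>zeros w. C N a)"
      show "g \<in> B"
      proof (rule local_membership[OF B L])
        show "N \<ge> length L1 + length L2 + length L3" using N by (simp add: N1_def)
        fix x y z assume v: "\<And>q. q \<in> B \<Longrightarrow> ev3 q x y z = 0"
        have "?l - 1 \<in> B" unfolding B_def by (rule isum_right[OF J]) (auto simp: prin_def intro: exI[of _ 1])
        from v[OF this] have l1: "ev3 ?l x y z = 1" by simp
        then have "(x, y, z) \<noteq> (0, 0, 0)" by (auto simp: lt_def)
        from proj_pts_norm[OF this] obtain a s where a: "a \<in> proj_pts" "s \<noteq> 0" "x = s * a 0" "y = s * a 1" "z = s * a 2"
          by (elim bexE exE conjE)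
        obtain w1 w2 w3 where w123: "w = (w1, w2, w3)" by (metis prod.exhaust)
        have "u * w1 + u' * w2 + u'' * w3 \<in> B" for u u' u''
          unfolding B_def by (rule isum_left[OF idl_prin])
            (auto simp: Jac_def w123 intro: exI[of _ u] exI[of _ u'] exI[of _ u''])
        from this[of 1 0 0] this[of 0 1 0] this[of 0 0 1] have "w1 \<in> B" "w2 \<in> B" "w3 \<in> B" by auto
        then have ev0: "ev3 w1 x y z = 0" "ev3 w2 x y z = 0" "ev3 w3 x y z = 0" using v by auto
        have "evp q a = 0" if "hom e q" "ev3 q x y z = 0" for q
          using that ev3_scale[OF that(1), of s "a 0" "a 1" "a 2"] a by simp
        then have "a \<in> zeros w" using ev0 w a by (auto simp: zeros_def vanish_def w123)
        moreover have "s * evp ?l a = 1" using l1 ev3_scale[OF hom_lt, of t s "a 0" "a 1" "a 2"] a by simp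
        then have "p a i = s * a i" for i using a(2) evl[OF \<open>a \<in> zeros w\<close>] by (simp add: p_def field_simps)
        ultimately show "g \<in> isum B (mpt x y z N)" using g a by (auto simp: C_def)
      qed
    qed
  qed
  have summ: "(\<Sum>a\<in>zeros w. VR.qdim UNIV (C N a)) = h" if N: "N \<ge> N1" for N
  proof -
    have cm: "1 \<in> isum (C N a) (C N b)" if "a \<in> zeros w" "b \<in> zeros w" "a \<noteq> b" for a b
    proof -
      have "1 \<in> isum (mpt (p a 0) (p a 1) (p a 2) N) (mpt (p b 0) (p b 1) (p b 2) N)"
        by (rule comax_mpt[OF pinj[OF that]])
      moreover have "mpt (p a 0) (p a 1) (p a 2) N \<subseteq> C N a" for a unfolding C_def using isum_right[OF B] by blast
      ultimately show ?thesis using isum_mono by blast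
    qed
    have "VR.qdim UNIV (\<Inter>a\<in>zeros w. C N a) = (\<Sum>a\<in>zeros w. VR.qdim UNIV (C N a))"
      by (rule qdim_Inter[THEN conjunct2, OF fin iC fC cm])
    then show ?thesis unfolding inter[OF N] h_def by simp
  qed
  define c where "c a = VR.qdim UNIV (C N1 a)" for a
  \<comment> \<open>No summand decreases with \<open>N\<close>, while the sum stays
    \<open>h\<close>; so every summand is constant from \<open>N1\<close> on.\<close>
  have cN: "VR.qdim UNIV (C N a) = c a" if "a \<in> zeros w" "N \<ge> N1" for a N
  proof -
    have "c a = VR.qdim UNIV (C N a)"
      by (rule sum_mono_inv[where I = "zeros w" and f = c and g = "\<lambda>a. VR.qdim UNIV (C N a)"])
        (use summ[of N] summ[of N1] mono'[OF that(2)] that fin in \<open>auto simp: c_def\<close>)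
    then show ?thesis by simp
  qed
  have "VR.qdim UNIV (loc w a (vars3 (chart a)) N) = c a" if a: "a \<in> zeros w" and N: "N \<ge> N1" for a N
  proof -
    have ap: "a \<in> proj_pts" using a zp by blast
    obtain \<alpha> \<beta> \<gamma> where lf: "vars3 (chart a) = lf \<alpha> \<beta> \<gamma>" using vars3_chart(1)[OF ap] by blast
    have "VR.qdim UNIV (loc w a (vars3 (chart a)) N) = VR.qdim UNIV (loc w (p a) ?l N)"
    proof (rule loc_independent[OF w lf vars3_chart(2)[OF ap] lt_lf, of t "p a" "evp ?l a"])
      show "evp ?l (p a) = 1"
        using ev3_scale[OF hom_lt, of t "1 / evp ?l a" "a 0" "a 1" "a 2"] evl[OF a] by (simp add: p_def)
    qed (use evl[OF a] in \<open>auto simp: p_def\<close>)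
    also have "loc w (p a) ?l N = C N a" unfolding loc_eq[OF w] C_def B_def ..
    finally show ?thesis using cN[OF a N] by simp
  qed
  moreover have "(\<Sum>a\<in>zeros w. c a) = h" using summ[of N1] by (simp add: c_def)
  ultimately show ?thesis using hil by blast
qed

section \<open>The bound for the Tjurina number and free curves\<close>

definition freeR :: "R3 \<Rightarrow> nat \<Rightarrow> nat \<Rightarrow> bool" where
  "freeR w d1 d2 \<longleftrightarrow> (\<exists>\<rho>1\<in>Syz w. \<exists>\<rho>2\<in>Syz w. hom3 d1 \<rho>1 \<and> \<rho>1 \<noteq> 0 \<and> hom3 d2 \<rho>2 \<and> \<rho>2 \<noteq> 0 \<and>
     (\<forall>\<sigma>\<in>Syz w. \<exists>!x. \<sigma> = smul (fst x) \<rho>1 + smul (snd x) \<rho>2))"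

definition no_syz_below :: "R3 \<Rightarrow> nat \<Rightarrow> bool" where
  "no_syz_below w r \<longleftrightarrow> (\<forall>k<r. \<forall>\<sigma>\<in>Syz w. hom3 k \<sigma> \<longrightarrow> \<sigma> = 0)"

lemma hcomp3_add: "hcomp3 n (u + v) = hcomp3 n u + hcomp3 n v"
  by (cases u; cases v) (simp add: hcomp_add)

lemma zero_in_Syz: "0 \<in> Syz w"
  by (simp add: Syz_def)

text \<open>The coefficients supplied by freeness need not be homogeneous. Passing to components
  shows that the degree \<open>k\<close> part is the direct sum of copies of
  \<open>Sn (k - d1)\<close> and \<open>Sn (k - d2)\<close>.\<close>

lemma freeR_dimSyz:
  assumes w: "hom3 e w" and free: "freeR w d1 d2"
  shows "k \<ge> d1 \<Longrightarrow> k \<ge> d2 \<Longrightarrow> dimSyz w k = dimS (k - d1) + dimS (k - d2)"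
    and "d1 \<le> d2 \<Longrightarrow> no_syz_below w d1"
proof -
  obtain \<rho>1 \<rho>2 where r: "\<rho>1 \<in> Syz w" "\<rho>2 \<in> Syz w" "hom3 d1 \<rho>1" "\<rho>1 \<noteq> 0" "hom3 d2 \<rho>2" "\<rho>2 \<noteq> 0"
    and ex1': "\<forall>\<sigma>\<in>Syz w. \<exists>!x. \<sigma> = smul (fst x) \<rho>1 + smul (snd x) \<rho>2"
    using free unfolding freeR_def by (elim bexE conjE) (rule that)
  note ex1 = ex1'[rule_format]
  have ind: "p = 0 \<and> q = 0" if "smul p \<rho>1 + smul q \<rho>2 = 0" for p q
  proof -
    have "(p, q) = (0, 0)"
      using ex1[OF zero_in_Syz] that by (elim ex1E) (metis fst_conv snd_conv smul_0_left add_0)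
    then show ?thesis by simp
  qed
  show "no_syz_below w d1" if d: "d1 \<le> d2"
    unfolding no_syz_below_def
  proof (intro allI impI ballI)
    fix k \<sigma> assume k: "k < d1" and s: "\<sigma> \<in> Syz w" "hom3 k \<sigma>"
    obtain p q where "\<sigma> = smul p \<rho>1 + smul q \<rho>2" using ex1[OF s(1)] by (metis ex1_implies_ex)
    then have "hcomp3 k \<sigma> = 0"
      using hcomp3_smul_small[OF r(3) k] hcomp3_smul_small[OF r(5), of k] k d by (simp add: hcomp3_add)
    then show "\<sigma> = 0" using hcomp3_hom3[OF s(2), of k] by simp
  qed
  show "dimSyz w k = dimS (k - d1) + dimS (k - d2)" if k: "k \<ge> d1" "k \<ge> d2"
  proof -
    let ?Z = "Syz w \<inter> S3 k" and ?U = "(\<lambda>p. smul p \<rho>1) ` Sn (k - d1)"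
    have sZ: "VT.subspace ?Z" by (simp add: VT.subspace_inter subspace_Syz subspace_S3)
    have fZ: "VT.fin_quot ?Z {0}" by (rule VT.qdim_add_0[OF sZ subspace_S3 _ qdim_S3(1)]) auto
    have lr: "Vector_Spaces.linear scR scR3 (\<lambda>p. smul p v)" for v
      by (rule VRT_linearI) (auto simp: smul_add_left smul_smul)
    have sU: "VT.subspace ?U" by (rule VRT.linear_subspace_image[OF lr subspace_Sn])
    have in1: "smul p \<rho> \<in> ?Z" if "p \<in> Sn (k - d)" "\<rho> \<in> Syz w" "hom3 d \<rho>" "k \<ge> d" for p \<rho> d
      using that hom3_smul[of "k - d" p d \<rho>] by (auto simp: Sn_def S3_def Syz_def dot_smul_left)
    have UZ: "?U \<subseteq> ?Z" using in1[OF _ r(1,3) k(1)] by blast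
    have sur: "\<exists>v\<in>Sn (k - d2). v' - smul v \<rho>2 \<in> ?U" if v': "v' \<in> ?Z" for v'
    proof -
      obtain p q where pq: "v' = smul p \<rho>1 + smul q \<rho>2" using ex1 v' by (metis ex1_implies_ex IntD1)
      have "v' = hcomp3 k v'" using v' hcomp3_hom3[of k v' k] by (simp add: S3_def)
      also have "\<dots> = smul (hcomp (k - d1) p) \<rho>1 + smul (hcomp (k - d2) q) \<rho>2"
        using hcomp3_smul[OF r(3), of "k - d1" p] hcomp3_smul[OF r(5), of "k - d2" q] k pq by (simp add: hcomp3_add)
      finally have "v' - smul (hcomp (k - d2) q) \<rho>2 = smul (hcomp (k - d1) p) \<rho>1" by (simp add: diff_eq_eq)
      then show ?thesis using hom_hcomp by (intro bexI[of _ "hcomp (k - d2) q"]) (auto simp: Sn_def)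
    qed
    have 1: "VT.qdim ?Z {0} = VT.qdim ?Z ?U + VT.qdim ?U {0}"
      by (rule VT.qdim_add_0(3)[OF sU sZ UZ fZ])
    have 2: "VR.qdim (Sn (k - d1)) {0} = VT.qdim ?U {0}"
      by (rule VRT.qdim_iso(2)[OF lr subspace_Sn VR.subspace_single_0 VT.subspace_single_0 _ _ _ _ qdim_Sn(1)])
        (auto simp: smul_eq_0_iff r Sn_def)
    have 3: "VR.qdim (Sn (k - d2)) {0} = VT.qdim ?Z ?U"
    proof (rule VRT.qdim_iso(2)[OF lr subspace_Sn VR.subspace_single_0 sU _ _ _ sur qdim_Sn(1)])
      show "{0} \<subseteq> Sn (k - d2)" by (simp add: Sn_def)
      show "(\<lambda>p. smul p \<rho>2) ` Sn (k - d2) \<subseteq> ?Z" using in1[OF _ r(2,5) k(2)] by blast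
      show "smul v \<rho>2 \<in> ?U \<longleftrightarrow> v \<in> {0}" for v
      proof
        assume "smul v \<rho>2 \<in> ?U"
        then obtain p where "smul v \<rho>2 = smul p \<rho>1" by blast
        then have "smul (- p) \<rho>1 + smul v \<rho>2 = 0" by (simp add: smul_uminus_left)
        then show "v \<in> {0}" using ind by blast
      qed (use VT.subspace_0[OF sU] in simp)
    qed
    show ?thesis using 1 2 3 by (simp add: dimSyz_def dimS_def)
  qed
qed

lemma dimS_int: "2 * int (dimS n) = (int n + 1) * (int n + 2)"
  using arg_cong[OF dimS[of n], of int] by (simp only: of_nat_mult of_nat_add of_nat_numeral of_nat_1)

text \<open>A basis makes \<open>2 * hilb\<close> an explicit polynomial of degree at most 1 in
  \<open>k\<close>. Being eventually constant, it has no linear term, which fixes the sum of the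
  exponents; its constant term then gives \<open>h\<close>.\<close>

lemma freeR_exponents:
  assumes w: "hom3 e w" "w \<noteq> 0" "Prim w" and free: "freeR w d1 d2" and h: "\<forall>n\<ge>n1. hilb w n = h"
  shows "d1 + d2 = e" "int h = (int e)\<^sup>2 - int d1 * int d2"
proof -
  \<comment> \<open>\<open>2 * D\<close> and \<open>c\<close> are the linear and the constant
    coefficient of that polynomial; the quadratic terms cancel.\<close>
  define D where "D = int e - int d1 - int d2"
  define c where "c = (int e + 1) * (int e + 2) + (1 - int d1) * (2 - int d1) + (1 - int d2) * (2 - int d2) - 6"
  have key: "2 * int h = 2 * int k * D + c" if k: "k \<ge> n1 + d1 + d2" for k
  proof -
    have "dimS (e + k) + dimSyz w k = h + 3 * dimS k" using hilb_dimSyz[OF w(1), of k] h k by simp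
    moreover have "dimSyz w k = dimS (k - d1) + dimS (k - d2)" by (rule freeR_dimSyz(1)[OF w(1) free]) (use k in auto)
    ultimately have "int (dimS (e + k)) + (int (dimS (k - d1)) + int (dimS (k - d2))) = int h + 3 * int (dimS k)"
      by (metis of_nat_add of_nat_mult of_nat_numeral)
    then have "2 * int h = 2 * int (dimS (e + k)) + 2 * int (dimS (k - d1)) + 2 * int (dimS (k - d2)) - 3 * (2 * int (dimS k))"
      by simp
    moreover have "int (k - d1) = int k - int d1" "int (k - d2) = int k - int d2" using k by auto
    ultimately show ?thesis unfolding dimS_int D_def c_def by (simp add: algebra_simps)
  qed
  have "2 * int (n1 + d1 + d2) * D + c = 2 * int (n1 + d1 + d2 + 1) * D + c"
    using key[of "n1 + d1 + d2"] key[of "n1 + d1 + d2 + 1"] by simp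
  then have D0: "D = 0" by (simp add: algebra_simps)
  then show e: "d1 + d2 = e" unfolding D_def by linarith
  have "2 * int h = c" using key[of "n1 + d1 + d2"] D0 by simp
  then show "int h = (int e)\<^sup>2 - int d1 * int d2"
    unfolding c_def e[symmetric] by (simp add: algebra_simps power2_eq_square)
qed

text \<open>A multiplier of degree \<open>n\<close> comes from a syzygy of degree
  \<open>k = e + n - r\<close>. Below \<open>r\<close> there are only zero ones.\<close>

lemma quot_ideal_low_degree:
  assumes w: "hom3 e w" "w \<noteq> 0" and m: "min_syz w r \<rho>" and n: "r + k = e + n" "k < r"
  shows "quot_ideal w \<rho> \<inter> Sn n = {0}"
proof -
  have rho: "hom3 r \<rho>" and min: "\<And>k \<sigma>. k < r \<Longrightarrow> \<sigma> \<in> Syz w \<Longrightarrow> hom3 k \<sigma> \<Longrightarrow> \<sigma> = 0"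
    using m by (auto simp: min_syz_def)
  have "h = 0" if h: "h \<in> quot_ideal w \<rho>" "h \<in> Sn n" for h
  proof -
    obtain \<sigma> where s: "\<sigma> \<in> Syz w" "cross \<rho> \<sigma> = smul h w" using h unfolding quot_ideal_def by blast
    have "hcomp3 k \<sigma> = 0" by (rule min[OF n(2) hcomp3_Syz[OF w(1) s(1)] hom3_hcomp3])
    then have "hcomp3 (r + k) (smul h w) = cross \<rho> 0" using hcomp3_cross[OF rho, of k \<sigma>] s by simp
    then have "smul (hcomp n h) w = 0" using hcomp3_smul[OF w(1), of n h] n(1) by (cases \<rho>) (simp add: zero_triple)
    then show "h = 0" using w(2) h(2) hcomp_hom[of n h n] by (simp add: smul_eq_0_iff Sn_def)
  qed
  moreover have "0 \<in> quot_ideal w \<rho>" "0 \<in> Sn n"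
    by (rule VR.subspace_0[OF subspace_quot_ideal], rule VR.subspace_0[OF subspace_Sn])
  ultimately show ?thesis by blast
qed

text \<open>Let \<open>\<rho>2\<close> be a homogeneous syzygy with
  \<open>cross \<rho> \<rho>2 = w\<close>. For any syzygy \<tau> the product
  \<open>cross \<rho> \<tau>\<close> is \<open>smul h w\<close>, so \<tau> minus \<open>h\<close>
  times \<open>\<rho>2\<close> is parallel to \<rho>, hence a multiple of it. Taking
  \<open>cross \<rho>\<close> also recovers the coefficient \<open>h\<close>, so the coefficients
  are unique.\<close>

lemma freeI:
  assumes w: "hom3 e w" "w \<noteq> 0" "Prim w" and m: "min_syz w r \<rho>" and re: "r \<le> e" and one: "1 \<in> quot_ideal w \<rho>"
  shows "freeR w r (e - r)"
proof -
  have rho: "\<rho> \<in> Syz w" "hom3 r \<rho>" "\<rho> \<noteq> 0" using m by (auto simp: min_syz_def)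
  have prho: "Prim \<rho>" by (rule min_syz_Prim[OF w(1) m])
  obtain \<sigma> where s: "\<sigma> \<in> Syz w" "cross \<rho> \<sigma> = w" using one unfolding quot_ideal_def by auto
  define \<rho>2 where "\<rho>2 = hcomp3 (e - r) \<sigma>"
  have r2: "\<rho>2 \<in> Syz w" "hom3 (e - r) \<rho>2" unfolding \<rho>2_def by (rule hcomp3_Syz[OF w(1) s(1)], rule hom3_hcomp3)
  have c2: "cross \<rho> \<rho>2 = w"
    using hcomp3_cross[OF rho(2), of "e - r" \<sigma>] s re hcomp3_hom3[OF w(1), of e] by (simp add: \<rho>2_def)
  have cz: "cross \<rho> 0 = 0" "cross \<rho> \<rho> = 0" by (cases \<rho>, simp add: zero_triple mult.commute)+
  have "\<rho>2 \<noteq> 0" using c2 w(2) cz by auto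
  moreover have "\<exists>!x. \<tau> = smul (fst x) \<rho> + smul (snd x) \<rho>2" if t: "\<tau> \<in> Syz w" for \<tau>
  proof (rule ex_ex1I)
    have "cross (cross \<rho> \<tau>) w = 0" by (rule cross_cross) (use rho t in \<open>auto simp: Syz_def\<close>)
    then obtain h where h: "cross \<rho> \<tau> = smul h w" using w(3) unfolding Prim_def by blast
    have "cross \<rho> (\<tau> + smul (- h) \<rho>2) = 0"
      unfolding cross_add_right cross_smul_right c2 h by (simp add: smul_uminus_left)
    then have "cross (\<tau> + smul (- h) \<rho>2) \<rho> = 0" using cross_anti[of _ \<rho>] by simp
    then obtain p where "\<tau> + smul (- h) \<rho>2 = smul p \<rho>" using prho unfolding Prim_def by blast
    then have "\<tau> = smul p \<rho> + smul h \<rho>2" by (simp add: smul_uminus_left diff_eq_eq)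
    then show "\<exists>x. \<tau> = smul (fst x) \<rho> + smul (snd x) \<rho>2" by (intro exI[of _ "(p, h)"]) simp
  next
    fix x y assume x: "\<tau> = smul (fst x) \<rho> + smul (snd x) \<rho>2" and y: "\<tau> = smul (fst y) \<rho> + smul (snd y) \<rho>2"
    have "cross \<rho> \<tau> = smul (snd x) w" "cross \<rho> \<tau> = smul (snd y) w"
      by (subst x, simp add: cross_add_right cross_smul_right cz c2,
          subst y, simp add: cross_add_right cross_smul_right cz c2)
    then have "snd x = snd y" using smul_cancel w(2) by metis
    moreover from this have "smul (fst x) \<rho> = smul (fst y) \<rho>" using x y by simp
    then have "fst x = fst y" using smul_cancel rho(3) by metis
    ultimately show "x = y" by (simp add: prod_eq_iff)
  qed
  ultimately show ?thesis unfolding freeR_def using rho r2 by blast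
qed

theorem hilb_bound:
  assumes w: "hom3 e w" "w \<noteq> 0" "Prim w" and h: "\<forall>n\<ge>n1. hilb w n = h" and r0: "no_syz_below w r0"
  shows "r0 \<le> e" "int h \<le> (int e)\<^sup>2 - int r0 * (int e - int r0)"
    "int h = (int e)\<^sup>2 - int r0 * (int e - int r0) \<longleftrightarrow> r0 \<le> e - r0 \<and> freeR w r0 (e - r0)"
proof -
  obtain r \<rho> where m: "min_syz w r \<rho>" and re: "r \<le> e" using min_syz_exists[OF w(1,2)] by blast
  have r0r: "r0 \<le> r" using m r0 unfolding no_syz_below_def min_syz_def by (meson not_le)
  then show r0e: "r0 \<le> e" using re by simp
  \<comment> \<open>The exact formula holds in large degrees; as \<open>hilbI\<close> is monotone,
    it becomes an inequality in any degree \<open>m'\<close>.\<close>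
  have bd: "int h + int (hilbI w \<rho> m') \<le> (int e)\<^sup>2 - int r * (int e - int r)" for m'
  proof -
    define k where "k = n1 + m' + e + r"
    have "int (hilb w (e + k)) + int (hilbI w \<rho> (k + r - e)) = (int e)\<^sup>2 - int r * (int e - int r)"
      by (rule hilb_formula[OF w m]) (auto simp: k_def)
    moreover have "hilb w (e + k) = h" using h by (simp add: k_def)
    moreover have "hilbI w \<rho> m' \<le> hilbI w \<rho> (k + r - e)" by (rule hilbI_mono[OF w(1) m]) (simp add: k_def)
    ultimately show ?thesis by linarith
  qed
  \<comment> \<open>The direction from free to equality needs no bound: it is read off from the
    Hilbert function of a free syzygy module.\<close>
  have free_eq: "int h = (int e)\<^sup>2 - int r0 * (int e - int r0)" if "freeR w r0 (e - r0)"
    using freeR_exponents(2)[OF w that h] r0e by (simp add: of_nat_diff)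
  show "int h \<le> (int e)\<^sup>2 - int r0 * (int e - int r0)"
    "int h = (int e)\<^sup>2 - int r0 * (int e - int r0) \<longleftrightarrow> r0 \<le> e - r0 \<and> freeR w r0 (e - r0)"
  proof -
    have "int h \<le> (int e)\<^sup>2 - int r0 * (int e - int r0) \<and>
      (int h = (int e)\<^sup>2 - int r0 * (int e - int r0) \<longrightarrow> r0 \<le> e - r0 \<and> freeR w r0 (e - r0))"
    proof (cases "2 * r \<le> e")
      case True
      \<comment> \<open>For \<open>r0 \<le> r \<le> e / 2\<close> both factors on the right are
        nonnegative, so \<open>r * (e - r)\<close> is monotone in this range.\<close>
      have d: "int r * (int e - int r) - int r0 * (int e - int r0) = (int r - int r0) * (int e - int r - int r0)"
        by (simp add: algebra_simps)
      have p: "0 \<le> (int r - int r0) * (int e - int r - int r0)" using True r0r by (intro mult_nonneg_nonneg) auto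
      have le: "int h \<le> (int e)\<^sup>2 - int r0 * (int e - int r0)" using bd[of 0] d p by linarith
      have "r0 \<le> e - r0 \<and> freeR w r0 (e - r0)" if eq: "int h = (int e)\<^sup>2 - int r0 * (int e - int r0)"
      proof -
        have "(int r - int r0) * (int e - int r - int r0) = 0" using bd[of 0] d p eq by linarith
        \<comment> \<open>If the second factor vanishes, then
          \<open>e = r + r0 \<le> 2 * r \<le> e\<close>, which again gives
          \<open>r = r0\<close>.\<close>
        then have rr: "r = r0" using True r0r by auto
        then have "hilbI w \<rho> 0 = 0" using bd[of 0] eq by simp
        then have "Sn 0 \<subseteq> quot_ideal w \<rho> \<inter> Sn 0"
          using VR.qdim_eq_0_iff[OF fin_quot_Sn[OF subspace_quot_ideal] subspace_Int_Sn[OF subspace_quot_ideal]]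
          unfolding hilbI_def by blast
        then have "1 \<in> quot_ideal w \<rho>" using hom_1 by (auto simp: Sn_def)
        from freeI[OF w m re this] rr True show ?thesis by auto
      qed
      then show ?thesis using le by blast
    next
      case False
      \<comment> \<open>The degree of a multiplier coming from a syzygy of degree
        \<open>r - 1\<close>, the last degree without nonzero syzygies.\<close>
      define n where "n = 2 * r - e - 1"
      have n: "int n = 2 * int r - int e - 1" using False by (simp add: n_def of_nat_diff)
      have "quot_ideal w \<rho> \<inter> Sn n = {0}"
        by (rule quot_ideal_low_degree[OF w(1,2) m, of "r - 1"]) (use False re in \<open>auto simp: n_def\<close>)
      then have "hilbI w \<rho> n = dimS n" by (simp add: hilbI_def dimS_def)
      then have "2 * int h + 2 * int (dimS n) \<le> 2 * ((int e)\<^sup>2 - int r * (int e - int r))"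
        using bd[of n] by simp
      then have "2 * int h + (int n + 1) * (int n + 2) \<le> 2 * ((int e)\<^sup>2 - int r * (int e - int r))"
        unfolding dimS_int .
      then have "2 * int h + (2 * int r - int e) * (2 * int r - int e + 1) \<le> 2 * ((int e)\<^sup>2 - int r * (int e - int r))"
        unfolding n by (simp add: add.commute)
      \<comment> \<open>Completing squares on both sides: up to the factor 4, \<open>h\<close> stays
        below \<open>3 * e^2\<close>, while the claimed bound is \<open>3 * e^2\<close> plus the
        square of \<open>e - 2 * r0\<close>.\<close>
      then have 1: "4 * int h \<le> 4 * (int e)\<^sup>2 - ((int e)\<^sup>2 + (2 * int r - int e)\<^sup>2 + 2 * (2 * int r - int e))"
        by (simp add: algebra_simps power2_eq_square)
      have 2: "4 * (int r0 * (int e - int r0)) = (int e)\<^sup>2 - (int e - 2 * int r0)\<^sup>2"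
        by (simp add: algebra_simps power2_eq_square)
      have 3: "2 * (2 * int r - int e) > 0" using False by auto
      have "(2 * int r - int e)\<^sup>2 \<ge> 0" "(int e - 2 * int r0)\<^sup>2 \<ge> 0" by simp_all
      then have "int h < (int e)\<^sup>2 - int r0 * (int e - int r0)" using 1 2 3 by linarith
      then show ?thesis by linarith
    qed
    then show "int h \<le> (int e)\<^sup>2 - int r0 * (int e - int r0)"
      "int h = (int e)\<^sup>2 - int r0 * (int e - int r0) \<longleftrightarrow> r0 \<le> e - r0 \<and> freeR w r0 (e - r0)"
      using free_eq by blast+
  qed
qed

section \<open>Translation between polynomial mappings and the iterated ring\<close>

definition grad :: "mpoly \<Rightarrow> R3" where
  "grad f = (\<Phi> (fx f), \<Phi> (fy f), \<Phi> (fz f))"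

lemma in_S_partials: "in_S f \<Longrightarrow> in_S (fx f) \<and> in_S (fy f) \<and> in_S (fz f)"
  by (simp add: fx_def fy_def fz_def in_S_pderiv)

lemma hom3_grad: "in_S f \<Longrightarrow> homog d f \<Longrightarrow> d \<ge> 1 \<Longrightarrow> hom3 (d - 1) (grad f)"
  using in_S_partials[of f] homog_pderiv[of "d - 1" f]
  by (auto simp: grad_def hom_\<Phi>) (auto simp: fx_def fy_def fz_def)

lemma grad_Prim:
  assumes "in_S f" "homog d f" "f \<noteq> 0" "d \<ge> 1" "reduced f"
  shows "grad f \<noteq> 0" "Prim (grad f)"
proof -
  note c = reduced_partials_coprime[OF assms, folded fx_def fy_def fz_def]
  show n: "grad f \<noteq> 0"
  proof
    assume "grad f = 0"
    then have "is_unit (0 :: R)" by (intro c) (auto simp: grad_def zero_triple)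
    then show False by simp
  qed
  show "Prim (grad f)" unfolding grad_def by (rule PrimI[OF n[unfolded grad_def] c])
qed

fun \<Phi>3 :: "mpoly \<times> mpoly \<times> mpoly \<Rightarrow> R3" where "\<Phi>3 (a, b, c) = (\<Phi> a, \<Phi> b, \<Phi> c)"
fun \<Psi>3 :: "R3 \<Rightarrow> mpoly \<times> mpoly \<times> mpoly" where "\<Psi>3 (a, b, c) = (\<Psi> a, \<Psi> b, \<Psi> c)"
fun in_S3 :: "mpoly \<times> mpoly \<times> mpoly \<Rightarrow> bool" where "in_S3 (a, b, c) \<longleftrightarrow> in_S a \<and> in_S b \<and> in_S c"

lemma \<Phi>3_\<Psi>3: "\<Phi>3 (\<Psi>3 v) = v" and in_S3_\<Psi>3: "in_S3 (\<Psi>3 v)"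
  by (cases v; simp add: \<Phi>_\<Psi> in_S_\<Psi>)+

lemma \<Phi>3_inject: "in_S3 u \<Longrightarrow> in_S3 v \<Longrightarrow> \<Phi>3 u = \<Phi>3 v \<longleftrightarrow> u = v"
  by (cases u; cases v) (simp add: \<Phi>_inject)

lemma AR_iff:
  assumes f: "in_S f"
  shows "\<rho> \<in> AR f \<longleftrightarrow> in_S3 \<rho> \<and> \<Phi>3 \<rho> \<in> Syz (grad f)"
proof -
  obtain a b c where r: "\<rho> = (a, b, c)" by (metis prod.exhaust)
  show ?thesis
  proof (cases "in_S3 \<rho>")
    case True
    then have S: "in_S (a * fx f + b * fy f + c * fz f)" using in_S_partials[OF f] r by (simp add: in_S_add in_S_mult)
    have "\<Phi> (a * fx f + b * fy f + c * fz f) = dot (\<Phi>3 \<rho>) (grad f)" by (simp add: r grad_def \<Phi>_add \<Phi>_mult)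
    then show ?thesis using True \<Phi>_eq_0_iff[OF S] r by (simp add: AR_def Syz_def)
  qed (auto simp: AR_def r)
qed

lemma homog3_iff: "in_S3 \<rho> \<Longrightarrow> homog3 r \<rho> \<longleftrightarrow> hom3 r (\<Phi>3 \<rho>)"
  by (cases \<rho>) (simp add: homog3_def hom_\<Phi>)

lemma \<Phi>3_0: "in_S3 \<rho> \<Longrightarrow> \<Phi>3 \<rho> = 0 \<longleftrightarrow> \<rho> = (0, 0, 0)"
  by (cases \<rho>) (simp add: zero_triple \<Phi>_eq_0_iff)

lemma AR_transfer:
  assumes f: "in_S f"
  shows "(\<exists>\<rho>\<in>AR f. P (\<Phi>3 \<rho>)) \<longleftrightarrow> (\<exists>\<sigma>\<in>Syz (grad f). P \<sigma>)" "(\<forall>\<rho>\<in>AR f. P (\<Phi>3 \<rho>)) \<longleftrightarrow> (\<forall>\<sigma>\<in>Syz (grad f). P \<sigma>)"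
proof -
  have 1: "\<Phi>3 \<rho> \<in> Syz (grad f)" if "\<rho> \<in> AR f" for \<rho> using AR_iff[OF f] that by blast
  have 2: "\<Psi>3 \<sigma> \<in> AR f" if "\<sigma> \<in> Syz (grad f)" for \<sigma>
    unfolding AR_iff[OF f] \<Phi>3_\<Psi>3 using that in_S3_\<Psi>3 by blast
  show "(\<exists>\<rho>\<in>AR f. P (\<Phi>3 \<rho>)) \<longleftrightarrow> (\<exists>\<sigma>\<in>Syz (grad f). P \<sigma>)"
  proof
    assume "\<exists>\<sigma>\<in>Syz (grad f). P \<sigma>"
    then obtain \<sigma> where "\<sigma> \<in> Syz (grad f)" "P \<sigma>" by blast
    then show "\<exists>\<rho>\<in>AR f. P (\<Phi>3 \<rho>)" using 2 by (intro bexI[of _ "\<Psi>3 \<sigma>"]) (simp_all add: \<Phi>3_\<Psi>3)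
  qed (use 1 in blast)
  show "(\<forall>\<rho>\<in>AR f. P (\<Phi>3 \<rho>)) \<longleftrightarrow> (\<forall>\<sigma>\<in>Syz (grad f). P \<sigma>)"
  proof
    assume a: "\<forall>\<rho>\<in>AR f. P (\<Phi>3 \<rho>)"
    show "\<forall>\<sigma>\<in>Syz (grad f). P \<sigma>"
    proof
      fix \<sigma> assume "\<sigma> \<in> Syz (grad f)"
      from a[rule_format, OF 2[OF this]] show "P \<sigma>" by (simp add: \<Phi>3_\<Psi>3)
    qed
  qed (use 1 in blast)
qed

lemma no_syz_below_mdr:
  assumes f: "in_S f" and r: "r \<le> mdr f"
  shows "no_syz_below (grad f) r"
  unfolding no_syz_below_def
proof (intro allI impI ballI, rule ccontr)
  fix k \<sigma> assume k: "k < r" and s: "\<sigma> \<in> Syz (grad f)" "hom3 k \<sigma>" "\<sigma> \<noteq> 0"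
  have "\<Psi>3 \<sigma> \<in> AR f" using AR_iff[OF f] s by (simp add: \<Phi>3_\<Psi>3 in_S3_\<Psi>3)
  moreover have "homog3 k (\<Psi>3 \<sigma>)" using homog3_iff[OF in_S3_\<Psi>3] s by (simp add: \<Phi>3_\<Psi>3)
  moreover have "\<Psi>3 \<sigma> \<noteq> (0, 0, 0)" using \<Phi>3_0[OF in_S3_\<Psi>3, of \<sigma>] s by (simp add: \<Phi>3_\<Psi>3)
  ultimately have "mdr f \<le> k" unfolding mdr_def by (intro Least_le) blast
  then show False using k r by simp
qed

lemma lincomb3_\<Phi>3: "\<Phi>3 (lincomb3 p \<rho>1 q \<rho>2) = smul (\<Phi> p) (\<Phi>3 \<rho>1) + smul (\<Phi> q) (\<Phi>3 \<rho>2)"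
  by (cases \<rho>1; cases \<rho>2) (simp add: lincomb3_def \<Phi>_add \<Phi>_mult)

lemma in_S3_lincomb3: "in_S p \<Longrightarrow> in_S q \<Longrightarrow> in_S3 \<rho>1 \<Longrightarrow> in_S3 \<rho>2 \<Longrightarrow> in_S3 (lincomb3 p \<rho>1 q \<rho>2)"
  by (cases \<rho>1; cases \<rho>2) (simp add: lincomb3_def in_S_add in_S_mult)

text \<open>\<open>\<Phi>\<close> is a bijection from \<open>in_S\<close> onto \<open>R\<close>, so
  unique existence of the coefficients transfers in both directions; membership in
  \<open>in_S\<close> becomes vacuous on the other side.\<close>

lemma lincomb3_unique:
  assumes S: "in_S3 \<rho>1" "in_S3 \<rho>2" "in_S3 \<rho>"
  shows "(\<exists>!(p, q). in_S p \<and> in_S q \<and> \<rho> = lincomb3 p \<rho>1 q \<rho>2)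
    \<longleftrightarrow> (\<exists>!x. \<Phi>3 \<rho> = smul (fst x) (\<Phi>3 \<rho>1) + smul (snd x) (\<Phi>3 \<rho>2))" (is "(\<exists>!x. ?P x) \<longleftrightarrow> (\<exists>!x. ?Q x)")
proof -
  have 1: "?Q (\<Phi> p, \<Phi> q) \<longleftrightarrow> ?P (p, q)" if "in_S p" "in_S q" for p q
    using that \<Phi>3_inject[OF S(3) in_S3_lincomb3[OF that S(1,2)]] by (simp add: lincomb3_\<Phi>3)
  have 2: "?P x \<Longrightarrow> in_S (fst x) \<and> in_S (snd x)" for x by (auto split: prod.splits)
  have 3: "?P x \<longleftrightarrow> in_S (fst x) \<and> in_S (snd x) \<and> ?Q (\<Phi> (fst x), \<Phi> (snd x))" for x
    by (cases x, hypsubst, simp only: fst_conv snd_conv) (use 1 in \<open>auto\<close>)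
  show ?thesis
  proof
    assume "\<exists>!x. ?P x"
    then obtain x where x: "?P x" "\<And>y. ?P y \<Longrightarrow> y = x" by blast
    show "\<exists>!x. ?Q x"
    proof (rule ex1I[of _ "(\<Phi> (fst x), \<Phi> (snd x))"])
      show "?Q (\<Phi> (fst x), \<Phi> (snd x))" using x 3 by blast
      fix y assume "?Q y"
      then have "?P (\<Psi> (fst y), \<Psi> (snd y))" unfolding 3 by (simp add: in_S_\<Psi> \<Phi>_\<Psi>)
      from x(2)[OF this, symmetric] show "y = (\<Phi> (fst x), \<Phi> (snd x))" by (simp add: \<Phi>_\<Psi>)
    qed
  next
    assume "\<exists>!x. ?Q x"
    then obtain x where x: "?Q x" "\<And>y. ?Q y \<Longrightarrow> y = x" by blast
    show "\<exists>!x. ?P x"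
    proof (rule ex1I[of _ "(\<Psi> (fst x), \<Psi> (snd x))"])
      show "?P (\<Psi> (fst x), \<Psi> (snd x))" unfolding 3 using x by (simp add: in_S_\<Psi> \<Phi>_\<Psi>)
      fix y assume "?P y"
      then have y: "in_S (fst y)" "in_S (snd y)" "?Q (\<Phi> (fst y), \<Phi> (snd y))" using 3 by blast+
      from x(2)[OF y(3), symmetric] show "y = (\<Psi> (fst x), \<Psi> (snd x))" using y(1,2) by (simp add: \<Psi>_\<Phi>)
    qed
  qed
qed

lemma free_exps_iff:
  assumes f: "in_S f"
  shows "free_exps f d1 d2 \<longleftrightarrow> d1 \<le> d2 \<and> freeR (grad f) d1 d2"
proof -
  have S: "in_S3 \<rho>" if "\<rho> \<in> AR f" for \<rho> using that AR_iff[OF f] by blast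
  have 1: "(\<forall>\<rho>\<in>AR f. \<exists>!(p, q). in_S p \<and> in_S q \<and> \<rho> = lincomb3 p \<rho>1 q \<rho>2)
    \<longleftrightarrow> (\<forall>\<sigma>\<in>Syz (grad f). \<exists>!x. \<sigma> = smul (fst x) (\<Phi>3 \<rho>1) + smul (snd x) (\<Phi>3 \<rho>2))"
    if "\<rho>1 \<in> AR f" "\<rho>2 \<in> AR f" for \<rho>1 \<rho>2
    unfolding AR_transfer(2)[OF f, symmetric]
    by (intro ball_cong refl lincomb3_unique S that)
  have 2: "homog3 d \<rho> \<and> \<rho> \<noteq> (0, 0, 0) \<longleftrightarrow> hom3 d (\<Phi>3 \<rho>) \<and> \<Phi>3 \<rho> \<noteq> 0" if "\<rho> \<in> AR f" for \<rho> d
    using homog3_iff[OF S[OF that]] \<Phi>3_0[OF S[OF that]] by blast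
  show ?thesis
    unfolding free_exps_def freeR_def AR_transfer(1)[OF f, symmetric]
  proof (rule conj_cong[OF refl], rule bex_cong[OF refl], rule bex_cong[OF refl])
    fix \<rho>1 \<rho>2 assume r: "\<rho>1 \<in> AR f" "\<rho>2 \<in> AR f"
    show "(homog3 d1 \<rho>1 \<and> \<rho>1 \<noteq> (0, 0, 0) \<and> homog3 d2 \<rho>2 \<and> \<rho>2 \<noteq> (0, 0, 0) \<and>
        (\<forall>\<rho>\<in>AR f. \<exists>!(p, q). in_S p \<and> in_S q \<and> \<rho> = lincomb3 p \<rho>1 q \<rho>2))
      = (hom3 d1 (\<Phi>3 \<rho>1) \<and> \<Phi>3 \<rho>1 \<noteq> 0 \<and> hom3 d2 (\<Phi>3 \<rho>2) \<and> \<Phi>3 \<rho>2 \<noteq> 0 \<and>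
        (\<forall>\<sigma>\<in>Syz (grad f). \<exists>!x. \<sigma> = smul (fst x) (\<Phi>3 \<rho>1) + smul (snd x) (\<Phi>3 \<rho>2)))"
      unfolding 1[OF r] using 2[OF r(1), of d1] 2[OF r(2), of d2] by argo
  qed
qed

lemma gen_ideal_iff:
  assumes G: "\<And>g. g \<in> G \<Longrightarrow> in_S g" and p: "in_S p"
  shows "p \<in> gen_ideal G \<longleftrightarrow> \<Phi> p \<in> genR (\<Phi> ` G)"
proof
  assume "p \<in> gen_ideal G"
  then obtain F c where F: "finite F" "F \<subseteq> G" "\<forall>g\<in>F. in_S (c g)" "p = (\<Sum>g\<in>F. c g * g)" unfolding gen_ideal_def by blast
  have "\<Phi> p = (\<Sum>g\<in>F. \<Phi> (c g) * \<Phi> g)" unfolding F(4) \<Phi>_sum \<Phi>_mult ..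
  also have "\<dots> \<in> genR (\<Phi> ` G)"
    using F(2) by (intro idl_sum[OF idl_genR] idl_mult[OF idl_genR] genR_base) auto
  finally show "\<Phi> p \<in> genR (\<Phi> ` G)" .
next
  assume "\<Phi> p \<in> genR (\<Phi> ` G)"
  then obtain F c where F: "finite F" "F \<subseteq> \<Phi> ` G" "\<Phi> p = (\<Sum>g\<in>F. c g * g)" unfolding genR_def by blast
  have inj: "inj_on \<Psi> F" by (rule inj_onI) (metis \<Phi>_\<Psi>)
  have FG: "\<Psi> ` F \<subseteq> G"
  proof (rule image_subsetI)
    fix x assume "x \<in> F"
    then obtain g where "g \<in> G" "x = \<Phi> g" using F(2) by blast
    then show "\<Psi> x \<in> G" using \<Psi>_\<Phi>[OF G] by simp
  qed
  let ?c = "\<lambda>g. \<Psi> (c (\<Phi> g))"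
  have "\<Phi> (\<Sum>g\<in>\<Psi> ` F. ?c g * g) = \<Phi> p"
    unfolding sum.reindex[OF inj] F(3) by (simp add: \<Phi>_sum \<Phi>_mult \<Phi>_\<Psi>)
  moreover have "in_S (\<Sum>g\<in>\<Psi> ` F. ?c g * g)" by (intro in_S_sum in_S_mult in_S_\<Psi>) (use in_S_\<Psi> in auto)
  ultimately have "(\<Sum>g\<in>\<Psi> ` F. ?c g * g) = p" using \<Phi>_inject[OF _ p] by blast
  then show "p \<in> gen_ideal G"
    unfolding gen_ideal_def using F(1) FG in_S_\<Psi>
    by (intro CollectI exI[of _ "\<Psi> ` F"] exI[of _ ?c] conjI finite_imageI) simp_all
qed

lemma codim_eq_qdim:
  assumes G: "\<And>g. g \<in> G \<Longrightarrow> in_S g"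
  shows "codim (gen_ideal G) = VR.qdim UNIV (genR (\<Phi> ` G))"
proof -
  let ?I = "genR (\<Phi> ` G)"
  have sI: "VR.subspace ?I" by (rule subspace_idl[OF idl_genR])
  have key: "p - (\<Sum>b\<in>B. const (c b) * b) \<in> gen_ideal G \<longleftrightarrow> \<Phi> p - (\<Sum>b\<in>B. K (c b) * \<Phi> b) \<in> ?I"
    if "in_S p" "\<forall>b\<in>B. in_S b" for p B c
  proof -
    have "in_S (p - (\<Sum>b\<in>B. const (c b) * b))" using that by (intro in_S_diff in_S_sum in_S_mult in_S_const) auto
    from gen_ideal_iff[OF G this] show ?thesis by (simp add: \<Phi>_diff \<Phi>_sum \<Phi>_mult \<Phi>_const)
  qed
  have "(\<exists>B. finite B \<and> card B = n \<and> (\<forall>b\<in>B. in_S b) \<and>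
       (\<forall>p. in_S p \<longrightarrow> (\<exists>c. p - (\<Sum>b\<in>B. const (c b) * b) \<in> gen_ideal G)))
    \<longleftrightarrow> (\<exists>C. VR.spans_mod UNIV ?I C \<and> card C = n)" for n
  proof
    assume "\<exists>B. finite B \<and> card B = n \<and> (\<forall>b\<in>B. in_S b) \<and>
       (\<forall>p. in_S p \<longrightarrow> (\<exists>c. p - (\<Sum>b\<in>B. const (c b) * b) \<in> gen_ideal G))"
    then obtain B where B: "finite B" "card B = n" "\<forall>b\<in>B. in_S b"
      "\<forall>p. in_S p \<longrightarrow> (\<exists>c. p - (\<Sum>b\<in>B. const (c b) * b) \<in> gen_ideal G)" by blast
    have inj: "inj_on \<Phi> B" using inj_on_\<Phi> by (rule inj_on_subset) (use B in auto)
    have "\<exists>a. v - (\<Sum>c\<in>\<Phi> ` B. K (a c) * c) \<in> ?I" for v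
    proof -
      obtain c where "\<Psi> v - (\<Sum>b\<in>B. const (c b) * b) \<in> gen_ideal G" using B(4) in_S_\<Psi> by blast
      then have "v - (\<Sum>b\<in>B. K (c b) * \<Phi> b) \<in> ?I" using key[OF in_S_\<Psi> B(3)] by (simp add: \<Phi>_\<Psi>)
      moreover have "(\<Sum>b\<in>B. K (c b) * \<Phi> b) = (\<Sum>x\<in>\<Phi> ` B. K (c (\<Psi> x)) * x)"
        unfolding sum.reindex[OF inj] using B(3) by (intro sum.cong refl) (simp add: \<Psi>_\<Phi>)
      ultimately show ?thesis by auto
    qed
    then have "VR.spans_mod UNIV ?I (\<Phi> ` B)"
      unfolding VR.spans_mod_def using VR.spans_mod_iff[OF sI, of "\<Phi> ` B" UNIV] B(1) by auto
    then show "\<exists>C. VR.spans_mod UNIV ?I C \<and> card C = n" using card_image[OF inj] B(2) by blast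
  next
    assume "\<exists>C. VR.spans_mod UNIV ?I C \<and> card C = n"
    then obtain C where C: "VR.spans_mod UNIV ?I C" "card C = n" by blast
    then have fC: "finite C" unfolding VR.spans_mod_def by blast
    have inj: "inj_on \<Psi> C" by (rule inj_onI) (metis \<Phi>_\<Psi>)
    have "\<exists>c. p - (\<Sum>b\<in>\<Psi> ` C. const (c b) * b) \<in> gen_ideal G" if p: "in_S p" for p
    proof -
      obtain a where a: "\<Phi> p - (\<Sum>c\<in>C. K (a c) * c) \<in> ?I"
        using VR.spans_mod_iff[OF sI fC, of UNIV] C(1) unfolding VR.spans_mod_def by blast
      have "(\<Sum>c\<in>C. K (a c) * c) = (\<Sum>b\<in>\<Psi> ` C. K (a (\<Phi> b)) * \<Phi> b)"
        unfolding sum.reindex[OF inj] by (simp add: \<Phi>_\<Psi>)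
      then have "p - (\<Sum>b\<in>\<Psi> ` C. const (a (\<Phi> b)) * b) \<in> gen_ideal G"
        using a key[OF p, of "\<Psi> ` C" "\<lambda>b. a (\<Phi> b)"] in_S_\<Psi> by auto
      then show ?thesis by (intro exI[of _ "\<lambda>b. a (\<Phi> b)"])
    qed
    then show "\<exists>B. finite B \<and> card B = n \<and> (\<forall>b\<in>B. in_S b) \<and>
       (\<forall>p. in_S p \<longrightarrow> (\<exists>c. p - (\<Sum>b\<in>B. const (c b) * b) \<in> gen_ideal G))"
      using fC C(2) card_image[OF inj] in_S_\<Psi> by (intro exI[of _ "\<Psi> ` C"]) auto
  qed
  then show ?thesis unfolding codim_def VR.qdim_def by simp
qed

lemma sing_pts_eq: "in_S f \<Longrightarrow> sing_pts f = zeros (grad f)"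
  using in_S_partials[of f] by (auto simp: sing_pts_def zeros_def vanish_def grad_def ev3_\<Phi>[unfolded One_nat_def])

lemma codim_loc:
  assumes f: "in_S f" "hom3 e (grad f)" and a: "a \<in> proj_pts"
  shows "codim (gen_ideal ({fx f, fy f, fz f, Var (chart a) - 1} \<union> Mpow a N))
    = VR.qdim UNIV (loc (grad f) a (vars3 (chart a)) N)"
proof -
  let ?G = "{fx f, fy f, fz f, Var (chart a) - 1} \<union> Mpow a N" and ?l = "vars3 (chart a)"
  let ?w = "grad f"
  have S: "in_S g" if "g \<in> ?G" for g
    using that in_S_partials[OF f(1)] proj_pts_chart(1)[OF a]
    by (auto simp: Mpow_def intro!: in_S_mult in_S_power in_S_diff in_S_Var in_S_const in_S_1)
  have J: "idl (Jac ?w)" by (rule hidl_idl[OF hidl_Jac[OF f(2)]])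
  note J1 = idl_isum[OF J idl_prin[of "?l - 1"]]
  have img: "\<Phi> ((Var 0 - const (a 0))^i * (Var 1 - const (a 1))^j * (Var 2 - const (a 2))^k)
    = (X - K (a 0)) ^ i * (Y - K (a 1)) ^ j * (Z - K (a 2)) ^ k" for i j k
    by (simp add: \<Phi>_mult \<Phi>_power \<Phi>_diff \<Phi>_Var \<Phi>_const vars3_def)
  have "genR (\<Phi> ` ?G) = loc ?w a ?l N"
    unfolding loc_eq[OF f(2)]
  proof
    let ?L = "isum (isum (Jac ?w) (prin (?l - 1))) (mpt (a 0) (a 1) (a 2) N)"
    have iL: "idl ?L" by (rule idl_isum[OF J1 idl_mpt])
    have "u * \<Phi> (fx f) + v * \<Phi> (fy f) + z * \<Phi> (fz f) \<in> Jac ?w" for u v z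
      unfolding Jac_def grad_def by (auto intro: exI[of _ u] exI[of _ v] exI[of _ z])
    from this[of 1 0 0] this[of 0 1 0] this[of 0 0 1]
    have j: "\<Phi> (fx f) \<in> Jac ?w" "\<Phi> (fy f) \<in> Jac ?w" "\<Phi> (fz f) \<in> Jac ?w" by auto
    have JL: "x \<in> ?L" if "x \<in> Jac ?w" for x by (rule isum_left[OF idl_mpt isum_left[OF idl_prin that]])
    note 1 = JL[OF j(1)] JL[OF j(2)] JL[OF j(3)]
    have "\<Phi> (Var (chart a) - 1) = ?l - 1" by (simp add: \<Phi>_diff \<Phi>_Var \<Phi>_1)
    moreover have "?l - 1 \<in> prin (?l - 1)" unfolding prin_def by (auto intro: exI[of _ 1])
    ultimately have 2: "\<Phi> (Var (chart a) - 1) \<in> ?L"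
      using isum_left[OF idl_mpt isum_right[OF J]] by auto
    have 3: "\<Phi> g \<in> ?L" if "g \<in> Mpow a N" for g
    proof -
      obtain i j k where g: "g = (Var 0 - const (a 0))^i * (Var 1 - const (a 1))^j * (Var 2 - const (a 2))^k"
        and N: "i + j + k = N" using \<open>g \<in> Mpow a N\<close> unfolding Mpow_def by blast
      show ?thesis unfolding g img mpt_def by (rule isum_right[OF J1 Mp_base[OF N]])
    qed
    show "genR (\<Phi> ` ?G) \<subseteq> ?L" by (rule genR_least[OF iL]) (use 1 2 3 in auto)
    note iG = idl_genR[of "\<Phi> ` ?G"]
    have g: "\<Phi> g \<in> genR (\<Phi> ` ?G)" if "g \<in> ?G" for g by (rule genR_base) (use that in blast)
    have "Jac ?w \<subseteq> genR (\<Phi> ` ?G)"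
    proof
      fix p assume "p \<in> Jac ?w"
      then obtain u v z where "p = dot (u, v, z) ?w" unfolding Jac_def by auto
      then have "p = u * \<Phi> (fx f) + v * \<Phi> (fy f) + z * \<Phi> (fz f)" by (simp add: grad_def)
      moreover have "u * \<Phi> (fx f) + v * \<Phi> (fy f) + z * \<Phi> (fz f) \<in> genR (\<Phi> ` ?G)"
        by (intro idl_add[OF iG] idl_mult[OF iG] g) auto
      ultimately show "p \<in> genR (\<Phi> ` ?G)" by simp
    qed
    moreover have "prin (?l - 1) \<subseteq> genR (\<Phi> ` ?G)"
      unfolding prin_def using idl_mult'[OF iG g[of "Var (chart a) - 1"]] by (auto simp: \<Phi>_diff \<Phi>_Var \<Phi>_1)
    moreover have "mpt (a 0) (a 1) (a 2) N \<subseteq> genR (\<Phi> ` ?G)"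
      unfolding mpt_def
    proof (rule Mp_least[OF iG])
      fix i j k assume "i + j + k = N"
      then show "(X - K (a 0)) ^ i * (Y - K (a 1)) ^ j * (Z - K (a 2)) ^ k \<in> genR (\<Phi> ` ?G)"
        unfolding img[symmetric] by (intro g) (auto simp: Mpow_def)
    qed
    ultimately show "?L \<subseteq> genR (\<Phi> ` ?G)" by (intro isum_subset[OF iG])
  qed
  then show ?thesis using codim_eq_qdim[of ?G] S by simp
qed

theorem tjurina_eq_hilb:
  assumes f: "in_S f" "hom3 e (grad f)" and fin: "finite (zeros (grad f))"
  shows "\<exists>n1. \<forall>n\<ge>n1. hilb (grad f) n = tjurina f"
proof -
  obtain h n1 c N1 where h: "\<forall>n\<ge>n1. hilb (grad f) n = h" "(\<Sum>a\<in>zeros (grad f). c a) = h"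
    and c: "\<And>a N. a \<in> zeros (grad f) \<Longrightarrow> N \<ge> N1 \<Longrightarrow> VR.qdim UNIV (loc (grad f) a (vars3 (chart a)) N) = c a"
    using local_multiplicities[OF f(2) fin] by blast
  have "loc_tjurina f a = c a" if a: "a \<in> zeros (grad f)" for a
  proof -
    have ap: "a \<in> proj_pts" using a by (simp add: zeros_def)
    show ?thesis
      unfolding loc_tjurina_def codim_loc[OF f ap]
    proof (rule the_equality)
      show "\<exists>N0. \<forall>N\<ge>N0. VR.qdim UNIV (loc (grad f) a (vars3 (chart a)) N) = c a" using c[OF a] by blast
      fix t assume "\<exists>N0. \<forall>N\<ge>N0. VR.qdim UNIV (loc (grad f) a (vars3 (chart a)) N) = t"
      then obtain N0 where N0: "\<forall>N\<ge>N0. VR.qdim UNIV (loc (grad f) a (vars3 (chart a)) N) = t" by blast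
      show "t = c a" using N0[rule_format, of "max N0 N1"] c[OF a, of "max N0 N1"] by simp
    qed
  qed
  then have "tjurina f = h" unfolding tjurina_def sing_pts_eq[OF f(1)] using h(2) by simp
  then show ?thesis using h(1) by blast
qed

lemma reduced_tjurina:
  assumes f: "in_S f" "homog d f" "f \<noteq> 0" "d \<ge> 1" "reduced f"
  shows "\<exists>n1. \<forall>n\<ge>n1. hilb (grad f) n = tjurina f"
proof -
  note w = hom3_grad[OF f(1,2,4)] grad_Prim[OF f]
  obtain B where "\<forall>n\<ge>3 * (d - 1). hilb (grad f) n \<le> B" using hilb_bounded[OF w] by blast
  then show ?thesis using tjurina_eq_hilb[OF f(1) w(1)] finite_zeros[OF w(1)] by blast
qed

lemma tjurina_bound:
  assumes f: "in_S f" "homog d f" "f \<noteq> 0" "d \<ge> 1" "reduced f" and r0: "no_syz_below (grad f) r0"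
  shows "r0 \<le> d - 1" "int (tjurina f) \<le> (int d - 1)^2 - int r0 * (int d - int r0 - 1)"
    "int (tjurina f) = (int d - 1)^2 - int r0 * (int d - int r0 - 1) \<longleftrightarrow> free_exps f r0 (d - r0 - 1)"
proof -
  note w = hom3_grad[OF f(1,2,4)] grad_Prim[OF f]
  obtain n1 where n1: "\<forall>n\<ge>n1. hilb (grad f) n = tjurina f" using reduced_tjurina[OF f] by blast
  note b = hilb_bound[OF w n1 r0]
  show "r0 \<le> d - 1" by (rule b(1))
  have e: "int (d - 1) = int d - 1" using f(4) by simp
  have e': "d - 1 - r0 = d - r0 - 1" by simp
  show "int (tjurina f) \<le> (int d - 1)^2 - int r0 * (int d - int r0 - 1)"
    using b(2) unfolding e by (simp add: algebra_simps)
  show "int (tjurina f) = (int d - 1)^2 - int r0 * (int d - int r0 - 1) \<longleftrightarrow> free_exps f r0 (d - r0 - 1)"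
    using b(3) unfolding e e' free_exps_iff[OF f(1)] by (simp add: algebra_simps)
qed

lemma free_criterion:
  assumes f: "in_S f" "homog d f" "f \<noteq> 0" "d \<ge> 1" "reduced f"
  shows "is_free f \<longleftrightarrow> (\<exists>r0. 2 * r0 \<le> d - 1 \<and> int (tjurina f) = (int d - 1)^2 - int r0 * (int d - int r0 - 1)
    \<and> no_syz_below (grad f) r0)"
proof
  note w = hom3_grad[OF f(1,2,4)] grad_Prim[OF f]
  obtain n1 where n1: "\<forall>n\<ge>n1. hilb (grad f) n = tjurina f" using reduced_tjurina[OF f] by blast
  assume "is_free f"
  then obtain d1 d2 where d: "d1 \<le> d2" "freeR (grad f) d1 d2"
    unfolding is_free_def free_exps_iff[OF f(1)] by blast
  note x = freeR_exponents[OF w d(2) n1]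
  have "int d - int d1 - 1 = int d2" using x(1) f(4) by linarith
  moreover have "int (d - 1) = int d - 1" using f(4) by simp
  ultimately have "int (tjurina f) = (int d - 1)^2 - int d1 * (int d - int d1 - 1)" using x(2) by simp
  then show "\<exists>r0. 2 * r0 \<le> d - 1 \<and> int (tjurina f) = (int d - 1)^2 - int r0 * (int d - int r0 - 1)
    \<and> no_syz_below (grad f) r0"
    using freeR_dimSyz(2)[OF w(1) d(2,1)] x(1) d(1) by (intro exI[of _ d1]) auto
next
  assume "\<exists>r0. 2 * r0 \<le> d - 1 \<and> int (tjurina f) = (int d - 1)^2 - int r0 * (int d - int r0 - 1)
    \<and> no_syz_below (grad f) r0"
  then show "is_free f" using tjurina_bound(3)[OF f] unfolding is_free_def by blast
qed

section \<open>The locus of free curves\<close>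

lemma mvars_subset_iff: "mvars p \<subseteq> V \<longleftrightarrow> (\<forall>m\<in>keys p. keys m \<subseteq> V)"
  by (auto simp: mvars_def)

lemma mvars_add: "mvars p \<subseteq> V \<Longrightarrow> mvars q \<subseteq> V \<Longrightarrow> mvars (p + q) \<subseteq> V"
  unfolding mvars_subset_iff using Poly_Mapping.keys_add[of p q] by blast

lemma mvars_mult:
  assumes "mvars p \<subseteq> V" "mvars q \<subseteq> V"
  shows "mvars (p * q) \<subseteq> V"
  unfolding mvars_subset_iff
proof
  fix m assume "m \<in> keys (p * q)"
  then obtain a b where "a \<in> keys p" "b \<in> keys q" "m = a + b"
    using keys_mult[of p q] by blast
  then show "keys m \<subseteq> V"
    using assms Poly_Mapping.keys_add[of a b] unfolding mvars_subset_iff by blast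
qed

lemma mvars_0 [simp]: "mvars 0 = {}" and mvars_1 [simp]: "mvars 1 = {}"
  by (simp_all add: mvars_def)

lemma mvars_uminus [simp]: "mvars (- p) = mvars p"
  by (simp add: mvars_def)

lemma homog_0 [simp]: "homog n 0" and homog_1: "homog 0 1"
  by (simp_all add: homog_def tdeg_def)

lemma homog_add: "homog n p \<Longrightarrow> homog n q \<Longrightarrow> homog n (p + q)"
  using Poly_Mapping.keys_add[of p q] unfolding homog_def by blast

lemma homog_uminus: "homog n p \<Longrightarrow> homog n (- p)"
  by (simp add: homog_def)

lemma homog_sum: "(\<And>a. a \<in> A \<Longrightarrow> homog n (g a)) \<Longrightarrow> homog n (sum g A)"
  by (induction A rule: infinite_finite_induct) (auto simp: homog_add)

lemma mvars_sum: "(\<And>a. a \<in> A \<Longrightarrow> mvars (g a) \<subseteq> V) \<Longrightarrow> mvars (sum g A) \<subseteq> V"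
  by (induction A rule: infinite_finite_induct) (auto simp: mvars_add)

lemma homog_prod:
  "(\<And>a. a \<in> A \<Longrightarrow> homog 1 (g a)) \<Longrightarrow> finite A \<Longrightarrow> homog (card A) (prod g A)"
proof (induction A rule: infinite_finite_induct)
  case (insert x A)
  then show ?case using homog_mult[of 1 "g x" "card A" "prod g A"] by simp
qed (simp_all add: homog_1)

lemma mvars_prod: "(\<And>a. a \<in> A \<Longrightarrow> mvars (g a) \<subseteq> V) \<Longrightarrow> mvars (prod g A) \<subseteq> V"
  by (induction A rule: infinite_finite_induct) (auto simp: mvars_mult)

section \<open>Determinants of linear forms in the coefficients\<close>

lemma det_homog_mvars:
  fixes E :: "nat \<Rightarrow> nat \<Rightarrow> 'v cpoly"
  assumes h: "\<And>i j. homog 1 (E i j)" and v: "\<And>i j. mvars (E i j) \<subseteq> V"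
  shows "homog n (det (mat n n (\<lambda>(i, j). E i j)))" "mvars (det (mat n n (\<lambda>(i, j). E i j))) \<subseteq> V"
proof -
  let ?A = "mat n n (\<lambda>(i, j). E i j)"
  have d: "det ?A = (\<Sum>p\<in>{p. p permutes {0..<n}}. signof p * (\<Prod>i = 0..<n. ?A $$ (i, p i)))"
    by (rule det_def') simp
  have pe: "(\<Prod>i = 0..<n. ?A $$ (i, p i)) = (\<Prod>i = 0..<n. E i (p i))" if "p permutes {0..<n}" for p
    using permutes_in_image[OF that] by (intro prod.cong refl) auto
  have s: "signof p * q = q \<or> signof p * q = - q" for p and q :: "'v cpoly" by (simp add: sign_def)
  have hp: "homog n (\<Prod>i = 0..<n. E i (p i))" for p
    using homog_prod[of "{0..<n}" "\<lambda>i. E i (p i)"] h by simp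
  have vp: "mvars (\<Prod>i = 0..<n. E i (p i)) \<subseteq> V" for p by (rule mvars_prod) (rule v)
  show "homog n (det ?A)" unfolding d
  proof (rule homog_sum)
    fix p assume "p \<in> {p. p permutes {0..<n}}"
    then have "p permutes {0..<n}" by simp
    then show "homog n (signof p * (\<Prod>i = 0..<n. ?A $$ (i, p i)))"
      unfolding pe[OF \<open>p permutes {0..<n}\<close>]
      using s[of p "\<Prod>i = 0..<n. E i (p i)"] by (elim disjE) (simp_all only: hp homog_uminus)
  qed
  show "mvars (det ?A) \<subseteq> V" unfolding d
  proof (rule mvars_sum)
    fix p assume "p \<in> {p. p permutes {0..<n}}"
    then have "p permutes {0..<n}" by simp
    then show "mvars (signof p * (\<Prod>i = 0..<n. ?A $$ (i, p i))) \<subseteq> V"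
      unfolding pe[OF \<open>p permutes {0..<n}\<close>]
      using s[of p "\<Prod>i = 0..<n. E i (p i)"] by (elim disjE) (simp_all only: vp mvars_uminus)
  qed
qed

interpretation mev: comm_ring_hom "meval a" for a :: "'v \<Rightarrow> complex"
  by unfold_locales (simp_all add: meval_eq_ev cid.ev_add cid.ev_mult)

lemma finite_Mon: "finite (Mon d)"
proof (rule finite_subset)
  show "Mon d \<subseteq> (\<lambda>(i, j, k). expo i j k) ` triples d"
  proof
    fix m assume "m \<in> Mon d"
    then have m: "keys m \<subseteq> {0,1,2}" "tdeg m = d" by (auto simp: Mon_def)
    let ?t = "(lookup m 0, lookup m 1, lookup m (2::nat))"
    have e: "m = (\<lambda>(i, j, k). expo i j k) ?t" using expo_lookup[OF m(1)] by simp
    moreover have "?t \<in> triples d" using m(2) tdeg_expo e by (metis (mono_tags, lifting) case_prod_conv mem_Collect_eq triples_def)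
    ultimately show "m \<in> (\<lambda>(i, j, k). expo i j k) ` triples d" by (rule image_eqI)
  qed
qed (simp add: finite_triples)

lemma sum_Mon:
  assumes "in_S f" "homog d f"
  shows "f = (\<Sum>m\<in>Mon d. single m (lookup f m))"
proof -
  have "keys f \<subseteq> Mon d" using assms by (auto simp: in_S_iff homog_def Mon_def)
  then have "(\<Sum>m\<in>Mon d. single m (lookup f m))
    = (\<Sum>m\<in>keys f. single m (lookup f m))"
    using finite_Mon by (intro sum.mono_neutral_right) (auto simp: in_keys_iff)
  then show ?thesis by (simp add: sum_single_lookup)
qed

lemma grad_add: "grad (f + g) = grad f + grad g"
  by (simp add: grad_def fx_def fy_def fz_def pderiv_add \<Phi>_add)

lemma grad_0: "grad 0 = 0"
  by (simp add: grad_def fx_def fy_def fz_def pderiv_0 \<Phi>_0 zero_triple)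

lemma grad_sum: "grad (sum g A) = (\<Sum>a\<in>A. grad (g a))"
  by (induction A rule: infinite_finite_induct) (auto simp: grad_add grad_0)

lemma pderiv_scale: "Defs.pderiv i (single m c) = const c * Defs.pderiv i (single m 1)"
  by (simp add: pderiv_single const_def mult_single mult.commute)

lemma grad_single: "grad (single m c) = smul (K c) (grad (single m 1))"
  unfolding grad_def fx_def fy_def fz_def
  by (subst (1 2 3) pderiv_scale) (simp add: \<Phi>_mult \<Phi>_const)

lemma dot_add_right: "dot u (v + w) = dot u v + dot u w"
  and dot_smul_right: "dot u (smul p v) = p * dot u v"
  by (cases u; cases v; cases w; simp add: algebra_simps)+

lemma dot_sum_right: "dot u (sum g A) = (\<Sum>a\<in>A. dot u (g a))"
proof -
  have "dot u 0 = 0" by (cases u) (simp add: zero_triple)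
  then show ?thesis by (induction A rule: infinite_finite_induct) (auto simp: dot_add_right)
qed

lemma dot_sum_left: "dot (sum g A) u = (\<Sum>a\<in>A. dot (g a) u)"
  by (induction A rule: infinite_finite_induct) (auto simp: dot_add_left)

text \<open>The forms \<open>\<mu>\<^sub>i(b\<^sub>j \<cdot> grad f)\<close>, with \<open>b\<^sub>j\<close> a basis of \<open>R\<^sub>k\<^sup>3\<close> and \<open>\<mu>\<^sub>i\<close> functionals dual to
  the \<open>b\<^sub>j \<cdot> grad f0\<close>, are linear in the coefficients of \<open>f\<close>. Their determinant is 1 at \<open>f0\<close> and
  vanishes wherever \<open>f\<close> has a syzygy of degree \<open>k\<close>.\<close>

lemma syzygy_determinant:
  assumes f0: "in_S f0" "homog d f0" and no: "\<And>\<sigma>. \<sigma> \<in> Syz (grad f0) \<Longrightarrow> hom3 k \<sigma> \<Longrightarrow> \<sigma> = 0"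
  shows "\<exists>P. mvars P \<subseteq> Mon d \<and> (\<exists>n. homog n P) \<and> meval (lookup f0) P \<noteq> 0
    \<and> (\<forall>f. in_S f \<longrightarrow> homog d f \<longrightarrow> (\<exists>\<sigma>\<in>Syz (grad f). hom3 k \<sigma> \<and> \<sigma> \<noteq> 0) \<longrightarrow> meval (lookup f) P = 0)"
proof -
  obtain B where B: "B \<subseteq> S3 k" "VT.independent B" "S3 k \<subseteq> VT.span B" by (rule VT.maximal_independent_subset)
  obtain D where "VT.spans_mod (S3 k) {0} D" using qdim_S3(1)[of k] unfolding VT.fin_quot_def by blast
  then have finB: "finite B" using VT.independent_span_bound[of D B] B unfolding VT.spans_mod_def by auto
  define n where "n = card B"
  obtain b where b: "bij_betw b {0..<n} B" using ex_bij_betw_nat_finite[OF finB] unfolding n_def by blast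
  have bB: "b j \<in> B" if "j < n" for j using b that by (auto simp: bij_betw_def)
  have injb: "inj_on b {0..<n}" and imb: "b ` {0..<n} = B" using b by (auto simp: bij_betw_def)
  have reB: "(\<Sum>x\<in>B. g x) = (\<Sum>j = 0..<n. g (b j))" for g :: "R3 \<Rightarrow> R3"
    using sum.reindex_bij_betw[OF b, of g] by simp
  define u where "u f j = dot (b j) (grad f)" for f j
  have comb: "dot (\<Sum>j = 0..<n. smul (K (c j)) (b j)) (grad f) = (\<Sum>j = 0..<n. K (c j) * u f j)" for c f
    unfolding dot_sum_left dot_smul_left u_def ..
  \<comment> \<open>A linear relation between the products \<open>u f0 j\<close> is a syzygy of
    degree \<open>k\<close>, so it is trivial.\<close>
  have ind: "c j = 0" if s: "(\<Sum>j = 0..<n. K (c j) * u f0 j) = 0" and j: "j < n" for c j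
  proof -
    let ?v = "\<Sum>j = 0..<n. smul (K (c j)) (b j)"
    have "?v \<in> Syz (grad f0)" using comb[of c f0] s by (simp add: Syz_def)
    moreover have "?v \<in> S3 k" using bB B(1) by (intro VT.subspace_sum[OF subspace_S3] VT.subspace_scale[OF subspace_S3]) auto
    ultimately have v0: "?v = 0" using no by (simp add: S3_def)
    let ?u = "\<lambda>x. c (the_inv_into {0..<n} b x)"
    have "(\<Sum>x\<in>B. smul (K (?u x)) x) = ?v"
      unfolding reB by (intro sum.cong refl) (simp add: the_inv_into_f_f[OF injb])
    then have s0: "(\<Sum>x\<in>B. smul (K (?u x)) x) = 0" using v0 by (simp only:)
    have "?u (b j) = 0" by (rule VT.independentD[OF B(2) finB order_refl s0 bB[OF j]])
    then show ?thesis using the_inv_into_f_f[OF injb, of j] j by simp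
  qed
  have inju: "u f0 i = u f0 j \<Longrightarrow> i = j" if "i < n" "j < n" for i j
  proof (rule ccontr)
    assume eq: "u f0 i = u f0 j" and ne: "i \<noteq> j"
    let ?c = "\<lambda>l. if l = i then 1 else if l = j then -1 else (0::complex)"
    have "(\<Sum>l = 0..<n. K (?c l) * u f0 l) = (\<Sum>l = 0..<n. (if l = i then u f0 i else 0) - (if l = j then u f0 j else 0))"
      using ne by (intro sum.cong refl) (auto simp: K_1 K_0 K_uminus)
    also have "\<dots> = 0" using that eq by (simp add: sum_subtractf)
    finally show False using ind[of ?c i] that by simp
  qed
  let ?U = "u f0 ` {0..<n}"
  have injU: "inj_on (u f0) {0..<n}" using inju by (auto simp: inj_on_def)
  have indU: "VR.independent ?U"
  proof (rule VR.independent_if_scalars_zero)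
    fix c x assume s: "(\<Sum>x\<in>?U. K (c x) * x) = 0" and x: "x \<in> ?U"
    have "(\<Sum>j = 0..<n. K (c (u f0 j)) * u f0 j) = 0" using s sum.reindex[OF injU, of "\<lambda>x. K (c x) * x"] by (simp add: o_def)
    from ind[OF this] show "c x = 0" using x by auto
  qed simp
  \<comment> \<open>The dual functionals are coordinates with respect to a basis of the whole ring
    that extends the products \<open>u f0 j\<close>.\<close>
  define E where "E = VR.extend_basis ?U"
  have E: "?U \<subseteq> E" "VR.independent E" "VR.span E = UNIV"
    unfolding E_def using VR.extend_basis_superset[OF indU] VR.independent_extend_basis[OF indU] VR.span_extend_basis[OF indU]
    by auto
  define \<mu> where "\<mu> i p = VR.representation E p (u f0 i)" for i p
  have mu_add: "\<mu> i (p + q) = \<mu> i p + \<mu> i q" and mu_scale: "\<mu> i (K c * p) = c * \<mu> i p" for i p q c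
    unfolding \<mu>_def using VR.representation_add[OF E(2)] VR.representation_scale[OF E(2)] E(3) by auto
  have mu_0: "\<mu> i 0 = 0" for i using mu_scale[of i 0 0] by simp
  have mu_sum: "\<mu> i (sum g A) = (\<Sum>a\<in>A. \<mu> i (g a))" for i A and g :: "'b \<Rightarrow> R"
    by (induction A rule: infinite_finite_induct) (auto simp: mu_add mu_0)
  have mu_u: "\<mu> i (u f0 j) = (if i = j then 1 else 0)" if "i < n" "j < n" for i j
  proof -
    have "u f0 j \<in> E" using E(1) that by auto
    from VR.representation_basis[OF E(2) this] show ?thesis unfolding \<mu>_def using inju that by auto
  qed
  \<comment> \<open>\<open>single (single m 1)\<close> is the coordinate of the space of forms that
    belongs to the monomial \<open>m\<close>. As \<open>u f j\<close> is linear in \<open>f\<close>,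
    its values at monomials determine the linear form.\<close>
  define e where "e i j = (\<Sum>m\<in>Mon d. single (single m (1::nat)) (\<mu> i (u (single m 1) j)))" for i j
  have eh: "homog 1 (e i j)" for i j unfolding e_def by (rule homog_sum) (simp add: homog_def)
  have ev: "mvars (e i j) \<subseteq> Mon d" for i j unfolding e_def by (rule mvars_sum) (auto simp: mvars_def)
  have me: "meval (lookup f) (e i j) = \<mu> i (u f j)" if f: "in_S f" "homog d f" for f i j
  proof -
    have "u f j = dot (b j) (grad (\<Sum>m\<in>Mon d. single m (lookup f m)))"
      unfolding u_def using sum_Mon[OF f] by simp
    also have "\<dots> = (\<Sum>m\<in>Mon d. K (lookup f m) * u (single m 1) j)"
      unfolding grad_sum dot_sum_right u_def by (intro sum.cong refl) (subst grad_single, rule dot_smul_right)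
    finally have "\<mu> i (u f j) = (\<Sum>m\<in>Mon d. lookup f m * \<mu> i (u (single m 1) j))"
      by (simp add: mu_sum mu_scale)
    also have "\<dots> = meval (lookup f) (e i j)"
      unfolding meval_eq_ev e_def cid.ev_sum cid.ev_single by (simp add: mono_val_single mult.commute)
    finally show ?thesis by simp
  qed
  define P where "P = det (mat n n (\<lambda>(i, j). e i j))"
  have mP: "meval (lookup f) P = det (mat n n (\<lambda>(i, j). \<mu> i (u f j)))" if "in_S f" "homog d f" for f
  proof -
    have "map_mat (meval (lookup f)) (mat n n (\<lambda>(i, j). e i j)) = mat n n (\<lambda>(i, j). \<mu> i (u f j))"
      by (rule eq_matI) (auto simp: me[OF that])
    then show ?thesis unfolding P_def mev.hom_det[symmetric] by simp
  qed
  show ?thesis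
  proof (intro exI[of _ P] conjI allI impI)
    show "mvars P \<subseteq> Mon d" "\<exists>n. homog n P" unfolding P_def
      by (rule det_homog_mvars(2)[OF eh ev], rule exI, rule det_homog_mvars(1)[OF eh ev])
    have "mat n n (\<lambda>(i, j). \<mu> i (u f0 j)) = 1\<^sub>m n" by (rule eq_matI) (auto simp: mu_u)
    then show "meval (lookup f0) P \<noteq> 0" using mP[OF f0] by simp
    fix f assume f: "in_S f" "homog d f" and "\<exists>\<sigma>\<in>Syz (grad f). hom3 k \<sigma> \<and> \<sigma> \<noteq> 0"
    then obtain \<sigma> where s: "\<sigma> \<in> Syz (grad f)" "\<sigma> \<in> S3 k" "\<sigma> \<noteq> 0" by (auto simp: S3_def)
    then obtain a where "\<sigma> = (\<Sum>x\<in>B. smul (K (a x)) x)" using B(3) VT.span_finite[OF finB] by blast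
    then have sa: "\<sigma> = (\<Sum>j = 0..<n. smul (K (a (b j))) (b j))" unfolding reB .
    \<comment> \<open>The coordinates of the syzygy with respect to \<open>b\<close> form a nonzero
      vector in the kernel of the matrix.\<close>
    let ?A = "mat n n (\<lambda>(i, j). \<mu> i (u f j))" and ?v = "vec n (\<lambda>j. a (b j))"
    have "?v \<noteq> 0\<^sub>v n"
    proof
      assume "?v = 0\<^sub>v n"
      then have "a (b j) = 0" if "j < n" for j using that by (metis index_vec index_zero_vec(1))
      then have "\<sigma> = 0" unfolding sa by (intro sum.neutral) (simp add: K_0)
      then show False using s by simp
    qed
    moreover have "?A *\<^sub>v ?v = 0\<^sub>v n"
    proof (rule eq_vecI)
      fix i assume i: "i < dim_vec (0\<^sub>v n :: complex vec)"
      have "(?A *\<^sub>v ?v) $ i = (\<Sum>j = 0..<n. \<mu> i (u f j) * a (b j))"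
        using i by (simp add: scalar_prod_def)
      also have "\<dots> = \<mu> i (\<Sum>j = 0..<n. K (a (b j)) * u f j)" unfolding mu_sum mu_scale by (simp add: mult.commute)
      also have "(\<Sum>j = 0..<n. K (a (b j)) * u f j) = 0" using s(1) comb[of "\<lambda>j. a (b j)" f] sa by (simp add: Syz_def)
      finally show "(?A *\<^sub>v ?v) $ i = 0\<^sub>v n $ i" using i by (simp add: mu_0)
    qed simp
    moreover have "?v \<in> carrier_vec n" by simp
    ultimately have "\<exists>v. v \<in> carrier_vec n \<and> v \<noteq> 0\<^sub>v n \<and> ?A *\<^sub>v v = 0\<^sub>v n" by blast
    moreover have "?A \<in> carrier_mat n n" by simp
    ultimately have "det ?A = 0" using det_0_iff_vec_prod_zero by blast
    then show "meval (lookup f) P = 0" using mP[OF f] by simp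
  qed
qed

text \<open>A nonzero syzygy of lower degree can be multiplied by a power of \<open>X\<close> into
  degree \<open>k\<close>. So the top degree alone decides, and one determinant is enough.\<close>

lemma no_syz_below_Suc:
  "no_syz_below w (Suc k) \<longleftrightarrow> (\<forall>\<sigma>\<in>Syz w. hom3 k \<sigma> \<longrightarrow> \<sigma> = 0)"
proof
  assume n: "\<forall>\<sigma>\<in>Syz w. hom3 k \<sigma> \<longrightarrow> \<sigma> = 0"
  show "no_syz_below w (Suc k)"
    unfolding no_syz_below_def
  proof (intro allI impI ballI)
    fix l \<sigma> assume l: "l < Suc k" "\<sigma> \<in> Syz w" "hom3 l \<sigma>"
    have "hom3 (k - l + l) (smul (X ^ (k - l)) \<sigma>)" using hom3_smul[OF hom_power[OF hom_X] l(3), of "k - l"] by simp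
    moreover have "smul (X ^ (k - l)) \<sigma> \<in> Syz w" using l by (simp add: Syz_def dot_smul_left)
    ultimately have "smul (X ^ (k - l)) \<sigma> = 0" using n l(1) by simp
    then show "\<sigma> = 0" by (simp add: smul_eq_0_iff X_def)
  qed
qed (unfold no_syz_below_def, blast)

lemma zariski_open_all: "zariski_open_in d A A"
  unfolding zariski_open_in_def
  by (intro conjI order_refl exI[of _ "{1}"]) (auto simp: homog_1 meval_eq_ev intro: exI[of _ 0])

lemma zariski_open_empty: "zariski_open_in d {} A"
  unfolding zariski_open_in_def by (intro conjI empty_subsetI exI[of _ "{}"]) auto

text \<open>Take for \<open>G\<close> all forms vanishing on the complement; then openness may be
  checked at one point at a time, with a form depending on that point.\<close>

lemma zariski_openI:
  assumes "A \<subseteq> B" and P: "\<And>f0. f0 \<in> A \<Longrightarrow> \<exists>P. mvars P \<subseteq> Mon d \<and> (\<exists>n. homog n P)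
    \<and> meval (lookup f0) P \<noteq> 0 \<and> (\<forall>f\<in>B - A. meval (lookup f) P = 0)"
  shows "zariski_open_in d A B"
  unfolding zariski_open_in_def
proof (intro conjI assms(1))
  let ?G = "{P. mvars P \<subseteq> Mon d \<and> (\<exists>k. homog k P) \<and> (\<forall>f\<in>B - A. meval (lookup f) P = 0)}"
  have "\<forall>f\<in>B. f \<in> A \<longleftrightarrow> (\<exists>P\<in>?G. meval (lookup f) P \<noteq> 0)"
  proof
    fix f assume f: "f \<in> B"
    show "f \<in> A \<longleftrightarrow> (\<exists>P\<in>?G. meval (lookup f) P \<noteq> 0)"
    proof
      assume "f \<in> A"
      from P[OF this] show "\<exists>P\<in>?G. meval (lookup f) P \<noteq> 0" by blast
    qed (use f in blast)
  qed
  moreover have "\<forall>P\<in>?G. mvars P \<subseteq> Mon d \<and> (\<exists>k. homog k P)" by blast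
  ultimately show "\<exists>G. (\<forall>P\<in>G. mvars P \<subseteq> Mon d \<and> (\<exists>k. homog k P)) \<and>
      (\<forall>f\<in>B. f \<in> A \<longleftrightarrow> (\<exists>P\<in>G. meval (lookup f) P \<noteq> 0))" by blast
qed

text \<open>The difference of the two values factors as \<open>(r - s) * (e - r - s)\<close>, and
  under the bounds a zero second factor also forces \<open>r = s\<close>.\<close>

lemma tjurina_value_unique:
  fixes e r s :: int
  assumes "2 * r \<le> e" "2 * s \<le> e" "r * (e - r) = s * (e - s)"
  shows "r = s"
proof (rule ccontr)
  assume ne: "r \<noteq> s"
  have "(r - s) * (e - r - s) = 0" using assms(3) by (simp add: algebra_simps)
  then have "e - r - s = 0" using ne by simp
  then show False using assms ne by simp
qed

lemma free_locus_open: "zariski_open_in d (Fdt d t) (Cdt d t)"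
proof (cases "d = 0")
  case True
  have p0: "Defs.pderiv i f = 0" if "homog 0 f" for f :: mpoly and i
  proof (rule poly_mapping_eqI)
    fix m
    have "m + single i 1 \<notin> keys f"
    proof
      assume "m + single i 1 \<in> keys f"
      then have "tdeg (m + single i 1) = 0" using \<open>homog 0 f\<close> unfolding homog_def by (rule bspec[rotated])
      then show False by (simp add: tdeg_add)
    qed
    then have "lookup f (m + single i 1) = 0" unfolding in_keys_iff by blast
    then show "lookup (Defs.pderiv i f) m = lookup 0 m" by (simp add: lookup_pderiv)
  qed
  have "is_free f \<longleftrightarrow> is_free g" if "f \<in> Cdt d t" "g \<in> Cdt d t" for f g
  proof -
    have "homog 0 f" "homog 0 g" using that True by (auto simp: Cdt_def)
    then have "AR f = AR g" by (simp add: AR_def fx_def fy_def fz_def p0)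
    then show ?thesis unfolding is_free_def free_exps_def by simp
  qed
  then have "Fdt d t = Cdt d t \<or> Fdt d t = {}" unfolding Fdt_def by blast
  then show ?thesis using zariski_open_all zariski_open_empty by metis
next
  case False
  then have d: "d \<ge> 1" by simp
  have C: "in_S f" "homog d f" "f \<noteq> 0" "reduced f" "tjurina f = t" if "f \<in> Cdt d t" for f
    using that by (auto simp: Cdt_def)
  note crit = free_criterion[OF C(1-3) d C(4)]
  let ?eq = "\<lambda>r. 2 * r \<le> d - 1 \<and> int t = (int d - 1)^2 - int r * (int d - int r - 1)"
  show ?thesis
  proof (cases "\<exists>r. ?eq r")
    case False
    then have "Fdt d t = {}" using crit C(5) unfolding Fdt_def by blast
    then show ?thesis using zariski_open_empty by simp
  next
    case True
    then obtain r where r: "?eq r" by blast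
    \<comment> \<open>Thus \<open>d\<close> and \<open>t\<close> alone determine the smaller
      exponent of every free curve in \<open>Cdt d t\<close>.\<close>
    have uniq: "s = r" if s: "?eq s" for s
    proof -
      have "2 * int s \<le> int d - 1" "2 * int r \<le> int d - 1" using r s d by linarith+
      moreover have "int d - int x - 1 = (int d - 1) - int x" for x by simp
      then have "int s * ((int d - 1) - int s) = int r * ((int d - 1) - int r)" using r s by (metis add_diff_cancel_left' diff_add_cancel diff_diff_eq2)
      ultimately show ?thesis using tjurina_value_unique[of "int s" "int d - 1" "int r"] by simp
    qed
    have free: "is_free f \<longleftrightarrow> no_syz_below (grad f) r" if f: "f \<in> Cdt d t" for f
      unfolding crit[OF f f f f] C(5)[OF f] using r uniq by blast
    show ?thesis
    proof (cases r)
      case 0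
      \<comment> \<open>There are no degrees below 0, so the condition on syzygies is vacuous and
        every curve is free.\<close>
      then have "Fdt d t = Cdt d t" unfolding Fdt_def using free by (auto simp: no_syz_below_def)
      then show ?thesis using zariski_open_all by simp
    next
      case (Suc k)
      note nf = free[unfolded Suc no_syz_below_Suc]
      show ?thesis
      proof (rule zariski_openI)
        show "Fdt d t \<subseteq> Cdt d t" by (auto simp: Fdt_def)
        fix f0 assume "f0 \<in> Fdt d t"
        then have f0: "f0 \<in> Cdt d t" "\<And>\<sigma>. \<sigma> \<in> Syz (grad f0) \<Longrightarrow> hom3 k \<sigma> \<Longrightarrow> \<sigma> = 0"
          using nf by (auto simp: Fdt_def)
        obtain P where P: "mvars P \<subseteq> Mon d" "\<exists>n. homog n P" "meval (lookup f0) P \<noteq> 0"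
          "\<forall>f. in_S f \<longrightarrow> homog d f \<longrightarrow> (\<exists>\<sigma>\<in>Syz (grad f). hom3 k \<sigma> \<and> \<sigma> \<noteq> 0) \<longrightarrow> meval (lookup f) P = 0"
          using syzygy_determinant[OF C(1,2)[OF f0(1)] f0(2)] by blast
        have "meval (lookup f) P = 0" if f: "f \<in> Cdt d t - Fdt d t" for f
        proof -
          have "f \<in> Cdt d t" "\<not> is_free f" using f by (auto simp: Fdt_def)
          then show ?thesis using P(4) C(1,2)[of f] nf[of f] by blast
        qed
        then show "\<exists>P. mvars P \<subseteq> Mon d \<and> (\<exists>n. homog n P) \<and> meval (lookup f0) P \<noteq> 0
          \<and> (\<forall>f\<in>Cdt d t - Fdt d t. meval (lookup f) P = 0)"
          using P(1-3) by blast
      qed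
    qed
  qed
qed

theorem theorem1p1:
  fixes f :: mpoly and d r0 :: nat
  assumes "in_S f" and "homog d f" and "f \<noteq> 0" and "d \<ge> 1" and "reduced f"
    and "r0 \<ge> 1" and "r0 \<le> mdr f"
  shows "int (tjurina f) \<le> (int d - 1)^2 - int r0 * (int d - int r0 - 1)
    \<and> (int (tjurina f) = (int d - 1)^2 - int r0 * (int d - int r0 - 1)
           \<longleftrightarrow> free_exps f r0 (d - r0 - 1))
    \<and> (\<forall>d' t. zariski_open_in d' (Fdt d' t) (Cdt d' t))"
  using tjurina_bound(2,3)[OF assms(1-5) no_syz_below_mdr[OF assms(1,7)]] free_locus_open by blast

end
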